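(* Let $\Gamma$ be a Coxeter graph with Coxeter system $(W,S)$. Then $\pi_1(\overline{\mathrm{Sal}}(\Gamma), x_0) = A_\Gamma$, $\pi_1(\mathrm{Sal}(\Gamma), x(1)) = CA_\Gamma$ (up to isomorphism), and, under these identifications, the exact sequence associated with the regular covering $\mathrm{Sal}(\Gamma) \to \overline{\mathrm{Sal}}(\Gamma)$ is $$1 \to CA_\Gamma \to A_\Gamma \xrightarrow{\ \theta\ } W \to 1 .$$
   Context: **Coxeter and Artin groups.** Let $S$ be a finite set. A Coxeter matrix over $S$ is $M = (m_{s,t})_{s,t\in S}$ with $m_{s,s}=1$ and $m_{s,t}=m_{t,s}\in\{2,3,\dots\}\cup\{\infty\}$ for $s\ne t$; its Coxeter graph $\Gamma$ has vertex set $S$, with $s,t$ joined by an edge if $m_{s,t}\ge3$, labelled by $m_{s,t}$ if $m_{s,t}\ge4$. The Coxeter group is $W = \langle S \mid s^2=1\ (s\in S),\ (st)^{m_{s,t}}=1\ (s\ne t,\ m_{s,t}\ne\infty)\rangle$, and $(W,S)$ is the Coxeter system of $\Gamma$. Let $\Pi(a,b:m)$ be the alternating word $aba\cdots$ of length $m$. The Artin group is $A_\Gamma = \langle \sigma_s\ (s \in S) \mid \Pi(\sigma_s,\sigma_t:m_{s,t}) = \Pi(\sigma_t,\sigma_s:m_{s,t})\ (s\neq t,\ m_{s,t}\ne\infty)\rangle$. The homomorphism $\theta : A_\Gamma \to W$ sends $\sigma_s$ to $s$ for all $s \in S$; its kernel is the colored Artin group $CA_\Gamma$. **Salvetti complex.**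 For $X \subset S$, $W_X$ is the subgroup of $W$ generated by $X$, and $\mathcal{S}^f = \{X \subset S \mid W_X \text{ is finite}\}$. An element $w \in W$ is $(\emptyset,X)$-minimal if it has minimal word length (with respect to $S$) in $wW_X$. The set $W \times \mathcal{S}^f$ is partially ordered by: $(u,X) \preceq (v,Y)$ if $X \subset Y$, $v^{-1}u \in W_Y$, and $v^{-1}u$ is $(\emptyset,X)$-minimal. The derived complex of a poset is the abstract simplicial complex whose simplices are its nonempty finite chains. $\mathrm{Sal}(\Gamma)$ is the geometric realization (weak topology) of the derived complex of $(W \times \mathcal{S}^f, \preceq)$. The group $W$ acts on it freely and properly discontinuously via $w\cdot(u,X) = (wu,X)$, and $\overline{\mathrm{Sal}}(\Gamma) = \mathrm{Sal}(\Gamma)/W$. For $w \in W$, $x(w)$ is the vertex of $\mathrm{Sal}(\Gamma)$ corresponding to $(w,\emptyset)$; all the $x(w)$ have the same image $x_0$ in $\overline{\mathrm{Sal}}(\Gamma)$. *)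

theory Defs
  imports
    "HOL-Analysis.Analysis"
    "HOL-Algebra.Group_Action"
    "HOL-Algebra.Generated_Groups"
    "HOL-Algebra.Exact_Sequence"
    "HOL-Library.Extended_Nat"
begin

section \<open>Groups given by generators and relations\<close>

text \<open>A letter \<open>(s, True)\<close> stands for the generator \<open>s\<close>, a letter \<open>(s, False)\<close> for its formal
  inverse. A relation \<open>u = v\<close> is encoded as the pair \<open>(u, v)\<close>, and the presented group
  consists of the words modulo the smallest congruence that contains the relations and free
  cancellation.\<close>

type_synonym 's gword = "('s \<times> bool) list"

inductive pres_eq :: "'s set \<Rightarrow> ('s gword \<times> 's gword) set \<Rightarrow> 's gword \<Rightarrow> 's gword \<Rightarrow> bool"
  for S R where
  refl: "w \<in> lists (S \<times> UNIV) \<Longrightarrow> pres_eq S R w w"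
| sym: "pres_eq S R u v \<Longrightarrow> pres_eq S R v u"
| trans: "pres_eq S R u v \<Longrightarrow> pres_eq S R v w \<Longrightarrow> pres_eq S R u w"
| append: "pres_eq S R u u' \<Longrightarrow> pres_eq S R v v' \<Longrightarrow> pres_eq S R (u @ v) (u' @ v')"
| cancel: "s \<in> S \<Longrightarrow> pres_eq S R [(s, b), (s, \<not> b)] []"
| rel: "(u, v) \<in> R \<Longrightarrow> u \<in> lists (S \<times> UNIV) \<Longrightarrow> v \<in> lists (S \<times> UNIV) \<Longrightarrow> pres_eq S R u v"

definition pres_class :: "'s set \<Rightarrow> ('s gword \<times> 's gword) set \<Rightarrow> 's gword \<Rightarrow> 's gword set" where
  "pres_class S R w = {v. pres_eq S R w v}"

definition presented_group :: "'s set \<Rightarrow> ('s gword \<times> 's gword) set \<Rightarrow> 's gword set monoid" where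
  "presented_group S R =
     \<lparr>carrier = pres_class S R ` lists (S \<times> UNIV),
      mult = (\<lambda>A B. \<Union>a\<in>A. \<Union>b\<in>B. pres_class S R (a @ b)),
      one = pres_class S R []\<rparr>"

definition pres_gen :: "'s set \<Rightarrow> ('s gword \<times> 's gword) set \<Rightarrow> 's \<Rightarrow> 's gword set" where
  "pres_gen S R s = pres_class S R [(s, True)]"

definition eval_word :: "('g, 'h) monoid_scheme \<Rightarrow> ('s \<Rightarrow> 'g) \<Rightarrow> 's gword \<Rightarrow> 'g" where
  "eval_word G f w =
     foldr (\<lambda>(s, b) g. (if b then f s else inv\<^bsub>G\<^esub> (f s)) \<otimes>\<^bsub>G\<^esub> g) w \<one>\<^bsub>G\<^esub>"

text \<open>The homomorphism from a presented group to \<open>G\<close> that takes the value \<open>f s\<close> on the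
  generator \<open>s\<close> (meaningful when the values \<open>f s\<close> satisfy the relations: then all
  words in a class have the same evaluation).\<close>

definition pres_hom :: "('g, 'h) monoid_scheme \<Rightarrow> ('s \<Rightarrow> 'g) \<Rightarrow> 's gword set \<Rightarrow> 'g" where
  "pres_hom G f a = the_elem (eval_word G f ` a)"


section \<open>Coxeter groups and Artin groups\<close>

definition coxeter_matrix :: "'s set \<Rightarrow> ('s \<Rightarrow> 's \<Rightarrow> enat) \<Rightarrow> bool" where
  "coxeter_matrix S m \<longleftrightarrow>
     (\<forall>s\<in>S. m s s = 1) \<and>
     (\<forall>s\<in>S. \<forall>t\<in>S. s \<noteq> t \<longrightarrow> m s t = m t s \<and> 2 \<le> m s t)"

fun alternating :: "nat \<Rightarrow> 'a \<Rightarrow> 'a \<Rightarrow> 'a list" where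
  "alternating 0 a b = []"
| "alternating (Suc n) a b = a # alternating n b a"

definition coxeter_relations :: "'s set \<Rightarrow> ('s \<Rightarrow> 's \<Rightarrow> enat) \<Rightarrow> ('s gword \<times> 's gword) set" where
  "coxeter_relations S m =
     {([(s, True), (s, True)], []) | s. s \<in> S} \<union>
     {(concat (replicate k [(s, True), (t, True)]), []) | s t k.
        s \<in> S \<and> t \<in> S \<and> s \<noteq> t \<and> m s t = enat k}"

definition artin_relations :: "'s set \<Rightarrow> ('s \<Rightarrow> 's \<Rightarrow> enat) \<Rightarrow> ('s gword \<times> 's gword) set" where
  "artin_relations S m =
     {(alternating k (s, True) (t, True), alternating k (t, True) (s, True)) | s t k.
        s \<in> S \<and> t \<in> S \<and> s \<noteq> t \<and> m s t = enat k}"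

definition coxeter_group :: "'s set \<Rightarrow> ('s \<Rightarrow> 's \<Rightarrow> enat) \<Rightarrow> 's gword set monoid" where
  "coxeter_group S m = presented_group S (coxeter_relations S m)"

definition coxeter_gen :: "'s set \<Rightarrow> ('s \<Rightarrow> 's \<Rightarrow> enat) \<Rightarrow> 's \<Rightarrow> 's gword set" where
  "coxeter_gen S m = pres_gen S (coxeter_relations S m)"

definition artin_group :: "'s set \<Rightarrow> ('s \<Rightarrow> 's \<Rightarrow> enat) \<Rightarrow> 's gword set monoid" where
  "artin_group S m = presented_group S (artin_relations S m)"

definition artin_gen :: "'s set \<Rightarrow> ('s \<Rightarrow> 's \<Rightarrow> enat) \<Rightarrow> 's \<Rightarrow> 's gword set" where
  "artin_gen S m = pres_gen S (artin_relations S m)"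

definition artin_theta :: "'s set \<Rightarrow> ('s \<Rightarrow> 's \<Rightarrow> enat) \<Rightarrow> 's gword set \<Rightarrow> 's gword set" where
  "artin_theta S m = pres_hom (coxeter_group S m) (coxeter_gen S m)"

definition colored_artin_group :: "'s set \<Rightarrow> ('s \<Rightarrow> 's \<Rightarrow> enat) \<Rightarrow> 's gword set monoid" where
  "colored_artin_group S m =
     (artin_group S m)\<lparr>carrier := kernel (artin_group S m) (coxeter_group S m) (artin_theta S m)\<rparr>"


section \<open>Geometric realization\<close>

text \<open>Points are given by their barycentric coordinates. On each closed simplex only finitely
  many coordinates are nonzero, so the product topology of the type \<open>'v \<Rightarrow> real\<close>
  induces the Euclidean topology there.\<close>

definition closed_simplex :: "'v set \<Rightarrow> ('v \<Rightarrow> real) set" where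
  "closed_simplex \<sigma> =
     {f. (\<forall>v. 0 \<le> f v) \<and> (\<forall>v. v \<notin> \<sigma> \<longrightarrow> f v = 0) \<and> (\<Sum>v\<in>\<sigma>. f v) = 1}"

definition realization :: "'v set set \<Rightarrow> ('v \<Rightarrow> real) topology" where
  "realization K =
     topology (\<lambda>U. U \<subseteq> (\<Union>\<sigma>\<in>K. closed_simplex \<sigma>) \<and>
       (\<forall>\<sigma>\<in>K. openin (top_of_set (closed_simplex \<sigma>)) (U \<inter> closed_simplex \<sigma>)))"

definition vertex_point :: "'v \<Rightarrow> 'v \<Rightarrow> real" where
  "vertex_point v = indicator {v}"

text \<open>The affine extension of a map of vertices.\<close>

definition realization_map :: "('v \<Rightarrow> 'w) \<Rightarrow> ('v \<Rightarrow> real) \<Rightarrow> 'w \<Rightarrow> real" where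
  "realization_map \<phi> f w = (\<Sum>v\<in>{v. f v \<noteq> 0 \<and> \<phi> v = w}. f v)"

definition derived_complex :: "'v set \<Rightarrow> ('v \<Rightarrow> 'v \<Rightarrow> bool) \<Rightarrow> 'v set set" where
  "derived_complex V r =
     {C. C \<subseteq> V \<and> finite C \<and> C \<noteq> {} \<and> (\<forall>a\<in>C. \<forall>b\<in>C. r a b \<or> r b a)}"


section \<open>Fundamental groups\<close>

text \<open>The library's path operations are restricted to topological spaces given by a type class;
  here the space is an arbitrary \<open>'a topology\<close>. Paths are functions on the whole real line of
  which only the values on the unit interval matter, and products of loops traverse the left
  factor first.\<close>

definition loops :: "'a topology \<Rightarrow> 'a \<Rightarrow> (real \<Rightarrow> 'a) set" where
  "loops X x = {p. pathin X p \<and> p 0 = x \<and> p 1 = x}"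

definition path_join :: "(real \<Rightarrow> 'a) \<Rightarrow> (real \<Rightarrow> 'a) \<Rightarrow> real \<Rightarrow> 'a" where
  "path_join p q = (\<lambda>t. if t \<le> 1/2 then p (2 * t) else q (2 * t - 1))"

definition loop_class :: "'a topology \<Rightarrow> 'a \<Rightarrow> (real \<Rightarrow> 'a) \<Rightarrow> (real \<Rightarrow> 'a) set" where
  "loop_class X x p =
     {q. homotopic_with (\<lambda>r. r 0 = x \<and> r 1 = x) (top_of_set {0..1}) X p q}"

definition fundamental_group :: "'a topology \<Rightarrow> 'a \<Rightarrow> (real \<Rightarrow> 'a) set monoid" where
  "fundamental_group X x =
     \<lparr>carrier = loop_class X x ` loops X x,
      mult = (\<lambda>A B. \<Union>a\<in>A. \<Union>b\<in>B. loop_class X x (path_join a b)),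
      one = loop_class X x (\<lambda>_. x)\<rparr>"

definition fundamental_group_map ::
  "'b topology \<Rightarrow> ('a \<Rightarrow> 'b) \<Rightarrow> 'a \<Rightarrow> (real \<Rightarrow> 'a) set \<Rightarrow> (real \<Rightarrow> 'b) set" where
  "fundamental_group_map Y f x A = (\<Union>a\<in>A. loop_class Y (f x) (f \<circ> a))"


section \<open>Orbit spaces and regular coverings\<close>

definition orbit_space ::
  "('g, 'h) monoid_scheme \<Rightarrow> ('g \<Rightarrow> 'a \<Rightarrow> 'a) \<Rightarrow> 'a topology \<Rightarrow> 'a set topology" where
  "orbit_space G \<phi> X =
     topology (\<lambda>U. U \<subseteq> orbits G (topspace X) \<phi> \<and>
       openin X {x \<in> topspace X. orbit G \<phi> x \<in> U})"

text \<open>The analogue of \<^const>\<open>covering_space\<close> for abstract topologies.\<close>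

definition covering_map :: "'a topology \<Rightarrow> 'b topology \<Rightarrow> ('a \<Rightarrow> 'b) \<Rightarrow> bool" where
  "covering_map X Y p \<longleftrightarrow>
     continuous_map X Y p \<and> p ` topspace X = topspace Y \<and>
     (\<forall>y\<in>topspace Y. \<exists>V. openin Y V \<and> y \<in> V \<and>
        (\<exists>\<U>. \<Union>\<U> = {x \<in> topspace X. p x \<in> V} \<and> pairwise disjnt \<U> \<and>
             (\<forall>U\<in>\<U>. openin X U \<and>
                 homeomorphic_map (subtopology X U) (subtopology Y V) p)))"

definition regular_covering :: "'a topology \<Rightarrow> 'b topology \<Rightarrow> ('a \<Rightarrow> 'b) \<Rightarrow> bool" where
  "regular_covering X Y p \<longleftrightarrow>
     covering_map X Y p \<and>
     (\<forall>x\<in>topspace X. \<forall>x'\<in>topspace X. p x = p x' \<longrightarrow>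
        (\<exists>h. homeomorphic_map X X h \<and> (\<forall>z\<in>topspace X. p (h z) = p z) \<and> h x = x'))"

text \<open>For a covering \<open>X \<rightarrow> X/G\<close>: the map \<open>\<pi>\<^sub>1(X/G) \<rightarrow> G\<close> sending the class of a
  loop to the element \<open>g\<close> such that the lift of the loop starting at \<open>x\<close> ends at
  \<open>g \<cdot> x\<close>.\<close>

definition covering_boundary ::
  "('g, 'h) monoid_scheme \<Rightarrow> ('g \<Rightarrow> 'a \<Rightarrow> 'a) \<Rightarrow> 'a topology \<Rightarrow> 'a \<Rightarrow> (real \<Rightarrow> 'a set) set \<Rightarrow> 'g"
  where
  "covering_boundary G \<phi> X x C =
     (THE g. g \<in> carrier G \<and>
        (\<exists>c. pathin X c \<and> c 0 = x \<and> c 1 = \<phi> g x \<and> orbit G \<phi> \<circ> c \<in> C))"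

text \<open>The library's \<^const>\<open>short_exact_sequence\<close> only relates groups over one and the same type.\<close>

definition short_exact ::
  "('a, 'x) monoid_scheme \<Rightarrow> ('b, 'y) monoid_scheme \<Rightarrow> ('c, 'z) monoid_scheme
     \<Rightarrow> ('a \<Rightarrow> 'b) \<Rightarrow> ('b \<Rightarrow> 'c) \<Rightarrow> bool" where
  "short_exact A B C f g \<longleftrightarrow>
     group A \<and> group B \<and> group C \<and> f \<in> mon A B \<and> g \<in> epi B C \<and>
     f ` carrier A = kernel B C g"


section \<open>The Salvetti complex\<close>

definition parabolic :: "'s set \<Rightarrow> ('s \<Rightarrow> 's \<Rightarrow> enat) \<Rightarrow> 's set \<Rightarrow> 's gword set set" where
  "parabolic S m X = generate (coxeter_group S m) (coxeter_gen S m ` X)"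

definition spherical_subsets :: "'s set \<Rightarrow> ('s \<Rightarrow> 's \<Rightarrow> enat) \<Rightarrow> 's set set" where
  "spherical_subsets S m = {X. X \<subseteq> S \<and> finite (parabolic S m X)}"

text \<open>Inverses of generators are not needed in the next definition, since the generators of a
  Coxeter group are involutions.\<close>

definition coxeter_length :: "'s set \<Rightarrow> ('s \<Rightarrow> 's \<Rightarrow> enat) \<Rightarrow> 's gword set \<Rightarrow> nat" where
  "coxeter_length S m w =
     (LEAST n. \<exists>ss. set ss \<subseteq> S \<and> length ss = n \<and>
        foldr (\<lambda>s g. coxeter_gen S m s \<otimes>\<^bsub>coxeter_group S m\<^esub> g) ss \<one>\<^bsub>coxeter_group S m\<^esub> = w)"

definition coset_minimal :: "'s set \<Rightarrow> ('s \<Rightarrow> 's \<Rightarrow> enat) \<Rightarrow> 's gword set \<Rightarrow> 's set \<Rightarrow> bool" where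
  "coset_minimal S m w X \<longleftrightarrow>
     (\<forall>w' \<in> w <#\<^bsub>coxeter_group S m\<^esub> parabolic S m X. coxeter_length S m w \<le> coxeter_length S m w')"

type_synonym 's sal_vertex = "'s gword set \<times> 's set"

definition sal_vertices :: "'s set \<Rightarrow> ('s \<Rightarrow> 's \<Rightarrow> enat) \<Rightarrow> 's sal_vertex set" where
  "sal_vertices S m = carrier (coxeter_group S m) \<times> spherical_subsets S m"

definition sal_le :: "'s set \<Rightarrow> ('s \<Rightarrow> 's \<Rightarrow> enat) \<Rightarrow> 's sal_vertex \<Rightarrow> 's sal_vertex \<Rightarrow> bool" where
  "sal_le S m = (\<lambda>(u, X) (v, Y).
     let d = inv\<^bsub>coxeter_group S m\<^esub> v \<otimes>\<^bsub>coxeter_group S m\<^esub> u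
     in X \<subseteq> Y \<and> d \<in> parabolic S m Y \<and> coset_minimal S m d X)"

definition salvetti :: "'s set \<Rightarrow> ('s \<Rightarrow> 's \<Rightarrow> enat) \<Rightarrow> ('s sal_vertex \<Rightarrow> real) topology" where
  "salvetti S m = realization (derived_complex (sal_vertices S m) (sal_le S m))"

definition sal_act ::
  "'s set \<Rightarrow> ('s \<Rightarrow> 's \<Rightarrow> enat) \<Rightarrow> 's gword set \<Rightarrow> ('s sal_vertex \<Rightarrow> real) \<Rightarrow> 's sal_vertex \<Rightarrow> real"
  where
  "sal_act S m w = realization_map (\<lambda>(u, X). (w \<otimes>\<^bsub>coxeter_group S m\<^esub> u, X))"

definition sal_point ::
  "'s gword set \<Rightarrow> 's sal_vertex \<Rightarrow> real" where
  "sal_point w = vertex_point (w, {})"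

definition salvetti_bar ::
  "'s set \<Rightarrow> ('s \<Rightarrow> 's \<Rightarrow> enat) \<Rightarrow> ('s sal_vertex \<Rightarrow> real) set topology" where
  "salvetti_bar S m = orbit_space (coxeter_group S m) (sal_act S m) (salvetti S m)"

definition sal_proj ::
  "'s set \<Rightarrow> ('s \<Rightarrow> 's \<Rightarrow> enat) \<Rightarrow> ('s sal_vertex \<Rightarrow> real) \<Rightarrow> ('s sal_vertex \<Rightarrow> real) set" where
  "sal_proj S m = orbit (coxeter_group S m) (sal_act S m)"


section \<open>The definitions make sense\<close>

lemma pres_eq_lists:
  "pres_eq S R u v \<Longrightarrow> u \<in> lists (S \<times> UNIV) \<and> v \<in> lists (S \<times> UNIV)"
  by (induction rule: pres_eq.induct) auto

lemma pres_class_eq_iff: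
  assumes "u \<in> lists (S \<times> UNIV)"
  shows "pres_class S R u = pres_class S R v \<longleftrightarrow> pres_eq S R u v"
proof
  assume "pres_class S R u = pres_class S R v"
  then have "u \<in> pres_class S R v"
    using assms pres_eq.refl unfolding pres_class_def by blast
  then show "pres_eq S R u v"
    using pres_eq.sym unfolding pres_class_def by blast
next
  assume "pres_eq S R u v"
  then show "pres_class S R u = pres_class S R v"
    unfolding pres_class_def using pres_eq.sym pres_eq.trans by blast
qed

lemma presented_group_mult:
  assumes "u \<in> lists (S \<times> UNIV)" "v \<in> lists (S \<times> UNIV)"
  shows "pres_class S R u \<otimes>\<^bsub>presented_group S R\<^esub> pres_class S R v = pres_class S R (u @ v)"
proof -
  have eq: "pres_class S R (a @ b) = pres_class S R (u @ v)"
    if "pres_eq S R u a" "pres_eq S R v b" for a b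
    using pres_eq.append[OF that] pres_eq_lists[OF that(1)] pres_eq_lists[OF that(2)]
    by (subst eq_commute, subst pres_class_eq_iff) auto
  have "pres_eq S R u u" "pres_eq S R v v"
    using assms by (simp_all add: pres_eq.refl)
  then have "(\<Union>a\<in>{a. pres_eq S R u a}. \<Union>b\<in>{b. pres_eq S R v b}. pres_class S R (a @ b)) =
      pres_class S R (u @ v)"
    using eq by blast
  then show ?thesis
    by (simp add: presented_group_def pres_class_def[of S R u] pres_class_def[of S R v])
qed

lemma pres_eq_inverse:
  "w \<in> lists (S \<times> UNIV) \<Longrightarrow> pres_eq S R (rev (map (\<lambda>(s, b). (s, \<not> b)) w) @ w) []"
proof (induction w)
  case Nil
  then show ?case by (simp add: pres_eq.refl)
next
  case (Cons x w)
  obtain s b where x: "x = (s, b)" by (cases x)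
  let ?i = "rev (map (\<lambda>(s, b). (s, \<not> b)) w)"
  have s: "s \<in> S" and w: "w \<in> lists (S \<times> UNIV)"
    using Cons.prems x by auto
  have i: "?i \<in> lists (S \<times> UNIV)"
    using w by (auto simp: in_lists_conv_set)
  have "pres_eq S R [(s, \<not> b), (s, b)] []"
    using pres_eq.cancel[OF s, of R "\<not> b"] by simp
  from pres_eq.append[OF pres_eq.append[OF pres_eq.refl[OF i] this] pres_eq.refl[OF w]]
  have "pres_eq S R ((?i @ [(s, \<not> b), (s, b)]) @ w) (?i @ w)" by simp
  with Cons.IH[OF w] show ?case
    using x pres_eq.trans by fastforce
qed

lemma group_presented_group: "group (presented_group S R)"
proof (rule groupI)
  note c = presented_group_mult[where S = S and R = R]
  let ?G = "presented_group S R"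
  have carr: "carrier ?G = pres_class S R ` lists (S \<times> UNIV)"
    and one: "\<one>\<^bsub>?G\<^esub> = pres_class S R []"
    by (simp_all add: presented_group_def)
  show "\<one>\<^bsub>?G\<^esub> \<in> carrier ?G"
    unfolding carr one by blast
  show "x \<otimes>\<^bsub>?G\<^esub> y \<in> carrier ?G" if xy: "x \<in> carrier ?G" "y \<in> carrier ?G" for x y
  proof -
    obtain u v where "u \<in> lists (S \<times> UNIV)" "v \<in> lists (S \<times> UNIV)"
      and "x = pres_class S R u" "y = pres_class S R v"
      using xy unfolding carr by blast
    then have "x \<otimes>\<^bsub>?G\<^esub> y = pres_class S R (u @ v)" "u @ v \<in> lists (S \<times> UNIV)"
      by (simp_all add: c)
    then show ?thesis unfolding carr by (metis imageI)
  qed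
  show "x \<otimes>\<^bsub>?G\<^esub> y \<otimes>\<^bsub>?G\<^esub> z = x \<otimes>\<^bsub>?G\<^esub> (y \<otimes>\<^bsub>?G\<^esub> z)"
    if xyz: "x \<in> carrier ?G" "y \<in> carrier ?G" "z \<in> carrier ?G" for x y z
  proof -
    obtain u v w where "u \<in> lists (S \<times> UNIV)" "v \<in> lists (S \<times> UNIV)" "w \<in> lists (S \<times> UNIV)"
      and "x = pres_class S R u" "y = pres_class S R v" "z = pres_class S R w"
      using xyz unfolding carr by blast
    then show ?thesis by (simp add: c)
  qed
  show "\<one>\<^bsub>?G\<^esub> \<otimes>\<^bsub>?G\<^esub> x = x" if "x \<in> carrier ?G" for x
    using that unfolding carr one by (auto simp: c in_lists_conv_set)
  show "\<exists>y\<in>carrier ?G. y \<otimes>\<^bsub>?G\<^esub> x = \<one>\<^bsub>?G\<^esub>" if x: "x \<in> carrier ?G" for x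
  proof -
    obtain w where w: "w \<in> lists (S \<times> UNIV)" "x = pres_class S R w"
      using x unfolding carr by blast
    let ?i = "rev (map (\<lambda>(s, b). (s, \<not> b)) w)"
    have i: "?i \<in> lists (S \<times> UNIV)"
      using w by (auto simp: in_lists_conv_set)
    have "pres_class S R ?i \<otimes>\<^bsub>?G\<^esub> x = pres_class S R (?i @ w)"
      using w i by (simp add: c)
    also have "\<dots> = \<one>\<^bsub>?G\<^esub>"
      unfolding one using pres_eq_inverse[OF w(1)] w i
      by (subst pres_class_eq_iff) auto
    finally show ?thesis
      using i unfolding carr by blast
  qed
qed

lemma eval_word_closed:
  assumes "group G" "f \<in> S \<rightarrow> carrier G" "w \<in> lists (S \<times> UNIV)"
  shows "eval_word G f w \<in> carrier G"
proof -
  interpret group G by fact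
  show ?thesis
    using assms(3,2) unfolding eval_word_def by (induction w) (auto simp: Pi_iff in_lists_conv_set)
qed

lemma eval_word_append:
  assumes "group G" "f \<in> S \<rightarrow> carrier G" "u \<in> lists (S \<times> UNIV)" "v \<in> lists (S \<times> UNIV)"
  shows "eval_word G f (u @ v) = eval_word G f u \<otimes>\<^bsub>G\<^esub> eval_word G f v"
proof -
  interpret group G by fact
  have v: "eval_word G f v \<in> carrier G"
    using eval_word_closed assms by blast
  show ?thesis
    using assms(3)
  proof (induction u)
    case Nil
    then show ?case using v by (simp add: eval_word_def)
  next
    case (Cons x u)
    obtain s b where x: "x = (s, b)" by (cases x)
    have u: "eval_word G f u \<in> carrier G"
      using Cons.hyps by (simp add: eval_word_closed[OF assms(1,2)])
    have "f s \<in> carrier G"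
      using Cons.hyps assms(2) x by auto
    moreover have "eval_word G f (y # z) =
        (if snd y then f (fst y) else inv\<^bsub>G\<^esub> (f (fst y))) \<otimes>\<^bsub>G\<^esub> eval_word G f z" for y z
      by (simp add: eval_word_def case_prod_beta)
    moreover have "eval_word G f (u @ v) = eval_word G f u \<otimes>\<^bsub>G\<^esub> eval_word G f v"
      using Cons by simp
    ultimately show ?case
      using u v x by (simp add: m_assoc)
  qed
qed

lemma eval_word_pres_eq:
  assumes G: "group G" and f: "f \<in> S \<rightarrow> carrier G"
    and R: "\<And>u v. (u, v) \<in> R \<Longrightarrow> eval_word G f u = eval_word G f v"
    and eq: "pres_eq S R u v"
  shows "eval_word G f u = eval_word G f v"
  using eq
proof (induction rule: pres_eq.induct)
  case (append u u' v v')
  then show ?case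
    using pres_eq_lists[OF append.hyps(1)] pres_eq_lists[OF append.hyps(2)]
    by (simp add: eval_word_append[OF G f])
next
  case (cancel s b)
  interpret group G by fact
  have "f s \<in> carrier G" using cancel f by blast
  then show ?case by (simp add: eval_word_def)
qed (use R in auto)

lemma pres_hom_class:
  assumes "group G" "f \<in> S \<rightarrow> carrier G"
    and "\<And>u v. (u, v) \<in> R \<Longrightarrow> eval_word G f u = eval_word G f v"
    and w: "w \<in> lists (S \<times> UNIV)"
  shows "pres_hom G f (pres_class S R w) = eval_word G f w"
proof -
  have "eval_word G f ` pres_class S R w = {eval_word G f w}"
    using eval_word_pres_eq[OF assms(1-3)] pres_eq.refl[OF w]
    unfolding pres_class_def by fastforce
  then show ?thesis by (simp add: pres_hom_def)
qed

lemma pres_hom_in_hom: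
  assumes "group G" "f \<in> S \<rightarrow> carrier G"
    and "\<And>u v. (u, v) \<in> R \<Longrightarrow> eval_word G f u = eval_word G f v"
  shows "pres_hom G f \<in> hom (presented_group S R) G"
proof -
  have carr: "carrier (presented_group S R) = pres_class S R ` lists (S \<times> UNIV)"
    by (simp add: presented_group_def)
  show ?thesis
    unfolding hom_def carr
  proof (intro CollectI conjI ballI funcsetI; elim imageE)
    fix a u assume u: "a = pres_class S R u" "u \<in> lists (S \<times> UNIV)"
    then show "pres_hom G f a \<in> carrier G"
      by (simp add: pres_hom_class[OF assms] eval_word_closed[OF assms(1,2)])
    fix b v assume "b = pres_class S R v" "v \<in> lists (S \<times> UNIV)"
    with u show "pres_hom G f (a \<otimes>\<^bsub>presented_group S R\<^esub> b) = pres_hom G f a \<otimes>\<^bsub>G\<^esub> pres_hom G f b"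
      by (simp add: pres_hom_class[OF assms] presented_group_mult eval_word_append[OF assms(1,2)])
  qed
qed

lemma alternating_eq:
  "alternating (2 * k) a b = concat (replicate k [a, b])"
  "alternating (Suc (2 * k)) a b = concat (replicate k [a, b]) @ [a]"
  by (induction k) simp_all

lemma group_coxeter_group: "group (coxeter_group S m)"
  and group_artin_group: "group (artin_group S m)"
  by (simp_all add: coxeter_group_def artin_group_def group_presented_group)

lemma eval_word_coxeter:
  assumes "w \<in> lists (S \<times> {True})"
  shows "eval_word (coxeter_group S m) (coxeter_gen S m) w = pres_class S (coxeter_relations S m) w"
  using assms
proof (induction w)
  case Nil
  then show ?case
    by (simp add: eval_word_def coxeter_group_def presented_group_def)
next
  case (Cons x w)
  then obtain s where x: "x = (s, True)" "s \<in> S" by auto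
  have "w \<in> lists (S \<times> UNIV)"
    using Cons.hyps(2) by (auto simp: in_lists_conv_set)
  with Cons x presented_group_mult[of "[(s, True)]" S w "coxeter_relations S m"] show ?case
    by (simp add: eval_word_def coxeter_group_def coxeter_gen_def pres_gen_def)
qed

lemma alternating_coxeter:
  assumes "s \<in> S" "t \<in> S" "s \<noteq> t" "m s t = enat k" "m t s = enat k"
  shows "pres_eq S (coxeter_relations S m)
           (alternating k (s, True) (t, True)) (alternating k (t, True) (s, True))"
proof -
  let ?R = "coxeter_relations S m"
  define a where "a = (s, True)"
  define b where "b = (t, True)"
  have L: "a \<in> S \<times> UNIV" "b \<in> S \<times> UNIV" using assms by (auto simp: a_def b_def)
  have alt: "alternating n x y \<in> lists (S \<times> UNIV)" if "x \<in> S \<times> UNIV" "y \<in> S \<times> UNIV" for n x y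
    using that by (induction n arbitrary: x y) auto
  have aa: "pres_eq S ?R [a, a] []" and bb: "pres_eq S ?R [b, b] []"
    using L assms by (auto simp: coxeter_relations_def a_def b_def intro!: pres_eq.rel)
  have conc: "concat (replicate k [a, b]) \<in> lists (S \<times> UNIV)"
    using L by (induction k) auto
  have "(concat (replicate k [a, b]), []) \<in> ?R"
    unfolding coxeter_relations_def a_def b_def using assms by blast
  then have full: "pres_eq S ?R (alternating (2 * k) a b) []"
    unfolding alternating_eq using conc by (intro pres_eq.rel) simp_all
  have last: "alternating (Suc n) x y = alternating n x y @ [if even n then x else y]" for n and x y :: "'a \<times> bool"
    by (induction n arbitrary: x y) auto
  have split: "alternating (n + j) x y =
      alternating n x y @ (if even n then alternating j x y else alternating j y x)"
    for n j and x y :: "'a \<times> bool"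
    by (induction n arbitrary: x y) auto
  have xx: "pres_eq S ?R [x, x] []" if "x \<in> {a, b}" for x
    using that aa bb by auto
  have inv: "pres_eq S ?R (alternating n x y @ rev (alternating n x y)) []"
    if "x \<in> {a, b}" "y \<in> {a, b}" for n x y
    using that
  proof (induction n arbitrary: x y)
    case 0
    then show ?case by (simp add: pres_eq.refl)
  next
    case (Suc n)
    have x: "[x] \<in> lists (S \<times> UNIV)" using Suc.prems L by auto
    have "pres_eq S ?R ([x] @ (alternating n y x @ rev (alternating n y x)) @ [x]) ([x] @ [] @ [x])"
      using Suc.IH[of y x] Suc.prems x by (intro pres_eq.append pres_eq.refl) auto
    with xx[OF Suc.prems(1)] show ?case
      using pres_eq.trans by fastforce
  qed
  have rev_alt: "rev (alternating n x y) = (if even n then alternating n y x else alternating n x y)"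
    for n and x y :: "'a \<times> bool"
  proof (induction n arbitrary: x y)
    case 0
    then show ?case by simp
  next
    case (Suc n)
    then show ?case using last[of n] by simp
  qed
  let ?Q = "if even k then alternating k a b else alternating k b a"
  let ?P = "alternating k a b"
  have PQ: "pres_eq S ?R (?P @ ?Q) []"
    using full split[of k k a b] by (simp add: mult_2)
  have revQ: "rev ?Q = alternating k b a"
    by (simp add: rev_alt)
  have QQ: "pres_eq S ?R (?Q @ rev ?Q) []"
    using inv by auto
  have P: "?P \<in> lists (S \<times> UNIV)" and rQ: "rev ?Q \<in> lists (S \<times> UNIV)"
    unfolding revQ by (intro alt L)+
  have 1: "pres_eq S ?R (?P @ (?Q @ rev ?Q)) (?P @ [])"
    by (rule pres_eq.append[OF pres_eq.refl[OF P] QQ])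
  have 2: "pres_eq S ?R ((?P @ ?Q) @ rev ?Q) ([] @ rev ?Q)"
    by (rule pres_eq.append[OF PQ pres_eq.refl[OF rQ]])
  have "pres_eq S ?R ?P (rev ?Q)"
    using pres_eq.trans[OF pres_eq.sym[OF 1]] 2 by simp
  then show ?thesis
    by (simp only: revQ) (simp only: a_def b_def)
qed

lemma artin_theta:
  assumes "coxeter_matrix S m"
  shows "artin_theta S m \<in> hom (artin_group S m) (coxeter_group S m)"
    and "s \<in> S \<Longrightarrow> artin_theta S m (artin_gen S m s) = coxeter_gen S m s"
proof -
  have gen: "coxeter_gen S m \<in> S \<rightarrow> carrier (coxeter_group S m)"
    by (auto simp: coxeter_gen_def pres_gen_def coxeter_group_def presented_group_def)
  have alt: "alternating n x y \<in> lists (S \<times> {True})"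
    if "x \<in> S \<times> {True}" "y \<in> S \<times> {True}" for n x y
    using that by (induction n arbitrary: x y) auto
  have R: "eval_word (coxeter_group S m) (coxeter_gen S m) u
         = eval_word (coxeter_group S m) (coxeter_gen S m) v"
    if uv: "(u, v) \<in> artin_relations S m" for u v
  proof -
    obtain s t k where st: "s \<in> S" "t \<in> S" "s \<noteq> t" "m s t = enat k"
      and uv: "u = alternating k (s, True) (t, True)" "v = alternating k (t, True) (s, True)"
      using uv unfolding artin_relations_def by blast
    have ts: "m t s = enat k"
      using assms st unfolding coxeter_matrix_def by metis
    have l: "u \<in> lists (S \<times> {True})" "v \<in> lists (S \<times> {True})"
      unfolding uv using st by (intro alt; simp)+
    then have "u \<in> lists (S \<times> UNIV)" using lists_mono[of "S \<times> {True}" "S \<times> UNIV"] by blast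
    then show ?thesis
      using alternating_coxeter[OF st ts] l uv
      by (simp add: eval_word_coxeter pres_class_eq_iff)
  qed
  show "artin_theta S m \<in> hom (artin_group S m) (coxeter_group S m)"
    unfolding artin_theta_def artin_group_def
    by (rule pres_hom_in_hom[OF group_coxeter_group gen R])
  show "artin_theta S m (artin_gen S m s) = coxeter_gen S m s" if "s \<in> S"
    unfolding artin_theta_def artin_gen_def pres_gen_def
    using that eval_word_coxeter[of "[(s, True)]" S m]
    by (subst pres_hom_class[OF group_coxeter_group gen R]) (auto simp: coxeter_gen_def pres_gen_def)
qed

lemma openin_realization:
  "openin (realization K) U \<longleftrightarrow> U \<subseteq> (\<Union>\<sigma>\<in>K. closed_simplex \<sigma>) \<and>
     (\<forall>\<sigma>\<in>K. openin (top_of_set (closed_simplex \<sigma>)) (U \<inter> closed_simplex \<sigma>))"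
proof -
  let ?P = "\<lambda>U. U \<subseteq> (\<Union>\<sigma>\<in>K. closed_simplex \<sigma>) \<and>
     (\<forall>\<sigma>\<in>K. openin (top_of_set (closed_simplex \<sigma>)) (U \<inter> closed_simplex \<sigma>))"
  have "istopology ?P"
    unfolding istopology_def
  proof (intro conjI allI impI ballI)
    fix U V \<sigma> assume *: "?P U" "?P V" "\<sigma> \<in> K"
    have "U \<inter> V \<inter> closed_simplex \<sigma> = (U \<inter> closed_simplex \<sigma>) \<inter> (V \<inter> closed_simplex \<sigma>)"
      by blast
    then show "openin (top_of_set (closed_simplex \<sigma>)) (U \<inter> V \<inter> closed_simplex \<sigma>)"
      using * by (simp only: openin_Int)
  next
    fix \<K> \<sigma> assume *: "\<forall>k\<in>\<K>. ?P k" "\<sigma> \<in> K"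
    have "openin (top_of_set (closed_simplex \<sigma>)) (\<Union>k\<in>\<K>. k \<inter> closed_simplex \<sigma>)"
      using * by (intro openin_Union) blast
    then show "openin (top_of_set (closed_simplex \<sigma>)) (\<Union>\<K> \<inter> closed_simplex \<sigma>)"
      by (simp only: Int_Union2)
  qed blast+
  then show ?thesis
    unfolding realization_def by (simp only: topology_inverse')
qed

lemma openin_orbit_space:
  "openin (orbit_space G \<phi> X) U \<longleftrightarrow> U \<subseteq> orbits G (topspace X) \<phi> \<and>
     openin X {x \<in> topspace X. orbit G \<phi> x \<in> U}"
proof -
  let ?P = "\<lambda>U. U \<subseteq> orbits G (topspace X) \<phi> \<and> openin X {x \<in> topspace X. orbit G \<phi> x \<in> U}"
  have "istopology ?P"
    unfolding istopology_def
  proof (intro conjI allI impI)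
    fix U V assume *: "?P U" "?P V"
    have "{x \<in> topspace X. orbit G \<phi> x \<in> U \<inter> V} =
        {x \<in> topspace X. orbit G \<phi> x \<in> U} \<inter> {x \<in> topspace X. orbit G \<phi> x \<in> V}"
      by blast
    then show "openin X {x \<in> topspace X. orbit G \<phi> x \<in> U \<inter> V}"
      using * by (simp only: openin_Int)
  next
    fix \<K> assume *: "\<forall>k\<in>\<K>. ?P k"
    have "openin X (\<Union>k\<in>\<K>. {x \<in> topspace X. orbit G \<phi> x \<in> k})"
      using * by (intro openin_Union) blast
    moreover have "(\<Union>k\<in>\<K>. {x \<in> topspace X. orbit G \<phi> x \<in> k}) =
        {x \<in> topspace X. orbit G \<phi> x \<in> \<Union>\<K>}"
      by blast
    ultimately show "openin X {x \<in> topspace X. orbit G \<phi> x \<in> \<Union>\<K>}"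
      by simp
  qed blast+
  then show ?thesis
    unfolding orbit_space_def by (simp only: topology_inverse')
qed

end

theory Submission
  imports Defs
begin

text \<open>Every path in the Salvetti complex between vertices \<open>x(w)\<close> is homotopic to an edge path, and
  edge paths can be pushed down to the paths \<open>x(w) \<rightarrow> (w, {s}) \<leftarrow> x(ws)\<close>; so they are spelled by
  words in the generators of the Artin group. The two sides of a braid relation spell homotopic
  paths because both lie in the star of the vertex \<open>(w, {s, t})\<close>. Conversely, by the exchange
  condition and Matsumoto's theorem the reduced words give a section \<open>W \<rightarrow> A\<close> that is
  multiplicative when lengths add. It turns the edges of the complex into a cocycle with values in
  \<open>A\<close>, and the associated covering separates words that differ in \<open>A\<close>. Hence
  words modulo the Artin relations are the homotopy classes of loops at \<open>x\<^sub>0\<close>, and the loops that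
  lift to loops in the complex are the words in the kernel of \<open>\<theta>\<close>.\<close>

section \<open>Homotopies of paths\<close>

text \<open>No presentation of the fundamental group is read off a cell structure. That words spell
  every path is shown by bisection and contractions inside stars; that they are identified no
  further than in \<open>A\<close> is shown by a covering, so faithfulness rests entirely on the
  edge labels. The difficulty is that \<open>lift\<close> is no homomorphism, while a cocycle has to
  be multiplicative on every simplex. The minimality clause in the order of the complex resolves
  this: for (u,X) below (v,Y) below (w,Z), the element w^-1 v is shortest in its coset of W_Y and
  v^-1 u lies in W_Y, so lengths add along every chain. Matsumoto's theorem in turn needs the order
  of st in \<open>W\<close> to be m(s,t) itself, not a proper divisor. The relations alone do not
  show this; it is what the geometric representation is for. Finiteness of \<open>S\<close> makes
  the complex locally finite, so its weak topology is that of coordinatewise convergence and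
  continuity can be checked one coordinate at a time.\<close>

definition path_homotopic :: "'a topology \<Rightarrow> (real \<Rightarrow> 'a) \<Rightarrow> (real \<Rightarrow> 'a) \<Rightarrow> bool" where
  "path_homotopic X p q \<longleftrightarrow>
     homotopic_with (\<lambda>r. r 0 = p 0 \<and> r 1 = p 1) (top_of_set {0..1}) X p q"

definition path_rev :: "(real \<Rightarrow> 'a) \<Rightarrow> real \<Rightarrow> 'a" where
  "path_rev p = (\<lambda>t. p (1 - t))"

lemma path_rev_ends [simp]: "path_rev p 0 = p 1" "path_rev p 1 = p 0"
  by (simp_all add: path_rev_def)

lemma path_rev_rev [simp]: "path_rev (path_rev p) = p"
  by (simp add: path_rev_def)

lemma path_join_ends [simp]: "path_join p q 0 = p 0" "path_join p q 1 = q 1"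
  by (simp_all add: path_join_def)

lemma path_join_comp: "f \<circ> path_join p q = path_join (f \<circ> p) (f \<circ> q)"
  by (auto simp: path_join_def)

lemma path_rev_comp: "f \<circ> path_rev p = path_rev (f \<circ> p)"
  by (auto simp: path_rev_def)

lemma pathin_rev: "pathin X p \<Longrightarrow> pathin X (path_rev p)"
  unfolding pathin_def path_rev_def
  by (rule continuous_map_compose[of _ "top_of_set {0..1}" "\<lambda>t. 1 - t", unfolded comp_def])
     (auto intro!: continuous_intros)

lemma pathin_reparam:
  assumes "pathin X p" "continuous_on {0..1::real} f" "f ` {0..1} \<subseteq> {0..1}"
  shows "pathin X (p \<circ> f)"
  using assms unfolding pathin_def
  by (intro continuous_map_compose[of _ "top_of_set {0..1}"]) (auto simp: continuous_map_in_subtopology)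

lemma pathin_in_topspace: "pathin X p \<Longrightarrow> 0 \<le> t \<Longrightarrow> t \<le> 1 \<Longrightarrow> p t \<in> topspace X"
  unfolding pathin_def by (auto simp: continuous_map_def)

lemma continuous_map_glue_half:
  fixes Z :: "'c::topological_space set" and f :: "'c \<Rightarrow> real"
  assumes "continuous_on Z f"
    and "continuous_map (top_of_set {x\<in>Z. f x \<le> 1/2}) X p"
    and "continuous_map (top_of_set {x\<in>Z. 1/2 \<le> f x}) X q"
    and "\<And>x. x \<in> Z \<Longrightarrow> f x = 1/2 \<Longrightarrow> p x = q x"
  shows "continuous_map (top_of_set Z) X (\<lambda>x. if f x \<le> 1/2 then p x else q x)"
  using assms
  by (intro continuous_map_cases_le) (auto simp: subtopology_subtopology Int_def)

lemma pathin_join: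
  assumes "pathin X p" "pathin X q" "p 1 = q 0"
  shows "pathin X (path_join p q)"
  unfolding pathin_def path_join_def
proof (rule continuous_map_glue_half)
  have *: "continuous_map (top_of_set {x \<in> {0..1}. x \<le> 1/2}) (top_of_set {0..1}) (\<lambda>t::real. 2 * t)"
    "continuous_map (top_of_set {x \<in> {0..1}. 1/2 \<le> x}) (top_of_set {0..1}) (\<lambda>t::real. 2 * t - 1)"
    by (auto simp: continuous_map_in_subtopology intro!: continuous_intros)
  show "continuous_map (top_of_set {x \<in> {0..1}. x \<le> 1/2}) X (\<lambda>t. p (2 * t))"
    using continuous_map_compose[OF *(1) assms(1)[unfolded pathin_def]] by (simp add: comp_def)
  show "continuous_map (top_of_set {x \<in> {0..1}. 1/2 \<le> x}) X (\<lambda>t. q (2 * t - 1))"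
    using continuous_map_compose[OF *(2) assms(2)[unfolded pathin_def]] by (simp add: comp_def)
  show "p (2 * t) = q (2 * t - 1)" if "t = 1/2" for t
    unfolding that using assms(3) by simp
qed (rule continuous_on_id)

text \<open>The working form of a homotopy: a map of the unit square whose first coordinate deforms
  and whose second runs along the path. Such squares are what is glued and lifted below.\<close>

lemma path_homotopic_alt:
  "path_homotopic X p q \<longleftrightarrow>
     (\<exists>h. continuous_map (top_of_set ({0..1} \<times> {0..1})) X h \<and>
        (\<forall>t\<in>{0..1}. h (0, t) = p t \<and> h (1, t) = q t \<and> h (t, 0) = p 0 \<and> h (t, 1) = p 1))"
  (is "_ \<longleftrightarrow> ?R")
proof -
  have "prod_topology (top_of_set {0..1::real}) (top_of_set {0..1::real})
      = top_of_set ({0..1} \<times> {0..1})"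
    by (metis euclidean_product_topology prod_topology_subtopology_eu subtopology_Times)
  then show ?thesis
    unfolding path_homotopic_def
    by (subst homotopic_with) auto
qed

lemma path_homotopic_ends:
  assumes "path_homotopic X p q"
  shows "q 0 = p 0" "q 1 = p 1"
  using homotopic_with_imp_property[OF assms[unfolded path_homotopic_def]] by auto

lemma path_homotopic_pathin:
  assumes "path_homotopic X p q"
  shows "pathin X p" "pathin X q"
  using homotopic_with_imp_continuous_maps[OF assms[unfolded path_homotopic_def]]
  by (auto simp: pathin_def)

lemma path_homotopic_eq:
  assumes "pathin X p" "\<And>t. 0 \<le> t \<Longrightarrow> t \<le> 1 \<Longrightarrow> p t = q t"
  shows "path_homotopic X p q"
  unfolding path_homotopic_def using assms
  by (intro homotopic_with_equal) (auto simp: pathin_def)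

lemma path_homotopic_refl [intro]: "pathin X p \<Longrightarrow> path_homotopic X p p"
  by (rule path_homotopic_eq) auto

lemma path_homotopic_sym: "path_homotopic X p q \<Longrightarrow> path_homotopic X q p"
  using path_homotopic_ends[of X p q] homotopic_with_symD[of _ _ _ p q]
  unfolding path_homotopic_def by simp

lemma path_homotopic_trans [trans]:
  "path_homotopic X p q \<Longrightarrow> path_homotopic X q r \<Longrightarrow> path_homotopic X p r"
  using path_homotopic_ends[of X p q] homotopic_with_trans[of _ _ _ p q r]
  unfolding path_homotopic_def by simp

lemma path_homotopic_compose:
  "path_homotopic X p q \<Longrightarrow> continuous_map X Y f \<Longrightarrow> path_homotopic Y (f \<circ> p) (f \<circ> q)"
  unfolding path_homotopic_def
  by (erule (1) homotopic_with_compose_continuous_map_left) auto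

lemma path_homotopic_join:
  assumes "path_homotopic X p p'" "path_homotopic X q q'" "p 1 = q 0"
  shows "path_homotopic X (path_join p q) (path_join p' q')"
proof -
  obtain h where h: "continuous_map (top_of_set ({0..1} \<times> {0..1})) X h"
    "\<forall>t\<in>{0..1}. h (0, t) = p t \<and> h (1, t) = p' t \<and> h (t, 0) = p 0 \<and> h (t, 1) = p 1"
    using iffD1[OF path_homotopic_alt assms(1)] by blast
  obtain k where k: "continuous_map (top_of_set ({0..1} \<times> {0..1})) X k"
    "\<forall>t\<in>{0..1}. k (0, t) = q t \<and> k (1, t) = q' t \<and> k (t, 0) = q 0 \<and> k (t, 1) = q 1"
    using iffD1[OF path_homotopic_alt assms(2)] by blast
  let ?l = "\<lambda>z::real\<times>real. if snd z \<le> 1/2 then h (fst z, 2 * snd z) else k (fst z, 2 * snd z - 1)"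
  have l: "continuous_map (top_of_set ({0..1} \<times> {0..1})) X ?l"
  proof (rule continuous_map_glue_half)
    have *: "continuous_map (top_of_set {z \<in> {0..1}\<times>{0..1}. snd z \<le> 1/2}) (top_of_set ({0..1} \<times> {0..1}))
         (\<lambda>z::real\<times>real. (fst z, 2 * snd z))"
      "continuous_map (top_of_set {z \<in> {0..1}\<times>{0..1}. 1/2 \<le> snd z}) (top_of_set ({0..1} \<times> {0..1}))
         (\<lambda>z::real\<times>real. (fst z, 2 * snd z - 1))"
      by (auto simp: continuous_map_in_subtopology intro!: continuous_intros)
    show "continuous_map (top_of_set {z \<in> {0..1}\<times>{0..1}. snd z \<le> 1/2}) X (\<lambda>z. h (fst z, 2 * snd z))"
      using continuous_map_compose[OF *(1) h(1)] by (simp add: comp_def)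
    show "continuous_map (top_of_set {z \<in> {0..1}\<times>{0..1}. 1/2 \<le> snd z}) X (\<lambda>z. k (fst z, 2 * snd z - 1))"
      using continuous_map_compose[OF *(2) k(1)] by (simp add: comp_def)
    show "h (fst z, 2 * snd z) = k (fst z, 2 * snd z - 1)"
      if "z \<in> {0..1}\<times>{0..1}" "snd z = 1/2" for z
      unfolding that(2) using that(1) h(2) k(2) assms(3) by auto
  qed (rule continuous_on_snd[OF continuous_on_id])
  then show ?thesis
    unfolding path_homotopic_alt using h(2) k(2)
    by (intro exI[of _ ?l]) (auto simp: path_join_def)
qed

text \<open>The straight-line homotopy in the parameter domain; every reparametrization of paths and
  every contraction of a square below is an instance.\<close>

lemma path_homotopic_convex:
  fixes C :: "'b::real_normed_vector set"
  assumes "convex C" "continuous_map (top_of_set C) X f"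
    and "continuous_on {0..1} \<gamma>" "\<gamma> ` {0..1} \<subseteq> C" "continuous_on {0..1} \<gamma>'" "\<gamma>' ` {0..1} \<subseteq> C"
    and "\<gamma> 0 = \<gamma>' 0" "\<gamma> 1 = \<gamma>' 1"
  shows "path_homotopic X (f \<circ> \<gamma>) (f \<circ> \<gamma>')"
proof -
  let ?l = "\<lambda>z. (1 - fst z) *\<^sub>R \<gamma> (snd z) + fst z *\<^sub>R \<gamma>' (snd z)"
  have "continuous_on ({0..1}\<times>{0..1}) (\<gamma> \<circ> snd)" "continuous_on ({0..1}\<times>{0..1}) (\<gamma>' \<circ> snd)"
    unfolding comp_def
    by (auto intro!: continuous_on_compose2[OF assms(3)] continuous_on_compose2[OF assms(5)] continuous_intros)
  then have "continuous_on ({0..1}\<times>{0..1}) ?l"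
    by (auto intro!: continuous_intros simp: comp_def)
  moreover have "?l ` ({0..1}\<times>{0..1}) \<subseteq> C"
    using assms(1,4,6) by (auto simp: image_subset_iff convex_alt)
  ultimately have l: "continuous_map (top_of_set ({0..1} \<times> {0..1})) (top_of_set C) ?l"
    by auto
  show ?thesis
    unfolding path_homotopic_alt
    by (intro exI[of _ "f \<circ> ?l"] conjI continuous_map_compose[OF l assms(2)])
       (auto simp: assms(7,8) algebra_simps simp flip: scaleR_add_left)
qed

lemma path_homotopic_reparametrize:
  assumes "pathin X p" "continuous_on {0..1} f" "f ` {0..1} \<subseteq> {0..1}"
    "continuous_on {0..1} g" "g ` {0..1} \<subseteq> {0..1}" "f 0 = g 0" "f 1 = g 1"
  shows "path_homotopic X (p \<circ> f) (p \<circ> g)"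
  by (rule path_homotopic_convex[of "{0..1}"]) (use assms in \<open>auto simp: pathin_def\<close>)

lemma path_homotopic_assoc:
  assumes "pathin X p" "pathin X q" "pathin X r" "p 1 = q 0" "q 1 = r 0"
  shows "path_homotopic X (path_join (path_join p q) r) (path_join p (path_join q r))"
proof -
  \<comment> \<open>The piecewise linear map taking the breakpoints 1/4, 1/2 of the left bracketing
    to the breakpoints 1/2, 3/4 of the right one. Its slopes are 2, 1, 1/2; \<open>min\<close> joins
    the first two pieces.\<close>
  let ?f = "\<lambda>t::real. if t \<le> 1/2 then min (2 * t) (t + 1/4) else (t + 1) / 2"
  let ?p = "path_join p (path_join q r)"
  have p: "pathin X ?p"
    using assms by (intro pathin_join) auto
  have f: "continuous_on {0..1} ?f"
    by (intro continuous_on_cases_le continuous_intros) auto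
  have im: "?f ` {0..1} \<subseteq> {0..1}"
    by auto
  have "path_homotopic X (?p \<circ> ?f) (?p \<circ> id)"
    using im by (intro path_homotopic_reparametrize p f) auto
  moreover have "path_homotopic X (?p \<circ> ?f) (path_join (path_join p q) r)"
  proof (rule path_homotopic_eq)
    show "pathin X (?p \<circ> ?f)" by (rule pathin_reparam[OF p f im])
    show "(?p \<circ> ?f) t = path_join (path_join p q) r t" if "0 \<le> t" "t \<le> 1" for t
    proof -
      consider "t \<le> 1/4" | "1/4 < t" "t \<le> 1/2" | "1/2 < t" by linarith
      then show ?thesis
      proof cases
        case 1
        then have "?f t = 2 * t" by simp
        with 1 show ?thesis by (simp add: path_join_def)
      next
        case 2
        then have "?f t = t + 1/4" by simp
        moreover have "2 * (2 * (t + 1/4) - 1) = 2 * (2 * t) - (1::real)" by simp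
        ultimately show ?thesis
          unfolding comp_def using 2 by (simp add: path_join_def)
      next
        case 3
        define u where "u = (t + 1) / 2"
        have u: "?f t = u" "\<not> u \<le> 1/2" "\<not> 2 * u - 1 \<le> 1/2" "2 * (2 * u - 1) - 1 = 2 * t - 1"
          "\<not> t \<le> 1/2"
          using 3 by (auto simp: u_def)
        show ?thesis
          by (simp only: comp_def u(1)) (simp only: path_join_def u(2-5) if_False)
      qed
    qed
  qed
  ultimately show ?thesis
    using path_homotopic_sym path_homotopic_trans by fastforce
qed

lemma path_homotopic_lid:
  assumes "pathin X p" "p 0 = x"
  shows "path_homotopic X (path_join (\<lambda>_. x) p) p"
proof -
  \<comment> \<open>This map waits at 0 during the first half, which is the constant path put in
    front.\<close>
  let ?f = "\<lambda>t::real. max 0 (2 * t - 1)"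
  have f: "continuous_on {0..1} ?f" "?f ` {0..1} \<subseteq> {0..1}"
    by (auto intro!: continuous_intros)
  have "path_homotopic X (p \<circ> ?f) (p \<circ> id)"
    using f by (intro path_homotopic_reparametrize assms) auto
  moreover have "(p \<circ> ?f) t = path_join (\<lambda>_. x) p t" for t
  proof (cases "t \<le> 1/2")
    case True
    then have "max 0 (2 * t - 1) = 0" by simp
    with True assms(2) show ?thesis by (simp add: path_join_def)
  next
    case False
    then have "max 0 (2 * t - 1) = 2 * t - 1" by simp
    with False show ?thesis by (simp add: path_join_def)
  qed
  then have "p \<circ> ?f = path_join (\<lambda>_. x) p" ..
  ultimately show ?thesis by simp
qed

lemma path_homotopic_rid:
  assumes "pathin X p" "p 1 = x"
  shows "path_homotopic X (path_join p (\<lambda>_. x)) p"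
proof -
  let ?f = "\<lambda>t::real. min 1 (2 * t)"
  have f: "continuous_on {0..1} ?f" "?f ` {0..1} \<subseteq> {0..1}"
    by (auto intro!: continuous_intros)
  have "path_homotopic X (p \<circ> ?f) (p \<circ> id)"
    using f by (intro path_homotopic_reparametrize assms) auto
  moreover have "(p \<circ> ?f) t = path_join p (\<lambda>_. x) t" for t
  proof (cases "t \<le> 1/2")
    case True
    then have "min 1 (2 * t) = 2 * t" by simp
    with True show ?thesis by (simp add: path_join_def)
  next
    case False
    then have "min 1 (2 * t) = 1" by simp
    with False assms(2) show ?thesis by (simp add: path_join_def)
  qed
  then have "p \<circ> ?f = path_join p (\<lambda>_. x)" ..
  ultimately show ?thesis by simp
qed

lemma path_homotopic_rinv:
  assumes "pathin X p"
  shows "path_homotopic X (path_join p (path_rev p)) (\<lambda>_. p 0)"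
proof -
  \<comment> \<open>The tent map runs to 1 and back to 0, and inside the interval it can be
    flattened to the constant 0.\<close>
  let ?f = "\<lambda>t::real. 1 - \<bar>2 * t - 1\<bar>"
  have f: "continuous_on {0..1} ?f" "?f ` {0..1} \<subseteq> {0..1}"
    by (auto intro!: continuous_intros)
  have "path_homotopic X (p \<circ> ?f) (p \<circ> (\<lambda>_. 0))"
    using f by (intro path_homotopic_reparametrize assms) auto
  moreover have "p \<circ> ?f = path_join p (path_rev p)"
    by (auto simp: path_join_def path_rev_def)
  ultimately show ?thesis by (simp add: comp_def)
qed

lemma path_homotopic_linv:
  assumes "pathin X p"
  shows "path_homotopic X (path_join (path_rev p) p) (\<lambda>_. p 1)"
  using path_homotopic_rinv[OF pathin_rev[OF assms]] by simp

section \<open>Lifting along covering maps\<close>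

lemma covering_mapD:
  assumes "covering_map X Y p"
  shows "continuous_map X Y p" "p ` topspace X = topspace Y"
  using assms by (auto simp: covering_map_def)

lemma covering_map_evenly:
  assumes "covering_map X Y p" "y \<in> topspace Y"
  shows "\<exists>V \<U>. openin Y V \<and> y \<in> V \<and> \<Union>\<U> = {x \<in> topspace X. p x \<in> V} \<and> pairwise disjnt \<U> \<and>
    (\<forall>U\<in>\<U>. openin X U \<and> homeomorphic_map (subtopology X U) (subtopology Y V) p \<and> inj_on p U)"
proof -
  obtain V \<U> where V: "openin Y V" "y \<in> V" "\<Union>\<U> = {x \<in> topspace X. p x \<in> V}" "pairwise disjnt \<U>"
    "\<forall>U\<in>\<U>. openin X U \<and> homeomorphic_map (subtopology X U) (subtopology Y V) p"
    using assms unfolding covering_map_def by meson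
  have "inj_on p U" if "U \<in> \<U>" for U
  proof -
    have "homeomorphic_map (subtopology X U) (subtopology Y V) p" "openin X U"
      using V that by auto
    then show ?thesis
      using homeomorphic_imp_injective_map[of "subtopology X U" "subtopology Y V" p]
      by (simp add: openin_subset Int_absorb1)
  qed
  with V show ?thesis by (intro exI[of _ V] exI[of _ \<U>]) auto
qed

text \<open>Agreement and disagreement of two lifts are both open conditions: near a given point the
  lifts stay in one sheet, where \<open>p\<close> is injective, or in two disjoint sheets.
  Connectedness leaves only agreement.\<close>

lemma covering_map_unique_lift:
  assumes cov: "covering_map X Y p" and conn: "connected_space T"
    and f: "continuous_map T X f" and g: "continuous_map T X g"
    and eq: "\<And>z. z \<in> topspace T \<Longrightarrow> p (f z) = p (g z)"
    and z: "z0 \<in> topspace T" "f z0 = g z0" "z \<in> topspace T"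
  shows "f z = g z"
proof -
  let ?E = "{z \<in> topspace T. f z = g z}" and ?D = "{z \<in> topspace T. f z \<noteq> g z}"
  have loc: "\<exists>N. openin T N \<and> z \<in> N \<and> (N \<subseteq> ?E \<or> N \<subseteq> ?D) " if z: "z \<in> topspace T" for z
  proof -
    have fz: "f z \<in> topspace X" "g z \<in> topspace X"
      using f g z by (auto simp: continuous_map_def)
    then have pf: "p (f z) \<in> topspace Y"
      using covering_mapD[OF cov] by blast
    obtain V \<U> where V: "openin Y V" "p (f z) \<in> V" "\<Union>\<U> = {x \<in> topspace X. p x \<in> V}" "pairwise disjnt \<U>"
      and U: "\<forall>U\<in>\<U>. openin X U \<and> homeomorphic_map (subtopology X U) (subtopology Y V) p \<and> inj_on p U"
    using covering_map_evenly[OF cov pf] by (elim exE conjE) (rule that)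
    have "f z \<in> \<Union>\<U>" "g z \<in> \<Union>\<U>"
      unfolding V(3) using V(2) fz by (simp_all add: eq[OF z])
    then obtain A B where AB: "A \<in> \<U>" "f z \<in> A" "B \<in> \<U>" "g z \<in> B"
      by blast
    let ?N = "{z \<in> topspace T. f z \<in> A} \<inter> {z \<in> topspace T. g z \<in> B}"
    have op: "openin T ?N"
      using openin_continuous_map_preimage[OF f U[rule_format, OF AB(1), THEN conjunct1]]
        openin_continuous_map_preimage[OF g U[rule_format, OF AB(3), THEN conjunct1]] by blast
    have "?N \<subseteq> ?E \<or> ?N \<subseteq> ?D"
    proof (cases "A = B")
      case True
      then show ?thesis
        using U AB(1) eq by (auto dest: inj_onD)
    next
      case False
      then have "A \<inter> B = {}"
        using V(4) AB by (meson disjnt_def pairwiseD)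
      then show ?thesis by auto
    qed
    with op z AB show ?thesis by blast
  qed
  have "openin T ?E" "openin T ?D"
    by (subst openin_subopen; use loc in blast)+
  moreover have "topspace T \<subseteq> ?E \<union> ?D" "?E \<inter> ?D = {}" "?E \<noteq> {}"
    using z by auto
  ultimately have "?D = {}"
    using conn unfolding connected_space_def by blast
  then show ?thesis using z by blast
qed

text \<open>The start may be any point of \<open>Z\<close> and its image any point above. This makes
  the property stable under gluing, so that it can be proved for rectangles by bisection.\<close>

definition liftable :: "'a topology \<Rightarrow> ('a \<Rightarrow> 'b) \<Rightarrow> (real \<times> real \<Rightarrow> 'b) \<Rightarrow> (real \<times> real) set \<Rightarrow> bool" where
  "liftable X p h Z \<longleftrightarrow> (\<forall>z0\<in>Z. \<forall>e\<in>topspace X. p e = h z0 \<longrightarrow>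
     (\<exists>H. continuous_map (top_of_set Z) X H \<and> (\<forall>z\<in>Z. p (H z) = h z) \<and> H z0 = e))"

text \<open>A lift on one piece prescribes the value of a lift on the other at a common point.
  Unique lifting on the connected intersection then makes the two agree wherever both are
  defined.\<close>

lemma liftable_glue:
  assumes cov: "covering_map X Y p"
    and Z: "closed Z1" "closed Z2" "connected (Z1 \<inter> Z2)" "Z1 \<inter> Z2 \<noteq> {}"
    and l: "liftable X p h Z1" "liftable X p h Z2"
  shows "liftable X p h (Z1 \<union> Z2)"
proof -
  have *: "\<exists>H. continuous_map (top_of_set (Z1 \<union> Z2)) X H \<and> (\<forall>z\<in>Z1 \<union> Z2. p (H z) = h z) \<and> H z0 = e"
    if Z: "closed Z1" "closed Z2" "connected (Z1 \<inter> Z2)" "Z1 \<inter> Z2 \<noteq> {}"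
      and l: "liftable X p h Z1" "liftable X p h Z2"
      and z0: "z0 \<in> Z1" "e \<in> topspace X" "p e = h z0" for Z1 Z2 z0 e
  proof -
    obtain H1 where H1: "continuous_map (top_of_set Z1) X H1" "\<forall>z\<in>Z1. p (H1 z) = h z" "H1 z0 = e"
      using l(1) z0 unfolding liftable_def by blast
    obtain z1 where z1: "z1 \<in> Z1" "z1 \<in> Z2" using Z(4) by blast
    have "H1 z1 \<in> topspace X" "p (H1 z1) = h z1"
      using H1 z1 by (auto simp: continuous_map_def)
    then obtain H2 where H2: "continuous_map (top_of_set Z2) X H2" "\<forall>z\<in>Z2. p (H2 z) = h z" "H2 z1 = H1 z1"
      using l(2) z1 unfolding liftable_def by blast
    have eq: "H1 z = H2 z" if "z \<in> Z1" "z \<in> Z2" for z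
    proof (rule covering_map_unique_lift[OF cov, of "top_of_set (Z1 \<inter> Z2)" H1 H2 z1])
      show "continuous_map (top_of_set (Z1 \<inter> Z2)) X H1"
        using continuous_map_from_subtopology[OF H1(1), of Z2] by (simp add: subtopology_subtopology)
      show "continuous_map (top_of_set (Z1 \<inter> Z2)) X H2"
        using continuous_map_from_subtopology[OF H2(1), of Z1]
        by (simp add: subtopology_subtopology Int_commute)
    qed (use Z that z1 H1 H2 in \<open>auto simp: connected_space_subtopology\<close>)
    let ?H = "\<lambda>z. if z \<in> Z1 then H1 z else H2 z"
    have "continuous_map (top_of_set (Z1 \<union> Z2)) X ?H"
    proof (rule pasting_lemma_closed[where I = "{True, False}" and T = "\<lambda>b. if b then Z1 else Z2"
          and f = "\<lambda>b. if b then H1 else H2"])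
      show "closedin (top_of_set (Z1 \<union> Z2)) (if i then Z1 else Z2)" for i
        using Z by (auto intro: closed_subset)
      show "continuous_map (subtopology (top_of_set (Z1 \<union> Z2)) (if i then Z1 else Z2)) X
          (if i then H1 else H2)" for i
        using H1 H2 by (auto simp: subtopology_subtopology Int_absorb1)
      show "\<exists>j. j \<in> {True, False} \<and> x \<in> (if j then Z1 else Z2) \<and>
             (if x \<in> Z1 then H1 x else H2 x) = (if j then H1 else H2) x"
        if "x \<in> topspace (top_of_set (Z1 \<union> Z2))" for x
        using that by (intro exI[of _ "x \<in> Z1"]) auto
    qed (use eq in \<open>auto split: if_splits\<close>)
    then show ?thesis
      using H1 H2 z0 by (intro exI[of _ ?H]) auto
  qed
  show ?thesis
    unfolding liftable_def using *[OF Z l] *[of Z2 Z1] Z l by (auto simp: Int_commute Un_commute)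
qed

text \<open>Over an evenly covered set, a lift is \<open>h\<close> followed by the inverse of the
  sheet through the prescribed point.\<close>

lemma liftable_evenly:
  assumes cov: "covering_map X Y p" and h: "continuous_map euclidean Y h"
  shows "\<exists>W. open W \<and> z \<in> W \<and> (\<forall>Z\<subseteq>W. liftable X p h Z)"
proof -
  have pf: "h z \<in> topspace Y" using h by (auto simp: continuous_map_def)
  obtain V \<U> where V: "openin Y V" "h z \<in> V" "\<Union>\<U> = {x \<in> topspace X. p x \<in> V}" "pairwise disjnt \<U>"
      and Us: "\<forall>U\<in>\<U>. openin X U \<and> homeomorphic_map (subtopology X U) (subtopology Y V) p \<and> inj_on p U"
    using covering_map_evenly[OF cov pf] by (elim exE conjE) (rule that)
  have W: "open (h -` V)"
    using openin_continuous_map_preimage[OF h V(1)] unfolding vimage_def by simp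
  have "liftable X p h Z" if Z: "Z \<subseteq> h -` V" for Z
    unfolding liftable_def
  proof (intro ballI impI)
    fix z0 e assume z0: "z0 \<in> Z" "e \<in> topspace X" "p e = h z0"
    then have "e \<in> \<Union>\<U>" unfolding V(3) using Z by auto
    then obtain U where U: "U \<in> \<U>" "e \<in> U" by blast
    then obtain q where q: "homeomorphic_maps (subtopology X U) (subtopology Y V) p q"
      using Us homeomorphic_map_maps by blast
    have tX: "topspace (subtopology X U) = U" and tY: "topspace (subtopology Y V) = V"
      using V(1) Us U(1) by (auto dest: openin_subset)
    have "continuous_map (top_of_set Z) (subtopology Y V) h"
      using h Z by (auto simp: continuous_map_in_subtopology continuous_map_from_subtopology)
    moreover have "continuous_map (subtopology Y V) X q"
      using q continuous_map_into_fulltopology by (auto simp: homeomorphic_maps_def)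
    ultimately have "continuous_map (top_of_set Z) X (q \<circ> h)"
      by (rule continuous_map_compose)
    moreover have "p (q y) = y" if "y \<in> V" for y
      using q tY that by (auto simp: homeomorphic_maps_def)
    moreover have "q (p e) = e"
      using q tX U by (auto simp: homeomorphic_maps_def)
    ultimately show "\<exists>H. continuous_map (top_of_set Z) X H \<and> (\<forall>z\<in>Z. p (H z) = h z) \<and> H z0 = e"
      using Z z0 by (intro exI[of _ "q \<circ> h"]) auto
  qed
  with W V(2) show ?thesis by (intro exI[of _ "h -` V"]) auto
qed

text \<open>Bisection in each coordinate in turn. The fact \<open>strip\<close> bisects the second
  coordinate near a fixed first one and yields a width that works for the whole height; with it the
  first coordinate can be bisected.\<close>

lemma liftable_rectangle:
  assumes cov: "covering_map X Y p" and h: "continuous_map euclidean Y h"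
    and ab: "a \<le> b" "c \<le> d"
  shows "liftable X p h ({a..b} \<times> {c..d})"
proof -
  have conn: "connected ({a..b} \<times> {c..d})" for a b c d :: real
    by (intro connected_Times) auto
  have strip: "\<exists>\<delta>>0. \<forall>a b. a \<le> x \<and> x \<le> b \<and> b - a < \<delta> \<longrightarrow> liftable X p h ({a..b} \<times> {c..d})" for x
    using ab(2)
  proof (induction rule: Bolzano)
    case (trans c d e)
    then obtain \<delta>1 \<delta>2 where \<delta>: "\<delta>1 > 0" "\<delta>2 > 0"
      "\<forall>a b. a \<le> x \<and> x \<le> b \<and> b - a < \<delta>1 \<longrightarrow> liftable X p h ({a..b} \<times> {c..d})"
      "\<forall>a b. a \<le> x \<and> x \<le> b \<and> b - a < \<delta>2 \<longrightarrow> liftable X p h ({a..b} \<times> {d..e})"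
      by blast
    show ?case
    proof (intro exI[of _ "min \<delta>1 \<delta>2"] conjI allI impI)
      fix a b assume *: "a \<le> x \<and> x \<le> b \<and> b - a < min \<delta>1 \<delta>2"
      have "{a..b} \<times> {c..d} \<inter> {a..b} \<times> {d..e} = {a..b} \<times> {d..d}"
        "{a..b} \<times> {c..d} \<union> {a..b} \<times> {d..e} = {a..b} \<times> {c..e}"
        using trans(3,4) by auto
      then show "liftable X p h ({a..b} \<times> {c..e})"
        using liftable_glue[OF cov, of "{a..b} \<times> {c..d}" "{a..b} \<times> {d..e}" h] conn[of a b d d] \<delta> *
        by (auto simp: closed_Times)
    qed (use \<delta> in auto)
  next
    case (local y)
    obtain W where W: "open W" "(x, y) \<in> W" "\<And>Z. Z \<subseteq> W \<Longrightarrow> liftable X p h Z"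
      using liftable_evenly[OF cov h] by metis
    obtain A B where AB: "open A" "open B" "x \<in> A" "y \<in> B" "A \<times> B \<subseteq> W"
      using W(1,2) unfolding open_prod_def by (metis mem_Sigma_iff)
    obtain \<delta>1 where \<delta>1: "\<delta>1 > 0" "ball x \<delta>1 \<subseteq> A"
      using AB(1,3) open_contains_ball by blast
    obtain \<delta>2 where \<delta>2: "\<delta>2 > 0" "ball y \<delta>2 \<subseteq> B"
      using AB(2,4) open_contains_ball by blast
    have "liftable X p h ({a..b} \<times> {c..d})"
      if "a \<le> x \<and> x \<le> b \<and> b - a < \<delta>1" "c \<le> y \<and> y \<le> d \<and> d - c < \<delta>2" for a b c d
    proof (rule W(3))
      have "{a..b} \<subseteq> ball x \<delta>1" "{c..d} \<subseteq> ball y \<delta>2"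
        using that by (auto simp: dist_real_def)
      then show "{a..b} \<times> {c..d} \<subseteq> W" using \<delta>1 \<delta>2 AB(5) by blast
    qed
    then show ?case using \<delta>1(1) \<delta>2(1) by (intro exI[of _ \<delta>2]) blast
  qed
  show ?thesis
    using ab(1)
  proof (induction rule: Bolzano)
    case (trans a b e)
    have "{a..b} \<times> {c..d} \<inter> {b..e} \<times> {c..d} = {b..b} \<times> {c..d}"
      "{a..b} \<times> {c..d} \<union> {b..e} \<times> {c..d} = {a..e} \<times> {c..d}"
      using trans(3,4) by auto
    then show ?case
      using liftable_glue[OF cov, of "{a..b} \<times> {c..d}" "{b..e} \<times> {c..d}" h] conn[of b b c d] trans ab
      by (auto simp: closed_Times)
  qed (use strip in blast)
qed

lemma covering_map_lift_square:
  fixes h :: "real \<times> real \<Rightarrow> 'b"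
  assumes cov: "covering_map X Y p"
    and h: "continuous_map (top_of_set ({0..1} \<times> {0..1})) Y h"
    and e: "e \<in> topspace X" "p e = h (0, 0)"
  shows "\<exists>H. continuous_map (top_of_set ({0..1} \<times> {0..1})) X H \<and>
    (\<forall>z \<in> {0..1} \<times> {0..1}. p (H z) = h z) \<and> H (0, 0) = e"
proof -
  \<comment> \<open>Retracting the plane onto the square extends \<open>h\<close> to the whole
    plane, so the preimages of evenly covered sets are open in the plane and not merely relative to
    the square.\<close>
  let ?c = "\<lambda>z::real\<times>real. (max 0 (min 1 (fst z)), max 0 (min 1 (snd z)))"
  have c: "continuous_on UNIV ?c"
    by (intro continuous_intros)
  have "continuous_map euclidean (top_of_set ({0..1} \<times> {0..1})) ?c"
    using c by (simp add: continuous_map_in_subtopology image_subset_iff)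
  then have "continuous_map euclidean Y (h \<circ> ?c)"
    by (rule continuous_map_compose[OF _ h])
  from liftable_rectangle[OF cov this, of 0 1 0 1]
  obtain H where "continuous_map (top_of_set ({0..1} \<times> {0..1})) X H"
    "\<forall>z\<in>{0..1} \<times> {0..1}. p (H z) = (h \<circ> ?c) z" "H (0, 0) = e"
    unfolding liftable_def using e by force
  then show ?thesis by (intro exI[of _ H]) auto
qed

lemma continuous_map_square_edges:
  assumes "continuous_map (top_of_set ({0..1} \<times> {0..1})) X H" "0 \<le> a" "a \<le> (1::real)"
  shows "continuous_map (top_of_set {0..1}) X (\<lambda>t. H (a, t))"
    "continuous_map (top_of_set {0..1}) X (\<lambda>t. H (t, a))"
proof -
  have "continuous_map (top_of_set {0..1}) (top_of_set ({0..1} \<times> {0..1})) (\<lambda>t. (a, t))"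
    "continuous_map (top_of_set {0..1}) (top_of_set ({0..1} \<times> {0..1})) (\<lambda>t. (t, a))"
    using assms by (auto simp: continuous_map_in_subtopology intro!: continuous_intros)
  from this[THEN continuous_map_compose[OF _ assms(1)]]
  show "continuous_map (top_of_set {0..1}) X (\<lambda>t. H (a, t))"
    "continuous_map (top_of_set {0..1}) X (\<lambda>t. H (t, a))"
    by (simp_all add: comp_def)
qed

text \<open>A path is a square that ignores its first coordinate.\<close>

lemma covering_map_lift_path:
  assumes cov: "covering_map X Y p" and c: "pathin Y c" and e: "e \<in> topspace X" "p e = c 0"
  shows "\<exists>c'. pathin X c' \<and> c' 0 = e \<and> (\<forall>t\<in>{0..1}. p (c' t) = c t)"
proof -
  have "continuous_map (top_of_set ({0..1} \<times> {0..1})) (top_of_set {0..1}) (snd :: real \<times> real \<Rightarrow> real)"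
    by (auto simp: continuous_map_in_subtopology intro!: continuous_intros)
  then have cont: "continuous_map (top_of_set ({0..1} \<times> {0..1})) Y (c \<circ> (snd :: real \<times> real \<Rightarrow> real))"
    using c unfolding pathin_def by (intro continuous_map_compose)
  have "p e = (c \<circ> snd) (0, 0)" using e by simp
  from covering_map_lift_square[OF cov cont e(1) this]
  obtain H where "continuous_map (top_of_set ({0..1} \<times> {0..1})) X H"
    "\<forall>z \<in> {0..1::real} \<times> {0..1}. p (H z) = (c \<circ> snd) z" "H (0, 0) = e"
    by blast
  then show ?thesis
    using continuous_map_square_edges[of X H 0]
    by (intro exI[of _ "\<lambda>t. H (0, t)"]) (auto simp: pathin_def)
qed

text \<open>After lifting the square, unique lifting identifies its four sides with
  \<open>c\<close>, \<open>d\<close> and two constant paths. The side \<open>d\<close> needs the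
  corner provided by the constant side at \<open>c 0\<close>, and the last side needs the end of
  \<open>c\<close>. That the lifts have the same end is part of the conclusion.\<close>

lemma covering_map_lift_homotopy:
  assumes cov: "covering_map X Y p" and c: "pathin X c" and d: "pathin X d" "c 0 = d 0"
    and hom: "path_homotopic Y (p \<circ> c) (p \<circ> d)"
  shows "path_homotopic X c d"
proof -
  obtain h where h: "continuous_map (top_of_set ({0..1} \<times> {0..1})) Y h"
    "\<forall>t\<in>{0..1}. h (0, t) = (p \<circ> c) t \<and> h (1, t) = (p \<circ> d) t \<and> h (t, 0) = (p \<circ> c) 0 \<and> h (t, 1) = (p \<circ> c) 1"
    using iffD1[OF path_homotopic_alt hom] by blast
  have "c 0 \<in> topspace X" using pathin_in_topspace[OF c] by simp
  moreover have "p (c 0) = h (0, 0)" using h(2)[rule_format, of 0] by simp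
  ultimately have "\<exists>H. continuous_map (top_of_set ({0..1} \<times> {0..1})) X H \<and>
    (\<forall>z \<in> {0..1} \<times> {0..1}. p (H z) = h z) \<and> H (0, 0) = c 0"
    by (rule covering_map_lift_square[OF cov h(1)])
  then obtain H where H: "continuous_map (top_of_set ({0..1} \<times> {0..1})) X H"
    "\<forall>z \<in> {0..1} \<times> {0..1}. p (H z) = h z" "H (0, 0) = c 0"
    by blast
  have conn: "connected_space (top_of_set {0..1::real})"
    by (simp add: connected_space_subtopology)
  have uniq: "f t = g t"
    if "continuous_map (top_of_set {0..1}) X f" "continuous_map (top_of_set {0..1}) X g"
      "\<And>t. t \<in> {0..1} \<Longrightarrow> p (f t) = p (g t)" "f 0 = g 0" "t \<in> {0..1::real}" for f g t
    using covering_map_unique_lift[OF cov conn that(1,2), of 0 t] that(3-5) by simp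
  have const: "continuous_map (top_of_set {0..1::real}) X (\<lambda>_. c a)" if "0 \<le> a" "a \<le> 1" for a
    using pathin_in_topspace[OF c that] by simp
  note edge = continuous_map_square_edges[OF H(1)]
  have pH: "p (H (0, t)) = p (c t)" "p (H (1, t)) = p (d t)" "p (H (t, 0)) = p (c 0)"
    "p (H (t, 1)) = p (c 1)" if "t \<in> {0..1}" for t
    using H(2) h(2) that by simp_all
  have 1: "H (0, t) = c t" if "t \<in> {0..1}" for t
    by (rule uniq[OF edge(1) c[unfolded pathin_def] pH(1) _ that]) (simp_all add: H(3))
  have 2: "H (t, 0) = c 0" if "t \<in> {0..1}" for t
    by (rule uniq[OF edge(2) const pH(3) _ that]) (simp_all add: H(3))
  have 3: "H (1, t) = d t" if "t \<in> {0..1}" for t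
    by (rule uniq[OF edge(1) d(1)[unfolded pathin_def] pH(2) _ that]) (simp_all add: 2 d)
  have 4: "H (t, 1) = c 1" if "t \<in> {0..1}" for t
    by (rule uniq[OF edge(2) const pH(4) _ that]) (simp_all add: 1)
  show ?thesis
    unfolding path_homotopic_alt
    by (intro exI[of _ H] conjI ballI H(1)) (simp_all add: 1 2 3 4)
qed

section \<open>Fundamental groups\<close>

lemma loops_iff: "p \<in> loops X x \<longleftrightarrow> pathin X p \<and> p 0 = x \<and> p 1 = x"
  by (simp add: loops_def)

lemma loop_class_alt:
  assumes "p \<in> loops X x"
  shows "loop_class X x p = {q. path_homotopic X p q}"
  using assms by (simp add: loop_class_def path_homotopic_def loops_iff)

lemma loop_class_eq_iff:
  assumes "p \<in> loops X x" "q \<in> loops X x"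
  shows "loop_class X x p = loop_class X x q \<longleftrightarrow> path_homotopic X p q"
proof
  assume "loop_class X x p = loop_class X x q"
  moreover have "q \<in> loop_class X x q"
    using assms by (auto simp: loop_class_alt loops_iff)
  ultimately show "path_homotopic X p q"
    using assms by (auto simp: loop_class_alt)
next
  assume pq: "path_homotopic X p q"
  then have "path_homotopic X p r \<longleftrightarrow> path_homotopic X q r" for r
    using path_homotopic_trans path_homotopic_sym by metis
  then show "loop_class X x p = loop_class X x q"
    using assms by (simp add: loop_class_alt)
qed

lemma loops_join: "p \<in> loops X x \<Longrightarrow> q \<in> loops X x \<Longrightarrow> path_join p q \<in> loops X x"
  by (auto simp: loops_iff intro!: pathin_join)

lemma loops_rev: "p \<in> loops X x \<Longrightarrow> path_rev p \<in> loops X x"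
  by (auto simp: loops_iff intro!: pathin_rev)

lemma loops_compose: "continuous_map X Y f \<Longrightarrow> p \<in> loops X x \<Longrightarrow> f \<circ> p \<in> loops Y (f x)"
  by (auto simp: loops_iff pathin_compose)

lemma homotopic_in_loops: "p \<in> loops X x \<Longrightarrow> path_homotopic X p q \<Longrightarrow> q \<in> loops X x"
  using path_homotopic_ends[of X p q] path_homotopic_pathin[of X p q] by (simp add: loops_iff)

lemma fundamental_group_carrier:
  "carrier (fundamental_group X x) = loop_class X x ` loops X x"
  by (simp add: fundamental_group_def)

lemma fundamental_group_one: "\<one>\<^bsub>fundamental_group X x\<^esub> = loop_class X x (\<lambda>_. x)"
  by (simp add: fundamental_group_def)

lemma fundamental_group_mult:
  assumes "p \<in> loops X x" "q \<in> loops X x"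
  shows "loop_class X x p \<otimes>\<^bsub>fundamental_group X x\<^esub> loop_class X x q = loop_class X x (path_join p q)"
proof -
  have "loop_class X x (path_join a b) = loop_class X x (path_join p q)"
    if "path_homotopic X p a" "path_homotopic X q b" for a b
  proof -
    have "path_join a b \<in> loops X x"
      using homotopic_in_loops[OF assms(1) that(1)] homotopic_in_loops[OF assms(2) that(2)]
      by (rule loops_join)
    moreover have "path_homotopic X (path_join p q) (path_join a b)"
      using that assms by (intro path_homotopic_join) (auto simp: loops_iff)
    ultimately show ?thesis
      using assms by (simp add: loop_class_eq_iff loops_join path_homotopic_sym)
  qed
  moreover have "path_homotopic X p p" "path_homotopic X q q"
    using assms by (auto simp: loops_iff)
  ultimately have "(\<Union>a\<in>{a. path_homotopic X p a}. \<Union>b\<in>{b. path_homotopic X q b}. loop_class X x (path_join a b))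
      = loop_class X x (path_join p q)"
    by blast
  then show ?thesis
    using assms by (simp add: fundamental_group_def loop_class_alt)
qed

lemma group_fundamental_group:
  assumes x: "x \<in> topspace X"
  shows "group (fundamental_group X x)"
proof (rule groupI)
  let ?G = "fundamental_group X x"
  note c = fundamental_group_mult[where X = X and x = x]
  note carr = fundamental_group_carrier[of X x] and one = fundamental_group_one[of X x]
  have const: "(\<lambda>_. x) \<in> loops X x"
    using x by (simp add: loops_iff)
  show "\<one>\<^bsub>?G\<^esub> \<in> carrier ?G"
    unfolding carr one using const by blast
  show "a \<otimes>\<^bsub>?G\<^esub> b \<in> carrier ?G" if ab: "a \<in> carrier ?G" "b \<in> carrier ?G" for a b
    using ab unfolding carr by (auto simp: c intro!: loops_join)
  show "a \<otimes>\<^bsub>?G\<^esub> b \<otimes>\<^bsub>?G\<^esub> d = a \<otimes>\<^bsub>?G\<^esub> (b \<otimes>\<^bsub>?G\<^esub> d)"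
    if abd: "a \<in> carrier ?G" "b \<in> carrier ?G" "d \<in> carrier ?G" for a b d
  proof -
    obtain p q r where "p \<in> loops X x" "q \<in> loops X x" "r \<in> loops X x"
      "a = loop_class X x p" "b = loop_class X x q" "d = loop_class X x r"
      using abd unfolding carr by blast
    moreover from this have "path_homotopic X (path_join (path_join p q) r) (path_join p (path_join q r))"
      by (intro path_homotopic_assoc) (auto simp: loops_iff)
    ultimately show ?thesis by (simp add: c loops_join loop_class_eq_iff)
  qed
  show "\<one>\<^bsub>?G\<^esub> \<otimes>\<^bsub>?G\<^esub> a = a" if a: "a \<in> carrier ?G" for a
  proof -
    obtain p where p: "p \<in> loops X x" "a = loop_class X x p"
      using a unfolding carr by blast
    moreover from this have "path_homotopic X (path_join (\<lambda>_. x) p) p"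
      by (intro path_homotopic_lid) (auto simp: loops_iff)
    ultimately show ?thesis
      using const by (simp add: c one loops_join loop_class_eq_iff)
  qed
  show "\<exists>b\<in>carrier ?G. b \<otimes>\<^bsub>?G\<^esub> a = \<one>\<^bsub>?G\<^esub>" if a: "a \<in> carrier ?G" for a
  proof -
    obtain p where p: "p \<in> loops X x" "a = loop_class X x p"
      using a unfolding carr by blast
    have "path_homotopic X (path_join (path_rev p) p) (\<lambda>_. x)"
      using p path_homotopic_linv[of X p] by (simp add: loops_iff)
    then have "loop_class X x (path_rev p) \<otimes>\<^bsub>?G\<^esub> a = \<one>\<^bsub>?G\<^esub>"
      using const p by (simp add: c one loops_join loops_rev loop_class_eq_iff)
    then show ?thesis
      unfolding carr using loops_rev[OF p(1)] by blast
  qed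
qed

lemma fundamental_group_map_class:
  assumes f: "continuous_map X Y f" and p: "p \<in> loops X x"
  shows "fundamental_group_map Y f x (loop_class X x p) = loop_class Y (f x) (f \<circ> p)"
proof -
  have "loop_class Y (f x) (f \<circ> a) = loop_class Y (f x) (f \<circ> p)" if "path_homotopic X p a" for a
    using path_homotopic_compose[OF path_homotopic_sym[OF that] f]
      loops_compose[OF f p] loops_compose[OF f homotopic_in_loops[OF p that]]
    by (simp add: loop_class_eq_iff)
  moreover have "path_homotopic X p p"
    using p by (auto simp: loops_iff)
  ultimately have "(\<Union>a\<in>{a. path_homotopic X p a}. loop_class Y (f x) (f \<circ> a)) = loop_class Y (f x) (f \<circ> p)"
    by blast
  then show ?thesis
    using p by (simp add: fundamental_group_map_def loop_class_alt)
qed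

lemma fundamental_group_map_hom:
  assumes f: "continuous_map X Y f"
  shows "fundamental_group_map Y f x \<in> hom (fundamental_group X x) (fundamental_group Y (f x))"
  unfolding hom_def fundamental_group_carrier
  by (auto simp: fundamental_group_map_class[OF f] fundamental_group_mult loops_join loops_compose[OF f]
      path_join_comp)

section \<open>Orbit spaces of free actions\<close>

text \<open>\<^locale>\<open>group_action\<close> is not used since it requires the action to consist of extensional functions.\<close>

lemma regular_covering_orbit_space:
  fixes G (structure)
  assumes G: "group G"
    and cont: "\<And>g. g \<in> carrier G \<Longrightarrow> continuous_map X X (\<phi> g)"
    and act_one: "\<And>x. x \<in> topspace X \<Longrightarrow> \<phi> \<one> x = x"
    and act_mult: "\<And>g h x. g \<in> carrier G \<Longrightarrow> h \<in> carrier G \<Longrightarrow> x \<in> topspace X \<Longrightarrow>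
      \<phi> (g \<otimes> h) x = \<phi> g (\<phi> h x)"
    and slice: "\<And>x. x \<in> topspace X \<Longrightarrow> \<exists>U. openin X U \<and> x \<in> U \<and>
      (\<forall>g\<in>carrier G. \<forall>u\<in>U. \<phi> g u \<in> U \<longrightarrow> g = \<one>)"
  shows "regular_covering X (orbit_space G \<phi> X) (orbit G \<phi>)"
proof -
  interpret group G by fact
  let ?q = "orbit G \<phi>" and ?Y = "orbit_space G \<phi> X"
  have closed: "\<phi> g x \<in> topspace X" if "g \<in> carrier G" "x \<in> topspace X" for g x
    using cont[OF that(1)] that(2) by (auto simp: continuous_map_def)
  have cancel: "\<phi> (inv g) (\<phi> g x) = x" "\<phi> g (\<phi> (inv g) x) = x"
    if "g \<in> carrier G" "x \<in> topspace X" for g x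
    using that act_mult[of "inv g" g x] act_mult[of g "inv g" x] act_one by simp_all
  have q_act: "?q (\<phi> g x) = ?q x" if gx: "g \<in> carrier G" "x \<in> topspace X" for g x
  proof (intro subset_antisym subsetI)
    fix y assume "y \<in> ?q (\<phi> g x)"
    then obtain h where "h \<in> carrier G" "y = \<phi> h (\<phi> g x)" by (auto simp: orbit_def)
    then show "y \<in> ?q x"
      using gx unfolding orbit_def by (intro CollectI exI[of _ "h \<otimes> g"]) (simp add: act_mult)
  next
    fix y assume "y \<in> ?q x"
    then obtain h where "h \<in> carrier G" "y = \<phi> h x" by (auto simp: orbit_def)
    then show "y \<in> ?q (\<phi> g x)"
      using gx unfolding orbit_def
      by (intro CollectI exI[of _ "h \<otimes> inv g"]) (simp add: act_mult closed cancel)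
  qed
  have q_eq: "\<exists>g\<in>carrier G. y = \<phi> g x" if "?q x = ?q y" "y \<in> topspace X" for x y
  proof -
    have "\<phi> \<one> y \<in> ?q y" unfolding orbit_def by blast
    then show ?thesis
      using that act_one by (auto simp: orbit_def)
  qed
  have top: "topspace ?Y = ?q ` topspace X"
  proof -
    have "openin ?Y (orbits G (topspace X) \<phi>)"
      unfolding openin_orbit_space by (auto simp: orbits_def intro: openin_subopen[THEN iffD2])
    then have "topspace ?Y = orbits G (topspace X) \<phi>"
      by (metis openin_orbit_space openin_subset openin_topspace subset_antisym)
    then show ?thesis by (auto simp: orbits_def)
  qed
  have contq: "continuous_map X ?Y ?q"
    unfolding continuous_map_def top by (auto simp: openin_orbit_space)
  have act_open: "openin X (\<phi> g ` U)" if "g \<in> carrier G" "openin X U" for g U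
  proof -
    have "\<phi> g ` U = {x \<in> topspace X. \<phi> (inv g) x \<in> U}"
      using that openin_subset[OF that(2)] closed cancel by (auto; metis image_eqI subsetD inv_closed)
    then show ?thesis
      using openin_continuous_map_preimage[OF cont that(2)] that(1) by simp
  qed
  have saturate: "{x \<in> topspace X. ?q x \<in> ?q ` U} = (\<Union>g\<in>carrier G. \<phi> g ` U)"
    if UX: "U \<subseteq> topspace X" for U
  proof (intro subset_antisym subsetI)
    fix x assume "x \<in> {x \<in> topspace X. ?q x \<in> ?q ` U}"
    then obtain u where u: "u \<in> U" "?q u = ?q x" "x \<in> topspace X" by auto
    then show "x \<in> (\<Union>g\<in>carrier G. \<phi> g ` U)"
      using q_eq[OF u(2,3)] by blast
  next
    fix x assume "x \<in> (\<Union>g\<in>carrier G. \<phi> g ` U)"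
    then obtain g u where "g \<in> carrier G" "u \<in> U" "x = \<phi> g u" by blast
    then show "x \<in> {x \<in> topspace X. ?q x \<in> ?q ` U}"
      using q_act[of g u] closed[of g u] UX by auto
  qed
  have openq: "openin ?Y (?q ` U)" if U: "openin X U" for U
  proof -
    have UX: "U \<subseteq> topspace X" using U by (rule openin_subset)
    have "openin X {x \<in> topspace X. ?q x \<in> ?q ` U}"
      unfolding saturate[OF UX] using act_open[OF _ U] by blast
    then show ?thesis
      using UX by (auto simp: openin_orbit_space orbits_def)
  qed
  have ev: "\<exists>V. openin ?Y V \<and> y \<in> V \<and> (\<exists>\<U>. \<Union>\<U> = {x \<in> topspace X. ?q x \<in> V} \<and> pairwise disjnt \<U> \<and>
             (\<forall>U\<in>\<U>. openin X U \<and> homeomorphic_map (subtopology X U) (subtopology ?Y V) ?q))"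
    if y: "y \<in> topspace ?Y" for y
  proof -
    obtain x where x: "x \<in> topspace X" "y = ?q x"
      using y top by auto
    obtain U where U: "openin X U" "x \<in> U" "\<And>g u. g \<in> carrier G \<Longrightarrow> u \<in> U \<Longrightarrow> \<phi> g u \<in> U \<Longrightarrow> g = \<one>"
      using slice[OF x(1)] by blast
    have UX: "U \<subseteq> topspace X" using U(1) by (rule openin_subset)
    \<comment> \<open>The translates of \<open>U\<close> will be the sheets. If gu = hv, then g^-1 h
      moves \<open>v\<close> to \<open>u\<close>, both in \<open>U\<close>, and is therefore
      trivial.\<close>
    have same: "g = h" if gh: "g \<in> carrier G" "h \<in> carrier G" "u \<in> U" "v \<in> U" "\<phi> g u = \<phi> h v" for g h u v
    proof -
      have "\<phi> (inv g \<otimes> h) v = u"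
        using gh subsetD[OF UX gh(3)] subsetD[OF UX gh(4)] cancel(1)[of g u] by (simp add: act_mult)
      then have "inv g \<otimes> h = \<one>"
        using U(3)[of "inv g \<otimes> h" v] gh by simp
      then show ?thesis
        using gh by (metis inv_equality inv_inv inv_closed)
    qed
    let ?\<U> = "(\<lambda>g. \<phi> g ` U) ` carrier G"
    have "\<Union>?\<U> = {x \<in> topspace X. ?q x \<in> ?q ` U}"
      using saturate[OF UX] by simp
    moreover have "pairwise disjnt ?\<U>"
      unfolding pairwise_def disjnt_def using same by blast
    moreover have "homeomorphic_map (subtopology X (\<phi> g ` U)) (subtopology ?Y (?q ` U)) ?q"
      if g: "g \<in> carrier G" for g
    proof (rule bijective_open_imp_homeomorphic_map)
      have gU: "openin X (\<phi> g ` U)" "\<phi> g ` U \<subseteq> topspace X"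
        using act_open[OF g U(1)] openin_subset by auto
      have img: "?q ` (\<phi> g ` U) = ?q ` U"
        using q_act[OF g] UX by (auto simp: image_iff subset_iff)
      have tX: "topspace (subtopology X (\<phi> g ` U)) = \<phi> g ` U"
        using gU by auto
      have tY: "topspace (subtopology ?Y (?q ` U)) = ?q ` U"
        using openin_subset[OF openq[OF U(1)]] by auto
      show "continuous_map (subtopology X (\<phi> g ` U)) (subtopology ?Y (?q ` U)) ?q"
        using continuous_map_from_subtopology[OF contq] img
        by (simp add: continuous_map_in_subtopology flip: image_subset_iff_funcset) blast
      show "open_map (subtopology X (\<phi> g ` U)) (subtopology ?Y (?q ` U)) ?q"
        unfolding open_map_def
      proof (intro allI impI)
        fix W assume "openin (subtopology X (\<phi> g ` U)) W"
        then have W: "openin X W" "W \<subseteq> \<phi> g ` U"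
          using openin_open_subtopology[OF gU(1)] by auto
        then have "?q ` W \<subseteq> ?q ` U" using img by blast
        then show "openin (subtopology ?Y (?q ` U)) (?q ` W)"
          using openin_open_subtopology[OF openq[OF U(1)]] openq[OF W(1)] by blast
      qed
      show "?q ` topspace (subtopology X (\<phi> g ` U)) = topspace (subtopology ?Y (?q ` U))"
        unfolding tX tY by (rule img)
      show "inj_on ?q (topspace (subtopology X (\<phi> g ` U)))"
        unfolding tX
      proof (rule inj_onI, elim imageE)
        fix a b u v assume *: "?q a = ?q b" "a = \<phi> g u" "u \<in> U" "b = \<phi> g v" "v \<in> U"
        have "?q u = ?q v"
          using * g UX q_act by (metis subsetD)
        then obtain h where h: "h \<in> carrier G" "v = \<phi> h u"
          using q_eq[of u v] * UX by blast
        then have "h = \<one>" using U(3) * by blast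
        then show "a = b" using * h UX act_one by auto
      qed
    qed
    ultimately show ?thesis
      using x U openq[OF U(1)] act_open[OF _ U(1)]
      by (intro exI[of _ "?q ` U"] conjI exI[of _ ?\<U>]) auto
  qed
  have "covering_map X ?Y ?q"
    unfolding covering_map_def by (intro conjI ballI contq top[symmetric] ev)
  moreover have "\<exists>h. homeomorphic_map X X h \<and> (\<forall>z\<in>topspace X. ?q (h z) = ?q z) \<and> h x = x'"
    if xx: "x \<in> topspace X" "x' \<in> topspace X" "?q x = ?q x'" for x x'
  proof -
    obtain g where g: "g \<in> carrier G" "x' = \<phi> g x"
      using q_eq[OF xx(3,2)] by blast
    have "homeomorphic_maps X X (\<phi> g) (\<phi> (inv g))"
      unfolding homeomorphic_maps_def using g cont cancel by auto
    then have "homeomorphic_map X X (\<phi> g)"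
      by (metis homeomorphic_map_maps)
    then show ?thesis
      using g q_act[OF g(1)] by (intro exI[of _ "\<phi> g"]) simp
  qed
  ultimately show ?thesis
    unfolding regular_covering_def by blast
qed

section \<open>Locally finite simplicial complexes\<close>

definition geom :: "'v set set \<Rightarrow> ('v \<Rightarrow> real) set" where
  "geom K = (\<Union>\<sigma>\<in>K. closed_simplex \<sigma>)"

definition supp :: "('v \<Rightarrow> real) \<Rightarrow> 'v set" where
  "supp f = {v. f v \<noteq> 0}"

definition segment :: "('v \<Rightarrow> real) \<Rightarrow> ('v \<Rightarrow> real) \<Rightarrow> real \<Rightarrow> 'v \<Rightarrow> real" where
  "segment x y = (\<lambda>t v. (1 - t) * x v + t * y v)"

lemma segment_ends [simp]: "segment x y 0 = x" "segment x y 1 = y"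
  by (auto simp: segment_def)

lemma segment_const [simp]: "segment x x = (\<lambda>_. x)"
  by (auto simp: segment_def algebra_simps)

lemma segment_rev [simp]: "path_rev (segment x y) = segment y x"
  by (auto simp: segment_def path_rev_def fun_eq_iff)

lemma segment_flip: "segment x y (1 - t) = segment y x t"
  by (auto simp: segment_def)

lemma closed_simplexD:
  assumes "f \<in> closed_simplex \<sigma>"
  shows "0 \<le> f v" "v \<notin> \<sigma> \<Longrightarrow> f v = 0" "(\<Sum>v\<in>\<sigma>. f v) = 1"
  using assms by (auto simp: closed_simplex_def)

lemma closed_simplex_supp:
  assumes f: "f \<in> closed_simplex \<sigma>" and \<sigma>: "finite \<sigma>"
  shows "supp f \<subseteq> \<sigma>" "supp f \<noteq> {}" "f \<in> closed_simplex (supp f)"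
proof -
  show sub: "supp f \<subseteq> \<sigma>" using f by (auto simp: supp_def closed_simplex_def)
  have "(\<Sum>v\<in>supp f. f v) = (\<Sum>v\<in>\<sigma>. f v)"
    by (rule sum.mono_neutral_left[OF \<sigma> sub]) (auto simp: supp_def)
  then have 1: "(\<Sum>v\<in>supp f. f v) = 1" using closed_simplexD(3)[OF f] by simp
  then show "supp f \<noteq> {}" by auto
  show "f \<in> closed_simplex (supp f)"
    using 1 f by (auto simp: closed_simplex_def supp_def)
qed

lemma closed_simplex_segment:
  assumes "x \<in> closed_simplex \<sigma>" "y \<in> closed_simplex \<sigma>" "0 \<le> t" "t \<le> 1"
  shows "segment x y t \<in> closed_simplex \<sigma>"
  using assms by (auto simp: closed_simplex_def segment_def sum.distrib simp flip: sum_distrib_left)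

lemma vertex_point_simplex: "finite \<sigma> \<Longrightarrow> v \<in> \<sigma> \<Longrightarrow> vertex_point v \<in> closed_simplex \<sigma>"
  by (auto simp: closed_simplex_def vertex_point_def indicator_def)

lemma supp_vertex_point [simp]: "supp (vertex_point v) = {v}"
  by (auto simp: supp_def vertex_point_def indicator_def)

lemma vertex_point_eq [simp]: "vertex_point v = vertex_point w \<longleftrightarrow> v = w"
  by (metis supp_vertex_point singleton_inject)

lemma closed_closed_simplex:
  assumes "finite \<sigma>"
  shows "closed (closed_simplex \<sigma>)"
proof -
  have "closed_simplex \<sigma> = (\<Inter>v. {f. 0 \<le> f v}) \<inter> (\<Inter>v\<in>-\<sigma>. {f. f v = 0}) \<inter> {f. (\<Sum>v\<in>\<sigma>. f v) = 1}"
    by (auto simp: closed_simplex_def)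
  moreover have "closed {f::'a \<Rightarrow> real. 0 \<le> f v}" "closed {f::'a \<Rightarrow> real. f v = 0}" for v
    by (intro closed_Collect_le closed_Collect_eq continuous_on_const continuous_on_product_coordinates)+
  moreover have "closed {f::'a \<Rightarrow> real. (\<Sum>v\<in>\<sigma>. f v) = 1}"
    by (intro closed_Collect_eq continuous_on_const continuous_on_sum continuous_on_product_coordinates)
  ultimately show ?thesis
    by (auto intro!: closed_Int closed_INT)
qed

lemma pathin_top_of_set:
  "pathin (top_of_set X) c \<longleftrightarrow> continuous_on {0..1} c \<and> c ` {0..1} \<subseteq> X"
  by (auto simp: pathin_def continuous_map_in_subtopology)

lemma continuous_on_coord: "continuous_on A (c :: 'a::topological_space \<Rightarrow> 'v \<Rightarrow> real) \<Longrightarrow> continuous_on A (\<lambda>z. c z v)"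
  by (rule continuous_on_product_then_coordinatewise)

lemma continuous_on_segment:
  fixes c d :: "'a::topological_space \<Rightarrow> 'v \<Rightarrow> real"
  assumes "continuous_on A c" "continuous_on A d" "continuous_on A f"
  shows "continuous_on A (\<lambda>z. segment (c z) (d z) (f z))"
  unfolding segment_def
  by (rule continuous_on_coordinatewise_then_product)
    (intro continuous_on_add continuous_on_mult continuous_on_diff continuous_on_const assms(3)
      continuous_on_coord[OF assms(1)] continuous_on_coord[OF assms(2)])

locale lf_complex =
  fixes K :: "'v set set"
  assumes simplex_finite: "\<sigma> \<in> K \<Longrightarrow> finite \<sigma>"
    and simplex_face: "\<sigma> \<in> K \<Longrightarrow> \<tau> \<subseteq> \<sigma> \<Longrightarrow> \<tau> \<noteq> {} \<Longrightarrow> \<tau> \<in> K"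
    and star_finite: "finite {\<sigma> \<in> K. v \<in> \<sigma>}"
begin

lemma geomI: "\<sigma> \<in> K \<Longrightarrow> x \<in> closed_simplex \<sigma> \<Longrightarrow> x \<in> geom K"
  by (auto simp: geom_def)

lemma geom_supp:
  assumes "x \<in> geom K"
  shows "supp x \<in> K" "x \<in> closed_simplex (supp x)" "0 \<le> x v"
proof -
  obtain \<sigma> where \<sigma>: "\<sigma> \<in> K" "x \<in> closed_simplex \<sigma>" using assms by (auto simp: geom_def)
  note s = closed_simplex_supp[OF \<sigma>(2) simplex_finite[OF \<sigma>(1)]]
  show "supp x \<in> K" using simplex_face[OF \<sigma>(1) s(1,2)] .
  show "x \<in> closed_simplex (supp x)" by (rule s(3))
  show "0 \<le> x v" using closed_simplexD(1)[OF \<sigma>(2)] .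
qed

lemma vertex_point_geom: "\<sigma> \<in> K \<Longrightarrow> v \<in> \<sigma> \<Longrightarrow> vertex_point v \<in> closed_simplex \<sigma>"
  by (rule vertex_point_simplex[OF simplex_finite])

text \<open>Local finiteness makes the weak topology agree with the topology of coordinatewise convergence.\<close>

lemma realization_eq: "realization K = top_of_set (geom K)"
proof (rule topology_eq[THEN iffD2], intro allI iffI)
  fix U assume "openin (realization K) U"
  then have U: "U \<subseteq> geom K" "\<And>\<sigma>. \<sigma> \<in> K \<Longrightarrow> openin (top_of_set (closed_simplex \<sigma>)) (U \<inter> closed_simplex \<sigma>)"
    by (auto simp: openin_realization geom_def)
  have "\<exists>N. openin (top_of_set (geom K)) N \<and> x \<in> N \<and> N \<subseteq> U" if x: "x \<in> U" for x
  proof -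
    have xg: "x \<in> geom K" using x U by blast
    obtain v where v: "v \<in> supp x"
      using closed_simplex_supp(2)[OF geom_supp(2)[OF xg] simplex_finite[OF geom_supp(1)[OF xg]]] by blast
    \<comment> \<open>Points with positive coordinate \<open>v\<close> lie only in simplices
      containing \<open>v\<close>. There are finitely many of these, so removing from each its
      closed part outside \<open>U\<close> leaves an open condition.\<close>
    let ?S = "{\<sigma> \<in> K. v \<in> \<sigma>}"
    define F where "F = (\<Union>\<sigma>\<in>?S. closed_simplex \<sigma> - U)"
    have "closed (closed_simplex \<sigma> - U)" if \<sigma>: "\<sigma> \<in> K" for \<sigma>
    proof -
      have "closedin (top_of_set (closed_simplex \<sigma>)) (closed_simplex \<sigma> - (U \<inter> closed_simplex \<sigma>))"
        using U(2)[OF \<sigma>] by (simp add: closedin_diff)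
      then have "closedin (top_of_set (closed_simplex \<sigma>)) (closed_simplex \<sigma> - U)"
        by (metis Diff_Int_distrib2 Diff_cancel Diff_Int Un_empty_right)
      then show ?thesis
        using closed_closed_simplex[OF simplex_finite[OF \<sigma>]] closedin_closed_trans by blast
    qed
    then have F: "closed F"
      unfolding F_def using star_finite by (intro closed_UN) auto
    have N: "open ({f. 0 < f v} - F)"
      by (intro open_Diff F open_Collect_less continuous_on_const continuous_on_product_coordinates)
    have "x v > 0" using v geom_supp(3)[OF xg, of v] by (auto simp: supp_def)
    moreover have "geom K \<inter> ({f. 0 < f v} - F) \<subseteq> U"
    proof
      fix y assume y: "y \<in> geom K \<inter> ({f. 0 < f v} - F)"
      then have "v \<in> supp y" by (auto simp: supp_def)
      then have "y \<in> closed_simplex (supp y)" "supp y \<in> ?S"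
        using geom_supp y by auto
      then show "y \<in> U" using y unfolding F_def by blast
    qed
    moreover have "x \<notin> F" using x by (auto simp: F_def)
    ultimately show ?thesis
      using xg N by (intro exI[of _ "geom K \<inter> ({f. 0 < f v} - F)"]) (auto simp: openin_open_Int)
  qed
  then show "openin (top_of_set (geom K)) U"
    by (subst openin_subopen) blast
next
  fix U assume "openin (top_of_set (geom K)) U"
  then obtain T where T: "open T" "U = geom K \<inter> T" by (auto simp: openin_open)
  have "openin (top_of_set (closed_simplex \<sigma>)) (U \<inter> closed_simplex \<sigma>)" if "\<sigma> \<in> K" for \<sigma>
  proof -
    have "U \<inter> closed_simplex \<sigma> = closed_simplex \<sigma> \<inter> T"
      using that T by (auto simp: geom_def)
    then show ?thesis using T by (simp add: openin_open_Int)
  qed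
  then show "openin (realization K) U"
    using T by (auto simp: openin_realization geom_def)
qed

abbreviation "X \<equiv> top_of_set (geom K)"

text \<open>At each time the two points share a simplex, so the segment between them stays in the
  complex.\<close>

lemma contiguous_homotopic:
  assumes c: "pathin X c" and d: "pathin X d" and ends: "c 0 = d 0" "c 1 = d 1"
    and cont: "\<And>t. 0 \<le> t \<Longrightarrow> t \<le> 1 \<Longrightarrow> \<exists>\<sigma>\<in>K. c t \<in> closed_simplex \<sigma> \<and> d t \<in> closed_simplex \<sigma>"
  shows "path_homotopic X c d"
proof -
  let ?h = "\<lambda>z. segment (c (snd z)) (d (snd z)) (fst z)"
  have "continuous_on ({0..1} \<times> {0..1}) (\<lambda>z::real\<times>real. c (snd z))"
    "continuous_on ({0..1} \<times> {0..1}) (\<lambda>z::real\<times>real. d (snd z))"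
    using c d unfolding pathin_top_of_set
    by (auto intro!: continuous_on_compose2[of "{0..1}" c _ snd] continuous_on_compose2[of "{0..1}" d _ snd]
        continuous_on_snd continuous_on_id)
  then have "continuous_on ({0..1} \<times> {0..1}) ?h"
    by (rule continuous_on_segment) (rule continuous_on_fst[OF continuous_on_id])
  moreover have "?h ` ({0..1} \<times> {0..1}) \<subseteq> geom K"
  proof (rule image_subsetI)
    fix z :: "real \<times> real" assume z: "z \<in> {0..1} \<times> {0..1}"
    then obtain \<sigma> where \<sigma>: "\<sigma> \<in> K" "c (snd z) \<in> closed_simplex \<sigma>" "d (snd z) \<in> closed_simplex \<sigma>"
      using cont[of "snd z"] by (cases z) auto
    have "?h z \<in> closed_simplex \<sigma>"
      by (rule closed_simplex_segment) (use \<sigma> z in auto)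
    then show "?h z \<in> geom K" using \<sigma>(1) by (rule geomI[rotated])
  qed
  ultimately have "continuous_map (top_of_set ({0..1} \<times> {0..1})) X ?h"
    by (simp add: continuous_map_in_subtopology image_subset_iff_funcset)
  then show ?thesis
    unfolding path_homotopic_alt by (intro exI[of _ ?h] conjI ballI) (simp_all add: ends)
qed

lemma pathin_segment:
  assumes "\<sigma> \<in> K" "x \<in> closed_simplex \<sigma>" "y \<in> closed_simplex \<sigma>"
  shows "pathin X (segment x y)"
proof -
  have "continuous_on {0..1::real} (\<lambda>t. segment x y t)"
    by (rule continuous_on_segment) (auto intro: continuous_intros)
  then show ?thesis
    unfolding pathin_top_of_set
    using assms closed_simplex_segment[of x \<sigma> y] geomI by auto
qed

lemma triangle_homotopic:
  assumes "\<sigma> \<in> K" "x \<in> closed_simplex \<sigma>" "y \<in> closed_simplex \<sigma>" "z \<in> closed_simplex \<sigma>"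
  shows "path_homotopic X (path_join (segment x y) (segment y z)) (segment x z)"
proof (rule contiguous_homotopic)
  show "pathin X (path_join (segment x y) (segment y z))" "pathin X (segment x z)"
    using assms by (auto intro!: pathin_join pathin_segment)
  show "\<exists>\<sigma>\<in>K. path_join (segment x y) (segment y z) t \<in> closed_simplex \<sigma> \<and> segment x z t \<in> closed_simplex \<sigma>"
    if "0 \<le> t" "t \<le> 1" for t
    using assms that by (intro bexI[of _ \<sigma>]) (auto simp: path_join_def intro!: closed_simplex_segment)
qed auto

text \<open>Contracting every point of the path to \<open>v\<close> gives a map of the square with
  \<open>c\<close> on one side. The other three sides form the route through \<open>v\<close>, and
  two routes with the same ends in a convex square are homotopic.\<close>

lemma star_homotopic:
  assumes c: "pathin X c" and v: "\<And>t. 0 \<le> t \<Longrightarrow> t \<le> 1 \<Longrightarrow> v \<in> supp (c t)"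
  shows "path_homotopic X c (path_join (segment (c 0) (vertex_point v)) (segment (vertex_point v) (c 1)))"
proof -
  let ?v = "vertex_point v"
  let ?H = "\<lambda>z::real\<times>real. segment (c (snd z)) ?v (fst z)"
  let ?Q = "{0..1} \<times> {0..1::real}"
  have simplex: "supp (c t) \<in> K" "c t \<in> closed_simplex (supp (c t))" "?v \<in> closed_simplex (supp (c t))"
    if "0 \<le> t" "t \<le> 1" for t
  proof -
    have "c t \<in> geom K" using pathin_in_topspace[OF c that] by simp
    then show "supp (c t) \<in> K" "c t \<in> closed_simplex (supp (c t))" using geom_supp by auto
    then show "?v \<in> closed_simplex (supp (c t))" using vertex_point_geom v[OF that] by blast
  qed
  have "continuous_on ?Q (\<lambda>z. c (snd z))"
    using c unfolding pathin_top_of_set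
    by (auto intro!: continuous_on_compose2[of "{0..1}" c _ snd] continuous_on_snd continuous_on_id)
  then have "continuous_on ?Q ?H"
    by (rule continuous_on_segment) (rule continuous_on_const continuous_on_fst[OF continuous_on_id])+
  moreover have "?H z \<in> geom K" if "z \<in> ?Q" for z
  proof -
    have "?H z \<in> closed_simplex (supp (c (snd z)))"
      by (rule closed_simplex_segment) (use simplex that in auto)
    then show ?thesis using simplex(1)[of "snd z"] that by (auto intro: geomI)
  qed
  ultimately have H: "continuous_map (top_of_set ?Q) X ?H"
    by (auto simp: continuous_map_in_subtopology)
  \<comment> \<open>These three sides are sent to the segment from \<open>c 0\<close> to
    \<open>v\<close>, the constant path at \<open>v\<close>, and the segment from \<open>v\<close>
    to \<open>c 1\<close>.\<close>
  let ?\<gamma>' = "path_join (\<lambda>t. (t, 0)) (path_join (\<lambda>t. (1, t)) (\<lambda>t::real. (1 - t, 1::real)))"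
  have "pathin (top_of_set ?Q) ?\<gamma>'"
    by (intro pathin_join) (auto simp: pathin_top_of_set intro!: continuous_intros)
  then have h: "path_homotopic X (?H \<circ> (\<lambda>t. (0, t))) (?H \<circ> ?\<gamma>')"
    by (intro path_homotopic_convex[OF _ H]) (auto simp: pathin_top_of_set convex_Times intro!: continuous_intros)
  have e1: "?H \<circ> (\<lambda>t. (0, t)) = c" by (auto simp: fun_eq_iff)
  have e2: "?H \<circ> ?\<gamma>' = path_join (segment (c 0) ?v) (path_join (\<lambda>_. ?v) (segment ?v (c 1)))"
    unfolding path_join_comp by (simp add: comp_def segment_flip)
  have "path_homotopic X (path_join (segment (c 0) ?v) (path_join (\<lambda>_. ?v) (segment ?v (c 1))))
     (path_join (segment (c 0) ?v) (segment ?v (c 1)))"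
    using simplex[of 0] simplex[of 1]
    by (intro path_homotopic_join path_homotopic_refl path_homotopic_lid pathin_segment[of "supp (c 0)"]
        pathin_segment[of "supp (c 1)"]) auto
  with h show ?thesis
    unfolding e1 e2 by (rule path_homotopic_trans)
qed

end

section \<open>Affine extensions of vertex maps\<close>

lemma realization_map_alt:
  assumes "finite \<sigma>" "supp f \<subseteq> \<sigma>"
  shows "realization_map \<phi> f w = (\<Sum>v\<in>{v \<in> \<sigma>. \<phi> v = w}. f v)"
  unfolding realization_map_def using assms
  by (intro sum.mono_neutral_left) (auto simp: supp_def)

lemma realization_map_segment:
  assumes "finite \<sigma>" "supp x \<subseteq> \<sigma>" "supp y \<subseteq> \<sigma>"
  shows "realization_map \<phi> (segment x y t) = segment (realization_map \<phi> x) (realization_map \<phi> y) t"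
proof
  fix w
  have "supp (segment x y t) \<subseteq> supp x \<union> supp y" by (auto simp: supp_def segment_def)
  then have "supp (segment x y t) \<subseteq> \<sigma>" using assms by blast
  then show "realization_map \<phi> (segment x y t) w = segment (realization_map \<phi> x) (realization_map \<phi> y) t w"
    using assms by (simp add: realization_map_alt[of \<sigma>] segment_def sum.distrib sum_distrib_left)
qed

lemma realization_map_vertex: "realization_map \<phi> (vertex_point v) = vertex_point (\<phi> v)"
proof
  fix w
  have eq: "{a \<in> {v}. \<phi> a = w} = (if \<phi> v = w then {v} else {})" by auto
  have "realization_map \<phi> (vertex_point v) w = (\<Sum>a\<in>{a \<in> {v}. \<phi> a = w}. vertex_point v a)"
    by (rule realization_map_alt) simp_all
  then show "realization_map \<phi> (vertex_point v) w = vertex_point (\<phi> v) w"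
    unfolding eq by (simp add: vertex_point_def indicator_def)
qed

lemma realization_map_simplex:
  assumes f: "f \<in> closed_simplex \<sigma>" and \<sigma>: "finite \<sigma>"
  shows "realization_map \<phi> f \<in> closed_simplex (\<phi> ` \<sigma>)"
proof -
  have s: "supp f \<subseteq> \<sigma>" by (rule closed_simplex_supp(1)[OF f \<sigma>])
  have "(\<Sum>w\<in>\<phi> ` \<sigma>. \<Sum>v\<in>{v \<in> \<sigma>. \<phi> v = w}. f v) = (\<Sum>v\<in>\<sigma>. f v)"
    using \<sigma> by (intro sum.group) auto
  moreover have "(\<Sum>v\<in>{v \<in> \<sigma>. \<phi> v = w}. f v) = 0" if "w \<notin> \<phi> ` \<sigma>" for w
    by (rule sum.neutral) (use that in auto)
  ultimately show ?thesis
    using closed_simplexD[OF f] unfolding closed_simplex_def[of "\<phi> ` \<sigma>"]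
    by (auto simp: realization_map_alt[OF \<sigma> s] intro: sum_nonneg)
qed

section \<open>Edge paths\<close>

definition restrict_path :: "(real \<Rightarrow> 'a) \<Rightarrow> real \<Rightarrow> real \<Rightarrow> real \<Rightarrow> 'a" where
  "restrict_path c a b = (\<lambda>t. c (a + (b - a) * t))"

lemma restrict_path_ends [simp]: "restrict_path c a b 0 = c a" "restrict_path c a b 1 = c b"
  by (simp_all add: restrict_path_def)

context lf_complex
begin

text \<open>The statement that paths between vertices are homotopic to edge paths, in the form of an
  induction principle.\<close>

lemma edge_path_induct:
  assumes hom: "\<And>v w p q. R v w p \<Longrightarrow> path_homotopic X p q \<Longrightarrow> R v w q"
    and join: "\<And>u v w p q. R u v p \<Longrightarrow> R v w q \<Longrightarrow> pathin X p \<Longrightarrow> pathin X q \<Longrightarrow>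
      p 0 = vertex_point u \<Longrightarrow> p 1 = vertex_point v \<Longrightarrow> q 0 = vertex_point v \<Longrightarrow> q 1 = vertex_point w \<Longrightarrow>
      R u w (path_join p q)"
    and edge: "\<And>v w. {v, w} \<in> K \<Longrightarrow> R v w (segment (vertex_point v) (vertex_point w))"
    and c: "pathin X c" "c 0 = vertex_point v" "c 1 = vertex_point w"
  shows "R v w c"
proof -
  let ?V = "vertex_point"
  \<comment> \<open>Extending the path by its end values lets subpaths be written without
    restricting their parameters to the interval.\<close>
  define clamp where "clamp t = max 0 (min 1 t)" for t :: real
  define d where "d = (\<lambda>t. c (clamp t))"
  have clamp: "clamp t \<in> {0..1}" "t \<in> {0..1} \<Longrightarrow> clamp t = t" for t by (auto simp: clamp_def)
  have d_cont: "continuous_on UNIV d"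
  proof -
    have "continuous_on UNIV clamp"
      unfolding clamp_def by (intro continuous_on_max continuous_on_min continuous_on_const continuous_on_id)
    moreover have "continuous_on {0..1} c" using c(1) by (simp add: pathin_top_of_set)
    ultimately show ?thesis
      unfolding d_def using clamp(1) by (intro continuous_on_compose2[of "{0..1}" c UNIV clamp]) auto
  qed
  have d_geom: "d t \<in> geom K" for t
    using c(1) clamp(1)[of t] unfolding d_def pathin_top_of_set by blast
  note d_supp = geom_supp(1)[OF d_geom] geom_supp(2)[OF d_geom]
  have d_vert: "?V x \<in> closed_simplex (supp (d t))" if "x \<in> supp (d t)" for x t
    using vertex_point_geom[OF d_supp(1)] that by blast
  have sub: "pathin X (restrict_path d a b)" for a b
  proof -
    have "continuous_on {0..1} (\<lambda>t. d (a + (b - a) * t))"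
      by (rule continuous_on_compose2[OF d_cont]) (auto intro!: continuous_intros)
    then show ?thesis
      unfolding pathin_top_of_set restrict_path_def using d_geom by auto
  qed
  have seg1: "pathin X (segment (?V x) (d t))" and seg2: "pathin X (segment (d t) (?V x))"
    if "x \<in> supp (d t)" for x t
    by (rule pathin_segment[OF d_supp(1)] d_supp d_vert that)+
  \<comment> \<open>The piece over the interval from \<open>a\<close> to \<open>b\<close>, prolonged
    inside the carriers of its ends so that it starts and finishes at vertices \<open>x\<close> and
    \<open>y\<close>. Bisection is applied to these prolonged pieces, for all choices of
    \<open>x\<close> and \<open>y\<close> at once.\<close>
  define full where "full x y a b = path_join (segment (?V x) (d a)) (path_join (restrict_path d a b) (segment (d b) (?V y)))"
    for x y a b
  have full: "pathin X (full x y a b)" if "x \<in> supp (d a)" "y \<in> supp (d b)" for x y a b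
    unfolding full_def using that by (intro pathin_join seg1 seg2 sub) auto
  have full_ends: "full x y a b 0 = ?V x" "full x y a b 1 = ?V y" for x y a b
    by (simp_all add: full_def)
  have supp_ne: "supp (d t) \<noteq> {}" for t
    using closed_simplex_supp(2)[OF d_supp(2) simplex_finite[OF d_supp(1)]] .
  have "\<forall>x y. x \<in> supp (d 0) \<longrightarrow> y \<in> supp (d 1) \<longrightarrow> R x y (full x y 0 1)"
    using zero_le_one
  proof (induction rule: Bolzano)
    case (trans a b e)
    show ?case
    proof (intro allI impI)
      fix x y assume xy: "x \<in> supp (d a)" "y \<in> supp (d e)"
      obtain z where z: "z \<in> supp (d b)" using supp_ne by blast
      let ?p1 = "segment (?V x) (d a)" and ?p2 = "restrict_path d a b" and ?p3 = "segment (d b) (?V z)"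
        and ?p4 = "segment (?V z) (d b)" and ?p5 = "restrict_path d b e" and ?p6 = "segment (d e) (?V y)"
      note P = seg1[OF xy(1)] sub[of a b] seg2[OF z] seg1[OF z] sub[of b e] seg2[OF xy(2)]
      have "R x y (path_join (full x z a b) (full z y b e))"
        using trans xy z by (intro join[of x z _ y]) (auto simp: full full_ends)
      \<comment> \<open>When two adjacent pieces are joined, the detour from \<open>d b\<close> to
        \<open>z\<close> and back cancels.\<close>
      moreover have "path_homotopic X (path_join (full x z a b) (full z y b e)) (full x y a e)"
      proof -
        have "path_homotopic X (path_join ?p3 (path_join ?p4 (path_join ?p5 ?p6)))
           (path_join (path_join ?p3 ?p4) (path_join ?p5 ?p6))"
          using P by (intro path_homotopic_sym[OF path_homotopic_assoc] pathin_join) auto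
        also have "path_homotopic X \<dots> (path_join (\<lambda>_. d b) (path_join ?p5 ?p6))"
          using P path_homotopic_rinv[OF P(3)] by (intro path_homotopic_join path_homotopic_refl pathin_join) auto
        also have "path_homotopic X \<dots> (path_join ?p5 ?p6)"
          using P by (intro path_homotopic_lid pathin_join) auto
        finally have 1: "path_homotopic X (path_join ?p3 (path_join ?p4 (path_join ?p5 ?p6))) (path_join ?p5 ?p6)" .
        have mid: "path_homotopic X (path_join ?p2 ?p5) (restrict_path d a e)"
        proof -
          let ?\<gamma> = "path_join (\<lambda>t. a + (b - a) * t) (\<lambda>t::real. b + (e - b) * t)"
          have "pathin euclidean ?\<gamma>"
            by (intro pathin_join) (auto simp: pathin_def intro!: continuous_intros)
          then have \<gamma>: "continuous_on {0..1} ?\<gamma>" by (simp add: pathin_def)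
          have dX: "continuous_map (top_of_set UNIV) X d"
            using d_cont d_geom by (auto simp: continuous_map_in_subtopology)
          have "path_homotopic X (d \<circ> ?\<gamma>) (d \<circ> (\<lambda>t. a + (e - a) * t))"
            by (rule path_homotopic_convex[OF convex_UNIV dX \<gamma>]) (auto intro!: continuous_intros)
          moreover have "d \<circ> ?\<gamma> = path_join ?p2 ?p5"
            unfolding path_join_comp by (simp add: restrict_path_def comp_def)
          moreover have "d \<circ> (\<lambda>t. a + (e - a) * t) = restrict_path d a e"
            by (simp add: restrict_path_def comp_def)
          ultimately show ?thesis by simp
        qed
        have "path_homotopic X (path_join (full x z a b) (full z y b e))
          (path_join ?p1 (path_join (path_join ?p2 ?p3) (path_join ?p4 (path_join ?p5 ?p6))))"
          unfolding full_def using P by (intro path_homotopic_assoc pathin_join) auto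
        also have "path_homotopic X \<dots>
          (path_join ?p1 (path_join ?p2 (path_join ?p3 (path_join ?p4 (path_join ?p5 ?p6)))))"
          using P by (intro path_homotopic_join path_homotopic_assoc path_homotopic_refl pathin_join) auto
        also have "path_homotopic X \<dots> (path_join ?p1 (path_join ?p2 (path_join ?p5 ?p6)))"
          by (rule path_homotopic_join[OF path_homotopic_refl[OF P(1)]
                path_homotopic_join[OF path_homotopic_refl[OF P(2)] 1]]) simp_all
        also have "path_homotopic X \<dots> (path_join ?p1 (path_join (path_join ?p2 ?p5) ?p6))"
          using P by (intro path_homotopic_join path_homotopic_refl path_homotopic_sym[OF path_homotopic_assoc]) auto
        also have "path_homotopic X \<dots> (full x y a e)"
          unfolding full_def using P mid by (intro path_homotopic_join path_homotopic_refl) auto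
        finally show ?thesis .
      qed
      ultimately show "R x y (full x y a e)" by (rule hom)
    qed
  next
    case (local t)
    \<comment> \<open>The coordinate \<open>z\<close> stays positive near \<open>t\<close>, so a
      short piece remains in the open star of \<open>z\<close> and can be replaced by the two edges
      through \<open>z\<close>.\<close>
    obtain z where z: "z \<in> supp (d t)" using supp_ne by blast
    then have "0 < d t z" using geom_supp(3)[OF d_geom, of t z] by (auto simp: supp_def)
    moreover have "open {s. 0 < d s z}"
      by (intro open_Collect_less continuous_on_const continuous_on_coord d_cont)
    ultimately obtain \<delta> where \<delta>: "\<delta> > 0" "ball t \<delta> \<subseteq> {s. 0 < d s z}"
      using open_contains_ball[of "{s. 0 < d s z}"] by blast
    show ?case
    proof (intro exI[of _ \<delta>] conjI \<delta>(1) allI impI)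
      fix a b x y assume ab: "a \<le> t \<and> t \<le> b \<and> b - a < \<delta>" and xy: "x \<in> supp (d a)" "y \<in> supp (d b)"
      have zs: "z \<in> supp (d s)" if "a \<le> s" "s \<le> b" for s
      proof -
        have "s \<in> ball t \<delta>" using ab that by (auto simp: dist_real_def)
        then have "0 < d s z" using \<delta>(2) by blast
        then show ?thesis by (simp add: supp_def)
      qed
      have zab: "z \<in> supp (d a)" "z \<in> supp (d b)" using zs ab by auto
      have zs': "z \<in> supp (restrict_path d a b s)" if "0 \<le> s" "s \<le> 1" for s
        unfolding restrict_path_def
      proof (rule zs)
        show "a \<le> a + (b - a) * s" using ab that by simp
        have "(b - a) * s \<le> (b - a) * 1" using ab that by (intro mult_left_mono) auto
        then show "a + (b - a) * s \<le> b" by simp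
      qed
      let ?p1 = "segment (?V x) (d a)" and ?p2 = "segment (d a) (?V z)" and ?p3 = "segment (?V z) (d b)"
        and ?p4 = "segment (d b) (?V y)"
      note P = seg1[OF xy(1)] seg2[OF zab(1)] seg1[OF zab(2)] seg2[OF xy(2)]
      have edges: "{x, z} \<in> K" "{z, y} \<in> K"
        using simplex_face[OF d_supp(1)] xy zab by (metis insert_subset empty_subsetI insert_not_empty)+
      have "R x y (path_join (segment (?V x) (?V z)) (segment (?V z) (?V y)))"
        using edges by (intro join[of x z _ y] edge pathin_segment[OF edges(1)] pathin_segment[OF edges(2)])
          (auto intro: vertex_point_geom)
      moreover have "path_homotopic X (path_join (segment (?V x) (?V z)) (segment (?V z) (?V y))) (full x y a b)"
      proof -
        have "path_homotopic X (full x y a b) (path_join ?p1 (path_join (path_join ?p2 ?p3) ?p4))"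
          unfolding full_def using P star_homotopic[OF sub zs']
          by (intro path_homotopic_join path_homotopic_refl) auto
        also have "path_homotopic X \<dots> (path_join ?p1 (path_join ?p2 (path_join ?p3 ?p4)))"
          using P by (intro path_homotopic_join path_homotopic_refl path_homotopic_assoc) auto
        also have "path_homotopic X \<dots> (path_join (path_join ?p1 ?p2) (path_join ?p3 ?p4))"
          using P by (intro path_homotopic_sym[OF path_homotopic_assoc] pathin_join) auto
        also have "path_homotopic X \<dots> (path_join (segment (?V x) (?V z)) (segment (?V z) (?V y)))"
          using xy zab
          by (intro path_homotopic_join triangle_homotopic[OF d_supp(1)] d_vert) (auto simp: d_supp(2))
        finally show ?thesis by (rule path_homotopic_sym)
      qed
      ultimately show "R x y (full x y a b)" by (rule hom)
    qed
  qed
  \<comment> \<open>At the ends of the whole path the carriers are single vertices and the added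
    tails are constant.\<close>
  moreover have d01: "d 0 = ?V v" "d 1 = ?V w"
    using c by (simp_all add: d_def clamp_def)
  ultimately have "R v w (full v w 0 1)" by simp
  moreover have "path_homotopic X (full v w 0 1) c"
  proof -
    have dc: "path_homotopic X (restrict_path d 0 1) c"
      by (rule path_homotopic_eq[OF sub]) (simp add: restrict_path_def d_def clamp(2))
    have "path_homotopic X (full v w 0 1) (path_join (restrict_path d 0 1) (\<lambda>_. ?V w))"
      unfolding full_def d01 segment_const using sub[of 0 1] d01
      by (intro path_homotopic_lid pathin_join) (auto simp flip: d01 intro: d_geom)
    also have "path_homotopic X \<dots> (restrict_path d 0 1)"
      using sub[of 0 1] d01 by (intro path_homotopic_rid) auto
    also note dc
    finally show ?thesis .
  qed
  ultimately show ?thesis by (rule hom)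
qed

end

section \<open>The covering defined by a cocycle on the edges\<close>

text \<open>The value \<open>g u v\<close> is the change of the group coordinate along the edge from
  \<open>u\<close> to \<open>v\<close>. The identity is imposed only within a simplex; imposed on
  all triples of vertices it would make the covering trivial.\<close>

locale cocycle_complex = lf_complex K + G: group G
  for K :: "'v set set" and G :: "('g, 'h) monoid_scheme" (structure) +
  fixes g :: "'v \<Rightarrow> 'v \<Rightarrow> 'g"
  assumes cocycle_closed: "\<sigma> \<in> K \<Longrightarrow> u \<in> \<sigma> \<Longrightarrow> v \<in> \<sigma> \<Longrightarrow> g u v \<in> carrier G"
    and cocycle: "\<sigma> \<in> K \<Longrightarrow> u \<in> \<sigma> \<Longrightarrow> v \<in> \<sigma> \<Longrightarrow> w \<in> \<sigma> \<Longrightarrow> g u w = g u v \<otimes> g v w"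
begin

text \<open>The covering is itself built as a simplicial complex on vertices paired with group
  elements, so its topology and its paths come from the same locale as those of
  \<open>K\<close>.\<close>

definition cover :: "('v \<times> 'g) set set" where
  "cover = {\<sigma>. finite \<sigma> \<and> \<sigma> \<noteq> {} \<and> fst ` \<sigma> \<in> K \<and> snd ` \<sigma> \<subseteq> carrier G \<and>
     (\<forall>(u, a)\<in>\<sigma>. \<forall>(v, b)\<in>\<sigma>. b = a \<otimes> g u v)}"

lemma cocycle_refl: "\<sigma> \<in> K \<Longrightarrow> u \<in> \<sigma> \<Longrightarrow> g u u = \<one>"
  using cocycle[of \<sigma> u u u] cocycle_closed[of \<sigma> u u] by (metis G.l_cancel_one' )

lemma coverD:
  assumes "\<sigma> \<in> cover"
  shows "finite \<sigma>" "fst ` \<sigma> \<in> K" "(u, a) \<in> \<sigma> \<Longrightarrow> a \<in> carrier G"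
    "(u, a) \<in> \<sigma> \<Longrightarrow> (v, b) \<in> \<sigma> \<Longrightarrow> b = a \<otimes> g u v"
  using assms by (auto simp: cover_def)

lemma cover_inj:
  assumes "\<sigma> \<in> cover" "(u, a) \<in> \<sigma>" "(u, b) \<in> \<sigma>"
  shows "a = b"
proof -
  have "g u u = \<one>"
    using cocycle_refl[OF coverD(2)[OF assms(1)]] assms(2) by force
  then show ?thesis
    using coverD(4)[OF assms] coverD(3)[OF assms(1,2)] by simp
qed

text \<open>For a simplex \<sigma> containing \<open>v\<close>, this is its lift through (v, a); by
  \<open>cover_sheet\<close> it is the only one.\<close>

definition sheet :: "'v \<Rightarrow> 'g \<Rightarrow> 'v set \<Rightarrow> ('v \<times> 'g) set" where
  "sheet v a \<sigma> = (\<lambda>u. (u, a \<otimes> g v u)) ` \<sigma>"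

lemma sheet_cover:
  assumes \<sigma>: "\<sigma> \<in> K" "v \<in> \<sigma>" and a: "a \<in> carrier G"
  shows "sheet v a \<sigma> \<in> cover"
proof -
  have eq: "a \<otimes> g v w = a \<otimes> g v u \<otimes> g u w" if "u \<in> \<sigma>" "w \<in> \<sigma>" for u w
    using cocycle[OF \<sigma>(1,2) that] cocycle_closed[OF \<sigma>(1)] \<sigma>(2) a that by (simp add: G.m_assoc)
  have "\<forall>(u, b)\<in>sheet v a \<sigma>. \<forall>(w, c)\<in>sheet v a \<sigma>. c = b \<otimes> g u w"
    by (clarsimp simp: sheet_def) (rule eq)
  moreover have "fst ` sheet v a \<sigma> = \<sigma>" by (simp add: sheet_def image_image)
  moreover have "snd ` sheet v a \<sigma> \<subseteq> carrier G"
    using a cocycle_closed[OF \<sigma>] by (auto simp: sheet_def)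
  moreover have "finite (sheet v a \<sigma>)" "sheet v a \<sigma> \<noteq> {}"
    using simplex_finite[OF \<sigma>(1)] \<sigma>(2) by (auto simp: sheet_def)
  ultimately show ?thesis
    using \<sigma>(1) by (simp add: cover_def)
qed

lemma cover_sheet:
  assumes "\<sigma> \<in> cover" "(v, a) \<in> \<sigma>"
  shows "\<sigma> = sheet v a (fst ` \<sigma>)"
proof (intro subset_antisym subsetI)
  fix x assume "x \<in> \<sigma>"
  moreover obtain u b where "x = (u, b)" by (cases x)
  ultimately show "x \<in> sheet v a (fst ` \<sigma>)"
    using coverD(4)[OF assms, of u b] by (force simp: sheet_def)
next
  fix x assume "x \<in> sheet v a (fst ` \<sigma>)"
  then obtain u b where "(u, b) \<in> \<sigma>" "x = (u, a \<otimes> g v u)" by (auto simp: sheet_def)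
  then show "x \<in> \<sigma>" using coverD(4)[OF assms, of u b] by simp
qed

sublocale cover: lf_complex cover
proof
  fix \<sigma> \<tau> :: "('v \<times> 'g) set"
  assume \<sigma>: "\<sigma> \<in> cover"
  then show "finite \<sigma>" by (rule coverD)
  assume \<tau>: "\<tau> \<subseteq> \<sigma>" "\<tau> \<noteq> {}"
  have "fst ` \<tau> \<in> K"
    by (rule simplex_face[OF coverD(2)[OF \<sigma>]]) (use \<tau> in auto)
  moreover have "finite \<tau>" using coverD(1)[OF \<sigma>] \<tau>(1) by (rule rev_finite_subset)
  ultimately show "\<tau> \<in> cover"
    using \<sigma> \<tau> unfolding cover_def by blast
next
  fix x :: "'v \<times> 'g"
  obtain v a where x: "x = (v, a)" by (cases x)
  have "{\<sigma> \<in> cover. x \<in> \<sigma>} \<subseteq> sheet v a ` {\<sigma> \<in> K. v \<in> \<sigma>}"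
  proof
    fix \<sigma> assume "\<sigma> \<in> {\<sigma> \<in> cover. x \<in> \<sigma>}"
    then have "\<sigma> \<in> cover" "(v, a) \<in> \<sigma>" by (auto simp: x)
    then show "\<sigma> \<in> sheet v a ` {\<sigma> \<in> K. v \<in> \<sigma>}"
      using cover_sheet coverD(2) by (intro image_eqI[of _ _ "fst ` \<sigma>"]) force+
  qed
  then show "finite {\<sigma> \<in> cover. x \<in> \<sigma>}"
    using star_finite by (rule finite_surj[rotated])
qed

definition proj :: "('v \<times> 'g \<Rightarrow> real) \<Rightarrow> 'v \<Rightarrow> real" where
  "proj = realization_map fst"

text \<open>A simplex of the covering meets each fibre of vertices at most once, so the sum over the
  fibre has a single term. On the open star of (v, a) the projection therefore only renames
  coordinates, which makes it continuous there.\<close>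

lemma proj_eq:
  assumes f: "f \<in> geom cover" and v: "f (v, a) \<noteq> 0"
  shows "proj f u = f (u, a \<otimes> g v u)"
proof -
  let ?s = "supp f"
  have s: "?s \<in> cover" "(v, a) \<in> ?s" using cover.geom_supp(1)[OF f] v by (auto simp: supp_def)
  have "{x \<in> ?s. fst x = u} = {x \<in> {(u, a \<otimes> g v u)}. f x \<noteq> 0}"
  proof (intro subset_antisym subsetI)
    fix x assume "x \<in> {x \<in> ?s. fst x = u}"
    then show "x \<in> {x \<in> {(u, a \<otimes> g v u)}. f x \<noteq> 0}"
      using coverD(4)[OF s, of u "snd x"] by (cases x) (auto simp: supp_def)
  qed (auto simp: supp_def)
  then have "proj f u = (\<Sum>x\<in>{x \<in> {(u, a \<otimes> g v u)}. f x \<noteq> 0}. f x)"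
    unfolding proj_def by (subst realization_map_alt[of ?s]) (use coverD(1)[OF s(1)] in auto)
  also have "\<dots> = f (u, a \<otimes> g v u)"
    by (subst sum.mono_neutral_left[of "{(u, a \<otimes> g v u)}"]) auto
  finally show ?thesis .
qed

lemma proj_geom: "f \<in> geom cover \<Longrightarrow> proj f \<in> geom K"
  unfolding proj_def using cover.geom_supp[of f] coverD[of "supp f"] realization_map_simplex[of f "supp f" fst]
  by (auto intro!: geomI)

text \<open>The inverse of \<open>proj\<close> from the open star of \<open>v\<close> to the open
  star of (v, a).\<close>

definition section_map :: "'v \<Rightarrow> 'g \<Rightarrow> ('v \<Rightarrow> real) \<Rightarrow> 'v \<times> 'g \<Rightarrow> real" where
  "section_map v a x = (\<lambda>(u, b). if b = a \<otimes>\<^bsub>G\<^esub> g v u then x u else 0)"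

lemma section_map:
  assumes x: "x \<in> geom K" and v: "x v \<noteq> 0" and a: "a \<in> carrier G"
  shows "section_map v a x \<in> geom cover" "section_map v a x (v, a) = x v" "proj (section_map v a x) = x"
proof -
  let ?f = "section_map v a x" and ?s = "supp x"
  have s: "?s \<in> K" "v \<in> ?s" using geom_supp(1)[OF x] v by (auto simp: supp_def)
  have one: "g v v = \<one>\<^bsub>G\<^esub>" by (rule cocycle_refl[OF s])
  show fv: "?f (v, a) = x v" using one a by (simp add: section_map_def)
  have "(\<Sum>y\<in>sheet v a ?s. ?f y) = (\<Sum>u\<in>?s. x u)"
    unfolding sheet_def by (subst sum.reindex) (auto simp: inj_on_def section_map_def)
  also have "\<dots> = 1" using closed_simplexD(3)[OF geom_supp(2)[OF x]] .
  finally have "?f \<in> closed_simplex (sheet v a ?s)"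
    using geom_supp(3)[OF x] unfolding closed_simplex_def
    by (auto simp: section_map_def sheet_def supp_def)
  then show geom: "?f \<in> geom cover"
    using sheet_cover[OF s a] by (rule cover.geomI[rotated])
  show "proj ?f = x"
  proof
    fix u
    show "proj ?f u = x u" using proj_eq[OF geom, of v a u] fv v by (simp add: section_map_def)
  qed
qed

lemma section_proj:
  assumes f: "f \<in> geom cover" and v: "f (v, a) \<noteq> 0"
  shows "section_map v a (proj f) = f"
proof
  fix x :: "'v \<times> 'g"
  obtain u b where x: "x = (u, b)" by (cases x)
  have s: "supp f \<in> cover" "(v, a) \<in> supp f" using cover.geom_supp(1)[OF f] v by (auto simp: supp_def)
  show "section_map v a (proj f) x = f x"
    using proj_eq[OF f v, of u] coverD(4)[OF s, of u b] by (auto simp: section_map_def x supp_def)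
qed

text \<open>The sheets over the open star of \<open>v\<close> are the open stars of the vertices (v,
  a). They are disjoint because no simplex contains two vertices above \<open>v\<close>, and
  \<open>section_map\<close> inverts the projection on each.\<close>

lemma cover_covering_map: "covering_map cover.X X proj"
proof -
  define U where "U v a = {f \<in> geom cover. 0 < f (v, a)}" for v a
  define V where "V v = {x \<in> geom K. 0 < x v}" for v
  have open_pos: "openin (top_of_set Z) {f \<in> Z. 0 < f i}" for Z :: "('i \<Rightarrow> real) set" and i
  proof -
    have "open {f::'i \<Rightarrow> real. 0 < f i}"
      by (intro open_Collect_less continuous_on_const continuous_on_product_coordinates)
    moreover have "{f \<in> Z. 0 < f i} = Z \<inter> {f. 0 < f i}" by auto
    ultimately show ?thesis by (metis openin_open_Int)
  qed
  have U_open: "openin cover.X (U v a)" and V_open: "openin X (V v)" for v a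
    unfolding U_def V_def by (rule open_pos)+
  have U_cont: "continuous_on (U v a) proj" for v a
  proof (rule continuous_on_coordinatewise_then_product)
    fix u
    have "continuous_on (U v a) (\<lambda>f. f (u, a \<otimes>\<^bsub>G\<^esub> g v u))"
      by (rule continuous_on_subset[OF continuous_on_product_coordinates]) simp
    then show "continuous_on (U v a) (\<lambda>f. proj f u)"
      by (rule continuous_on_eq) (use proj_eq[of _ v a u] in \<open>auto simp: U_def\<close>)
  qed
  have some: "\<exists>v a. f \<in> U v a" if f: "f \<in> geom cover" for f
  proof -
    have "supp f \<noteq> {}"
      using closed_simplex_supp(2)[OF cover.geom_supp(2)[OF f] cover.simplex_finite[OF cover.geom_supp(1)[OF f]]] .
    then obtain v a where "f (v, a) \<noteq> 0" by (auto simp: supp_def)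
    then have "0 < f (v, a)" using cover.geom_supp(3)[OF f, of "(v, a)"] by simp
    then show ?thesis using f by (auto simp: U_def)
  qed
  have UX: "U v a \<subseteq> geom cover" and VX: "V v \<subseteq> geom K" for v a
    by (auto simp: U_def V_def)
  have cont: "continuous_map cover.X X proj"
  proof (rule pasting_lemma[where I = UNIV and T = "\<lambda>(v, a). U v a" and f = "\<lambda>_. proj"])
    fix i :: "'v \<times> 'g"
    show "openin cover.X (case i of (v, a) \<Rightarrow> U v a)" by (cases i) (simp add: U_open)
    show "continuous_map (subtopology cover.X (case i of (v, a) \<Rightarrow> U v a)) X proj"
      using U_cont UX proj_geom[OF subsetD[OF UX]]
      by (cases i) (auto simp: subtopology_subtopology Int_absorb1 continuous_map_in_subtopology)
  qed (use some in auto)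
  have surj: "proj ` geom cover = geom K"
  proof
    show "geom K \<subseteq> proj ` geom cover"
    proof
      fix x assume x: "x \<in> geom K"
      obtain v where "x v \<noteq> 0"
        using closed_simplex_supp(2)[OF geom_supp(2)[OF x] simplex_finite[OF geom_supp(1)[OF x]]]
        by (auto simp: supp_def)
      from section_map[OF x this G.one_closed] show "x \<in> proj ` geom cover" by (metis imageI)
    qed
  qed (use proj_geom in auto)
  have homeo: "homeomorphic_map (subtopology cover.X (U v a)) (subtopology X (V v)) proj"
    if a: "a \<in> carrier G" for v a
  proof -
    \<comment> \<open>The point \<open>f\<close> only serves to provide a simplex containing
      \<open>v\<close>; the cocycle identity says nothing about an element outside all
      simplices.\<close>
    have one: "a \<otimes>\<^bsub>G\<^esub> g v v = a" if "f \<in> U v a" for f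
    proof -
      have "(v, a) \<in> supp f" "supp f \<in> cover" using that cover.geom_supp(1) by (auto simp: U_def supp_def)
      then show ?thesis using coverD(4)[of "supp f" v a v a] by simp
    qed
    have 1: "proj f \<in> V v" "section_map v a (proj f) = f" if f: "f \<in> U v a" for f
      using f proj_geom[of f] proj_eq[of f v a v] one[OF f] section_proj[of f v a]
      by (auto simp: U_def V_def)
    have 2: "section_map v a x \<in> U v a" "proj (section_map v a x) = x" if x: "x \<in> V v" for x
      using x section_map[of x v a] a by (auto simp: U_def V_def)
    have "continuous_on (V v) (section_map v a)"
    proof (rule continuous_on_coordinatewise_then_product)
      fix y :: "'v \<times> 'g"
      obtain u b where y: "y = (u, b)" by (cases y)
      have "continuous_on (V v) (\<lambda>x. x u)"
        by (rule continuous_on_subset[OF continuous_on_product_coordinates]) simp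
      then show "continuous_on (V v) (\<lambda>x. section_map v a x y)"
        by (cases "b = a \<otimes>\<^bsub>G\<^esub> g v u") (simp_all add: section_map_def y)
    qed
    then have "homeomorphic_maps (top_of_set (U v a)) (top_of_set (V v)) proj (section_map v a)"
      using 1 2 U_cont[of v a] by (auto simp: homeomorphic_maps_def continuous_map_in_subtopology)
    then have "homeomorphic_map (top_of_set (U v a)) (top_of_set (V v)) proj"
      using homeomorphic_map_maps by blast
    then show ?thesis
      using UX[of v a] VX[of v] by (simp add: subtopology_subtopology Int_absorb1)
  qed
  have "\<exists>V. openin X V \<and> y \<in> V \<and> (\<exists>\<U>. \<Union>\<U> = {x \<in> topspace cover.X. proj x \<in> V} \<and> pairwise disjnt \<U> \<and>
      (\<forall>U\<in>\<U>. openin cover.X U \<and> homeomorphic_map (subtopology cover.X U) (subtopology X V) proj))"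
    if y: "y \<in> topspace X" for y
  proof -
    have yg: "y \<in> geom K" using y by simp
    obtain v where v: "y v \<noteq> 0"
      using closed_simplex_supp(2)[OF geom_supp(2)[OF yg] simplex_finite[OF geom_supp(1)[OF yg]]]
      by (auto simp: supp_def)
    then have "y \<in> V v" using yg geom_supp(3)[OF yg, of v] by (simp add: V_def)
    moreover have "\<Union>(U v ` carrier G) = {x \<in> topspace cover.X. proj x \<in> V v}"
    proof (intro subset_antisym subsetI)
      fix f assume "f \<in> \<Union>(U v ` carrier G)"
      then obtain a where f: "f \<in> geom cover" "0 < f (v, a)" "a \<in> carrier G" by (auto simp: U_def)
      have "(v, a) \<in> supp f" "supp f \<in> cover" using f cover.geom_supp(1) by (auto simp: supp_def)
      then have "a \<otimes>\<^bsub>G\<^esub> g v v = a" using coverD(4)[of "supp f" v a v a] by simp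
      then show "f \<in> {x \<in> topspace cover.X. proj x \<in> V v}"
        using f proj_geom[of f] proj_eq[of f v a v] by (auto simp: V_def)
    next
      fix f assume "f \<in> {x \<in> topspace cover.X. proj x \<in> V v}"
      then have f: "f \<in> geom cover" "0 < proj f v" by (auto simp: V_def)
      have s: "supp f \<in> cover" by (rule cover.geom_supp(1)[OF f(1)])
      have "proj f v = (\<Sum>x\<in>{x \<in> supp f. fst x = v}. f x)"
        unfolding proj_def by (rule realization_map_alt[OF coverD(1)[OF s]]) simp
      then have "{x \<in> supp f. fst x = v} \<noteq> {}" using f(2) by force
      then obtain a where a: "(v, a) \<in> supp f" by auto
      then have "a \<in> carrier G" by (rule coverD(3)[OF s])
      moreover have "0 < f (v, a)" using a cover.geom_supp(3)[OF f(1), of "(v, a)"] by (simp add: supp_def)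
      ultimately show "f \<in> \<Union>(U v ` carrier G)" using f(1) by (auto simp: U_def)
    qed
    moreover have "U v a \<inter> U v b = {}" if "a \<noteq> b" for a b
    proof (rule ccontr)
      assume "U v a \<inter> U v b \<noteq> {}"
      then obtain f where f: "f \<in> geom cover" "0 < f (v, a)" "0 < f (v, b)" by (auto simp: U_def)
      then have "(v, a) \<in> supp f" "(v, b) \<in> supp f" by (simp_all add: supp_def)
      with f(1) show False using cover_inj[OF cover.geom_supp(1)] that by blast
    qed
    then have "pairwise disjnt (U v ` carrier G)"
      unfolding pairwise_def disjnt_def by (metis (no_types, lifting) imageE)
    ultimately show ?thesis
      using V_open[of v] U_open homeo by (intro exI[of _ "V v"] conjI exI[of _ "U v ` carrier G"]) auto
  qed
  then show ?thesis
    unfolding covering_map_def using cont surj by simp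
qed

lemma proj_edge:
  assumes "{x, y} \<in> cover"
  shows "proj \<circ> segment (vertex_point x) (vertex_point y) = segment (vertex_point (fst x)) (vertex_point (fst y))"
proof
  fix t
  show "(proj \<circ> segment (vertex_point x) (vertex_point y)) t = segment (vertex_point (fst x)) (vertex_point (fst y)) t"
    unfolding comp_def proj_def
    by (subst realization_map_segment[of "{x, y}"]) (auto simp: realization_map_vertex)
qed

end

section \<open>Coxeter groups: the exchange condition\<close>

definition pos_word :: "'s list \<Rightarrow> 's gword" where
  "pos_word ss = map (\<lambda>s. (s, True)) ss"

lemma pos_word_simps [simp]:
  "pos_word [] = []" "pos_word (s # ss) = (s, True) # pos_word ss"
  "pos_word (ss @ tt) = pos_word ss @ pos_word tt"
  by (simp_all add: pos_word_def)

lemma pos_word_lists [simp]: "pos_word ss \<in> lists (S \<times> UNIV) \<longleftrightarrow> set ss \<subseteq> S"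
  by (induction ss) auto

lemma pos_word_alternating: "pos_word (alternating n s t) = alternating n (s, True) (t, True)"
  by (induction n arbitrary: s t) auto

lemma alternating_set: "set (alternating n s t) \<subseteq> {s, t}"
  by (induction n arbitrary: s t) auto

lemma length_alternating [simp]: "length (alternating n s t) = n"
  by (induction n arbitrary: s t) auto

lemma alternating_add:
  "alternating (n + j) s t = alternating n s t @ (if even n then alternating j s t else alternating j t s)"
  by (induction n arbitrary: s t) auto

lemma alternating_Suc_right: "alternating (Suc n) s t = alternating n s t @ [if even n then s else t]"
  by (induction n arbitrary: s t) auto

lemma rev_alternating: "rev (alternating n s t) = (if even n then alternating n t s else alternating n s t)"
proof (induction n arbitrary: s t)
  case (Suc n)
  have "rev (alternating (Suc n) s t) = rev (alternating n t s) @ [s]" by simp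
  then show ?case
    using Suc alternating_Suc_right[of n s t] alternating_Suc_right[of n t s]
    by (simp del: alternating.simps)
qed simp

lemma sum_lessThan_add:
  fixes f :: "nat \<Rightarrow> nat"
  shows "(\<Sum>i<n + k. f i) = (\<Sum>i<n. f i) + (\<Sum>i<k. f (n + i))"
  by (induction k) auto

locale coxeter_system =
  fixes S :: "'s set" and m :: "'s \<Rightarrow> 's \<Rightarrow> enat"
  assumes coxeter_matrix: "coxeter_matrix S m"
begin

abbreviation "W \<equiv> coxeter_group S m"
abbreviation "gen \<equiv> coxeter_gen S m"
abbreviation "len \<equiv> coxeter_length S m"
abbreviation "W_rel \<equiv> coxeter_relations S m"
abbreviation "A_rel \<equiv> artin_relations S m"

sublocale W: group W
  by (rule group_coxeter_group)

abbreviation W_mult (infixl "\<cdot>" 70) where "v \<cdot> w \<equiv> v \<otimes>\<^bsub>W\<^esub> w"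
abbreviation "winv \<equiv> m_inv W"

text \<open>Spelled exactly as the product in \<open>coxeter_length\<close>, so that unfolding both
  makes length a statement about \<open>wd\<close>.\<close>

definition wd :: "'s list \<Rightarrow> 's gword set" where
  "wd ss = foldr (\<lambda>s g. gen s \<cdot> g) ss \<one>\<^bsub>W\<^esub>"

lemma wd_simps [simp]: "wd [] = \<one>\<^bsub>W\<^esub>" "wd (s # ss) = gen s \<cdot> wd ss"
  by (simp_all add: wd_def)

lemma W_carrier: "carrier W = pres_class S W_rel ` lists (S \<times> UNIV)"
  by (simp add: coxeter_group_def presented_group_def)

lemma W_one: "\<one>\<^bsub>W\<^esub> = pres_class S W_rel []"
  by (simp add: coxeter_group_def presented_group_def)

lemma gen_closed [simp]: "s \<in> S \<Longrightarrow> gen s \<in> carrier W"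
  by (auto simp: coxeter_gen_def pres_gen_def coxeter_group_def presented_group_def)

lemma W_class_mult: "u \<in> lists (S \<times> UNIV) \<Longrightarrow> v \<in> lists (S \<times> UNIV) \<Longrightarrow>
    pres_class S W_rel u \<cdot> pres_class S W_rel v = pres_class S W_rel (u @ v)"
  unfolding coxeter_group_def by (rule presented_group_mult)

lemma wd_class: "set ss \<subseteq> S \<Longrightarrow> wd ss = pres_class S W_rel (pos_word ss)"
proof (induction ss)
  case (Cons s ss)
  then show ?case
    using W_class_mult[of "[(s, True)]" "pos_word ss"]
    by (simp add: coxeter_gen_def pres_gen_def)
qed (simp add: W_one)

lemma gen_sq [simp]: "s \<in> S \<Longrightarrow> gen s \<cdot> gen s = \<one>\<^bsub>W\<^esub>"
proof -
  assume s: "s \<in> S"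
  then have "pres_eq S W_rel [(s, True), (s, True)] []"
    by (intro pres_eq.rel) (auto simp: coxeter_relations_def)
  then show ?thesis
    using s wd_class[of "[s, s]"] wd_class[of "[]"] pres_class_eq_iff[of "[(s, True), (s, True)]" S W_rel "[]"]
    by simp
qed

lemma gen_sq_left [simp]: "s \<in> S \<Longrightarrow> w \<in> carrier W \<Longrightarrow> gen s \<cdot> (gen s \<cdot> w) = w"
  by (metis W.l_one W.m_assoc gen_closed gen_sq)

lemma W_inv_cancel [simp]:
  assumes "x \<in> carrier W" "y \<in> carrier W"
  shows "winv x \<cdot> (x \<cdot> y) = y" "x \<cdot> (winv x \<cdot> y) = y"
  using assms by (simp_all flip: W.m_assoc)

lemma inv_gen [simp]: "s \<in> S \<Longrightarrow> winv (gen s) = gen s"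
  by (simp add: W.inv_equality)

lemma wd_closed [simp]: "set ss \<subseteq> S \<Longrightarrow> wd ss \<in> carrier W"
  by (induction ss) auto

lemma wd_append [simp]: "set ss \<subseteq> S \<Longrightarrow> set tt \<subseteq> S \<Longrightarrow> wd (ss @ tt) = wd ss \<cdot> wd tt"
  by (induction ss) (auto simp: W.m_assoc)

lemma wd_rev: "set ss \<subseteq> S \<Longrightarrow> wd (rev ss) = winv (wd ss)"
  by (induction ss) (auto simp: W.inv_mult_group)

lemma eval_word_wd: "set ss \<subseteq> S \<Longrightarrow> eval_word W gen (pos_word ss) = wd ss"
  by (induction ss) (auto simp: eval_word_def)

lemma wd_surj:
  assumes "w \<in> carrier W"
  shows "\<exists>ss. set ss \<subseteq> S \<and> wd ss = w"
proof -
  have "\<exists>ss. set ss \<subseteq> S \<and> wd ss = pres_class S W_rel u" if "u \<in> lists (S \<times> UNIV)" for u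
    using that
  proof (induction u)
    case Nil
    then show ?case by (intro exI[of _ "[]"]) (simp add: W_one)
  next
    case (Cons x u)
    obtain s b where x: "x = (s, b)" by (cases x)
    have s: "s \<in> S" and u: "u \<in> lists (S \<times> UNIV)"
      using Cons x by auto
    obtain ss where ss: "set ss \<subseteq> S" "wd ss = pres_class S W_rel u"
      using Cons.IH by blast
    have "pres_class S W_rel [(s, b)] = gen s"
    proof (cases b)
      case False
      have "pres_class S W_rel [(s, False)] \<cdot> gen s = \<one>\<^bsub>W\<^esub>"
        using s pres_eq.cancel[OF s, of W_rel False]
          W_class_mult[of "[(s, False)]" "[(s, True)]"] pres_class_eq_iff[of "[(s, False), (s, True)]" S W_rel "[]"]
        by (simp add: coxeter_gen_def pres_gen_def W_one)
      moreover have "pres_class S W_rel [(s, False)] \<in> carrier W"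
        unfolding W_carrier by (rule imageI) (use s in simp)
      ultimately have "pres_class S W_rel [(s, False)] = winv (gen s)"
        using s by (metis W.inv_equality gen_closed W.inv_inv)
      with False s show ?thesis by simp
    qed (simp add: coxeter_gen_def pres_gen_def)
    then show ?case
      using s u ss x W_class_mult[of "[(s, b)]" u] by (intro exI[of _ "s # ss"]) simp
  qed
  then show ?thesis
    using assms unfolding W_carrier by blast
qed

lemma wd_eq_iff:
  assumes "set ss \<subseteq> S" "set tt \<subseteq> S"
  shows "wd ss = wd tt \<longleftrightarrow> pres_eq S W_rel (pos_word ss) (pos_word tt)"
  using assms by (simp add: wd_class pres_class_eq_iff)

text \<open>Bourbaki's action of \<^term>\<open>W\<close> on signed group elements, whose sign component counts
  modulo 2 how often a reflection is crossed.\<close>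

definition refl_step :: "'s \<Rightarrow> 's gword set \<times> bool \<Rightarrow> 's gword set \<times> bool" where
  "refl_step s x = (gen s \<cdot> fst x \<cdot> gen s, snd x \<noteq> (fst x = gen s))"

definition refl_act :: "'s gword \<Rightarrow> 's gword set \<times> bool \<Rightarrow> 's gword set \<times> bool" where
  "refl_act u = foldr (\<lambda>(s, b). refl_step s) u"

lemma refl_act_simps [simp]:
  "refl_act [] x = x" "refl_act ((s, b) # u) x = refl_step s (refl_act u x)"
  "refl_act (u @ v) x = refl_act u (refl_act v x)"
  by (simp_all add: refl_act_def)

lemma refl_step_closed: "s \<in> S \<Longrightarrow> x \<in> carrier W \<times> UNIV \<Longrightarrow> refl_step s x \<in> carrier W \<times> UNIV"
  by (auto simp: refl_step_def)

lemma refl_act_closed: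
  "u \<in> lists (S \<times> UNIV) \<Longrightarrow> x \<in> carrier W \<times> UNIV \<Longrightarrow> refl_act u x \<in> carrier W \<times> UNIV"
  by (induction u) (auto simp: refl_step_closed)

lemma refl_step_invol:
  assumes "s \<in> S" "x \<in> carrier W \<times> UNIV"
  shows "refl_step s (refl_step s x) = x"
proof -
  obtain r e where x: "x = (r, e)" "r \<in> carrier W"
    using assms by (cases x) auto
  have conj: "gen s \<cdot> (gen s \<cdot> r \<cdot> gen s) \<cdot> gen s = r"
    using assms x by (simp add: W.m_assoc)
  moreover have "gen s \<cdot> r \<cdot> gen s = gen s \<longleftrightarrow> r = gen s"
    using conj assms by (metis W.l_one gen_closed gen_sq)
  ultimately show ?thesis
    by (auto simp: refl_step_def x)
qed

text \<open>The elements \<open>gen t \<cdot> d^i\<close> are t, tst, tstst, ...: the reflections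
  crossed in turn by the letters of the word read from its right end. The sign changes once for each
  occurrence of \<open>r\<close> in this list.\<close>

lemma refl_act_braid:
  assumes s: "s \<in> S" and t: "t \<in> S" and r: "r \<in> carrier W"
  defines "d \<equiv> gen s \<cdot> gen t"
  shows "refl_act (concat (replicate j [(s, True), (t, True)])) (r, e) =
    (d [^]\<^bsub>W\<^esub> j \<cdot> r \<cdot> winv (d [^]\<^bsub>W\<^esub> j),
     e \<noteq> odd (\<Sum>i<2 * j. of_bool (r = gen t \<cdot> d [^]\<^bsub>W\<^esub> i) :: nat))"
proof (induction j)
  case 0
  then show ?case using r by simp
next
  case (Suc j)
  have d: "d \<in> carrier W" using s t by (simp add: d_def)
  let ?D = "d [^]\<^bsub>W\<^esub> j" and ?t = "gen t" and ?s = "gen s"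
  have D: "?D \<in> carrier W" using d by simp
  have inv_d: "winv d = ?t \<cdot> ?s"
    using s t by (simp add: d_def W.inv_mult_group)
  \<comment> \<open>Conjugation by \<open>t\<close> inverts \<open>d\<close>, which brings all the
    conjugated conditions on \<open>r\<close> into the form
    \<open>gen t \<cdot> d^i\<close>.\<close>
  have flip: "winv (d [^]\<^bsub>W\<^esub> i) \<cdot> ?t = ?t \<cdot> d [^]\<^bsub>W\<^esub> i" for i :: nat
  proof (induction i)
    case 0
    then show ?case using t by simp
  next
    case (Suc i)
    have "winv (d [^]\<^bsub>W\<^esub> Suc i) \<cdot> ?t = winv d \<cdot> (winv (d [^]\<^bsub>W\<^esub> i) \<cdot> ?t)"
      using d t by (simp add: W.inv_mult_group W.m_assoc)
    also have "\<dots> = ?t \<cdot> (?s \<cdot> ?t) \<cdot> d [^]\<^bsub>W\<^esub> i"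
      using d s t by (simp add: Suc.IH inv_d W.m_assoc)
    also have "\<dots> = ?t \<cdot> d [^]\<^bsub>W\<^esub> Suc i"
      unfolding W.nat_pow_Suc2[OF d] using d t by (simp add: W.m_assoc flip: d_def)
    finally show ?case .
  qed
  have conj_eq: "?D \<cdot> r \<cdot> winv ?D = x \<longleftrightarrow> r = winv ?D \<cdot> x \<cdot> ?D"
    if "x \<in> carrier W" for x
  proof
    assume "?D \<cdot> r \<cdot> winv ?D = x"
    then have "x = ?D \<cdot> r \<cdot> winv ?D" ..
    then show "r = winv ?D \<cdot> x \<cdot> ?D" using D r by (simp add: W.m_assoc)
  next
    assume "r = winv ?D \<cdot> x \<cdot> ?D"
    then show "?D \<cdot> r \<cdot> winv ?D = x" using D that by (simp add: W.m_assoc)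
  qed
  have 1: "?D \<cdot> r \<cdot> winv ?D = ?t \<longleftrightarrow> r = ?t \<cdot> d [^]\<^bsub>W\<^esub> (2 * j)"
    using t d D flip[of j] by (simp add: conj_eq W.m_assoc W.nat_pow_mult mult_2)
  have "winv ?D \<cdot> (?t \<cdot> d) \<cdot> ?D = (winv ?D \<cdot> ?t) \<cdot> (d \<cdot> ?D)"
    using t d by (simp add: W.m_assoc)
  also have "\<dots> = ?t \<cdot> (?D \<cdot> (d \<cdot> ?D))"
    using t d by (simp add: flip W.m_assoc)
  also have "?D \<cdot> (d \<cdot> ?D) = d [^]\<^bsub>W\<^esub> (Suc (2 * j))"
    using W.nat_pow_Suc2[OF d, of j] d by (simp add: mult_2 W.m_assoc flip: W.nat_pow_mult)
  finally have 2: "?D \<cdot> r \<cdot> winv ?D = ?t \<cdot> d \<longleftrightarrow> r = ?t \<cdot> d [^]\<^bsub>W\<^esub> (Suc (2 * j))"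
    using t d by (simp only: conj_eq W.m_closed gen_closed)
  have 3: "?t \<cdot> y \<cdot> ?t = ?s \<longleftrightarrow> y = ?t \<cdot> d" if y: "y \<in> carrier W" for y
  proof
    assume "?t \<cdot> y \<cdot> ?t = ?s"
    then have "?t \<cdot> (?t \<cdot> y \<cdot> ?t) \<cdot> ?t = ?t \<cdot> ?s \<cdot> ?t" by simp
    then show "y = ?t \<cdot> d" using y s t by (simp add: d_def W.m_assoc)
  next
    assume "y = ?t \<cdot> d"
    then show "?t \<cdot> y \<cdot> ?t = ?s" using s t by (simp add: d_def W.m_assoc)
  qed
  define y where "y = ?D \<cdot> r \<cdot> winv ?D"
  have y: "y \<in> carrier W" using D r by (simp add: y_def)
  have "?s \<cdot> (?t \<cdot> y \<cdot> ?t) \<cdot> ?s = d \<cdot> y \<cdot> winv d"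
    using s t y by (simp add: inv_d W.m_assoc) (simp add: d_def W.m_assoc)
  also have "\<dots> = d [^]\<^bsub>W\<^esub> Suc j \<cdot> r \<cdot> winv (d [^]\<^bsub>W\<^esub> Suc j)"
    unfolding W.nat_pow_Suc2[OF d] y_def using d D r by (simp add: W.inv_mult_group W.m_assoc)
  finally have 4: "?s \<cdot> (?t \<cdot> y \<cdot> ?t) \<cdot> ?s
      = d [^]\<^bsub>W\<^esub> Suc j \<cdot> r \<cdot> winv (d [^]\<^bsub>W\<^esub> Suc j)" .
  define E where "E = (\<Sum>i<2 * j. of_bool (r = ?t \<cdot> d [^]\<^bsub>W\<^esub> i) :: nat)"
  have sum: "(\<Sum>i<2 * Suc j. of_bool (r = ?t \<cdot> d [^]\<^bsub>W\<^esub> i) :: nat)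
      = E + of_bool (y = ?t) + of_bool (y = ?t \<cdot> d)"
    unfolding y_def 1 2 E_def by (simp del: W.nat_pow_Suc)
  have "refl_act (concat (replicate (Suc j) [(s, True), (t, True)])) (r, e)
     = refl_step s (refl_step t (y, e \<noteq> odd E))"
    using Suc.IH by (simp add: y_def E_def)
  also have "\<dots> = (?s \<cdot> (?t \<cdot> y \<cdot> ?t) \<cdot> ?s,
      ((e \<noteq> odd E) \<noteq> (y = ?t)) \<noteq> (y = ?t \<cdot> d))"
    using 3[OF y] by (simp add: refl_step_def)
  also have "\<dots> = (d [^]\<^bsub>W\<^esub> Suc j \<cdot> r \<cdot> winv (d [^]\<^bsub>W\<^esub> Suc j),
      e \<noteq> odd (E + of_bool (y = ?t) + of_bool (y = ?t \<cdot> d)))"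
    unfolding 4 by auto
  finally show ?case
    unfolding sum .
qed

lemma wd_braid_power:
  assumes "s \<in> S" "t \<in> S"
  shows "wd (concat (replicate k [s, t])) = (gen s \<cdot> gen t) [^]\<^bsub>W\<^esub> k"
proof (induction k)
  case (Suc k)
  have "set (concat (replicate k [s, t])) \<subseteq> S" using assms by (induction k) auto
  then show ?case
    using Suc assms W.nat_pow_Suc2[of "gen s \<cdot> gen t" k] by (simp add: W.m_assoc)
qed simp

lemma pos_word_concat: "pos_word (concat (replicate k [s, t])) = concat (replicate k [(s, True), (t, True)])"
  by (induction k) auto

lemma braid_power_one:
  assumes "s \<in> S" "t \<in> S" "s \<noteq> t" "m s t = enat k"
  shows "(gen s \<cdot> gen t) [^]\<^bsub>W\<^esub> k = \<one>\<^bsub>W\<^esub>"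
proof -
  have set: "set (concat (replicate k [s, t])) \<subseteq> S" using assms by (induction k) auto
  have "(concat (replicate k [(s, True), (t, True)]), []) \<in> W_rel"
    unfolding coxeter_relations_def using assms by blast
  then have eq: "pres_eq S W_rel (pos_word (concat (replicate k [s, t]))) (pos_word [])"
    using set pos_word_lists[of "concat (replicate k [s, t])" S]
    unfolding pos_word_concat by (intro pres_eq.rel) auto
  have "wd (concat (replicate k [s, t])) = wd []"
    using wd_eq_iff[OF set, of "[]"] eq by simp
  then show ?thesis using assms by (simp add: wd_braid_power)
qed

lemma refl_act_pres_eq:
  assumes "pres_eq S W_rel u v" "x \<in> carrier W \<times> UNIV"
  shows "refl_act u x = refl_act v x"
  using assms
proof (induction arbitrary: x rule: pres_eq.induct)
  case (append u u' v v')
  have "v \<in> lists (S \<times> UNIV)" using pres_eq_lists[OF append.hyps(2)] by blast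
  then show ?case
    using append by (metis refl_act_closed refl_act_simps(3))
next
  case (cancel s b)
  then show ?case by (simp add: refl_step_invol)
next
  case (rel u v)
  from rel.hyps(1) consider s where "u = [(s, True), (s, True)]" "v = []" "s \<in> S"
    | s t k where "u = concat (replicate k [(s, True), (t, True)])" "v = []"
      "s \<in> S" "t \<in> S" "s \<noteq> t" "m s t = enat k"
    unfolding coxeter_relations_def by blast
  then show ?case
  proof cases
    case 1
    then show ?thesis using rel by (simp add: refl_step_invol)
  next
    case 2
    obtain r e where x: "x = (r, e)" "r \<in> carrier W"
      using rel by (cases x) auto
    let ?d = "gen s \<cdot> gen t"
    have d: "?d \<in> carrier W" and one: "?d [^]\<^bsub>W\<^esub> k = \<one>\<^bsub>W\<^esub>"
      using 2 braid_power_one by auto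
    have shift: "?d [^]\<^bsub>W\<^esub> (k + i) = ?d [^]\<^bsub>W\<^esub> i" for i
      using d one W.nat_pow_mult[OF d, of k i] by simp
    \<comment> \<open>Since \<open>d^k = 1\<close>, the list of 2k reflections is a list of k
      reflections written twice, so every reflection is crossed an even number of times. This is
      what makes the signed action respect the relation.\<close>
    have "even (\<Sum>i<2 * k. of_bool (r = gen t \<cdot> ?d [^]\<^bsub>W\<^esub> i) :: nat)"
      unfolding mult_2 sum_lessThan_add shift by simp
    then show ?thesis
      unfolding x 2(1) refl_act_braid[OF 2(3,4) x(2)] using x one 2(2) by simp
  qed
qed auto

section \<open>Parity of crossings, deletion and exchange\<close>

definition parity :: "'s list \<Rightarrow> 's gword set \<Rightarrow> bool" where
  "parity ss r = snd (refl_act (pos_word ss) (r, False))"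

lemma refl_act_parity:
  "set ss \<subseteq> S \<Longrightarrow> r \<in> carrier W \<Longrightarrow>
    refl_act (pos_word ss) (r, e) = (wd ss \<cdot> r \<cdot> winv (wd ss), e \<noteq> parity ss r)"
proof (induction ss arbitrary: e)
  case (Cons s ss)
  have IH: "refl_act (pos_word ss) (r, e) = (wd ss \<cdot> r \<cdot> winv (wd ss), e \<noteq> parity ss r)" for e
    using Cons by simp
  have c: "gen s \<cdot> (wd ss \<cdot> r \<cdot> winv (wd ss)) \<cdot> gen s
      = wd (s # ss) \<cdot> r \<cdot> winv (wd (s # ss))"
    using Cons.prems by (simp add: W.inv_mult_group W.m_assoc)
  show ?case
    unfolding parity_def[of "s # ss"] pos_word_simps refl_act_simps IH refl_step_def fst_conv snd_conv c
    by auto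
qed (simp add: parity_def)

text \<open>The signed action respects the defining relations, so the parity depends on the group
  element alone.\<close>

lemma parity_cong:
  assumes "wd ss = wd tt" "set ss \<subseteq> S" "set tt \<subseteq> S" "r \<in> carrier W"
  shows "parity ss r = parity tt r"
  unfolding parity_def using assms refl_act_pres_eq[of "pos_word ss" "pos_word tt" "(r, False)"]
  by (simp add: wd_eq_iff)

text \<open>The last letter acts first: it fixes the reflection \<open>gen s\<close> and flips its
  sign.\<close>

lemma parity_snoc:
  assumes "set ss \<subseteq> S" "s \<in> S"
  shows "parity (ss @ [s]) (gen s) \<longleftrightarrow> \<not> parity ss (gen s)"
proof -
  have "refl_step s (gen s, False) = (gen s, True)"
    using assms by (simp add: refl_step_def)
  then show ?thesis
    using assms refl_act_parity[of ss "gen s" True] by (simp add: parity_def)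
qed

text \<open>An odd number of crossings means that some letter crosses \<open>r\<close>. That letter
  is the conjugate of \<open>r\<close> by the word after it, so multiplying by \<open>r\<close> on
  the right cancels it.\<close>

lemma parity_deletion:
  assumes "set ss \<subseteq> S" "r \<in> carrier W" "parity ss r"
  shows "\<exists>i<length ss. wd ss \<cdot> r = wd (take i ss @ drop (Suc i) ss)"
  using assms
proof (induction ss)
  case Nil
  then show ?case by (simp add: parity_def)
next
  case (Cons s ss)
  have s: "s \<in> S" "set ss \<subseteq> S" using Cons.prems by auto
  have eq: "parity (s # ss) r \<longleftrightarrow> (parity ss r \<noteq> (wd ss \<cdot> r \<cdot> winv (wd ss) = gen s))"
    unfolding parity_def[of "s # ss"] pos_word_simps refl_act_simps
      refl_act_parity[OF s(2) Cons.prems(2)] refl_step_def by simp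
  show ?case
  proof (cases "parity ss r")
    case True
    then obtain i where i: "i < length ss" "wd ss \<cdot> r = wd (take i ss @ drop (Suc i) ss)"
      using Cons by auto
    have "set (take i ss @ drop (Suc i) ss) \<subseteq> S"
      using s set_take_subset[of i ss] set_drop_subset[of "Suc i" ss] by auto
    then show ?thesis
      using i s Cons.prems(2) by (intro exI[of _ "Suc i"]) (simp add: W.m_assoc del: wd_append)
  next
    case False
    then have "wd ss \<cdot> r \<cdot> winv (wd ss) = gen s"
      using eq Cons.prems(3) by simp
    then have "wd ss \<cdot> r = gen s \<cdot> wd ss"
      using s Cons.prems(2) by (metis W.inv_closed W.inv_solve_right' W.m_closed gen_closed wd_closed W.inv_inv)
    then show ?thesis
      using s Cons.prems(2) by (intro exI[of _ 0]) (simp add: W.m_assoc)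
  qed
qed

lemma len_wd_le: "set ss \<subseteq> S \<Longrightarrow> len (wd ss) \<le> length ss"
  unfolding coxeter_length_def wd_def by (rule Least_le) blast

lemma reduced_word_exists:
  assumes "w \<in> carrier W"
  shows "\<exists>ss. set ss \<subseteq> S \<and> wd ss = w \<and> length ss = len w"
proof -
  obtain tt where "set tt \<subseteq> S" "wd tt = w" using wd_surj[OF assms] by blast
  then have "\<exists>n. \<exists>ss. set ss \<subseteq> S \<and> length ss = n \<and> wd ss = w" by blast
  then have "\<exists>ss. set ss \<subseteq> S \<and> length ss = len w \<and> wd ss = w"
    unfolding coxeter_length_def wd_def by (rule LeastI_ex)
  then show ?thesis by blast
qed

text \<open>If the parity at \<open>gen s\<close> were even, a reduced word \<open>tt\<close> of the
  product, extended by s, would spell the original element with even parity, so \<open>tt\<close>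
  would have odd parity. Deletion in \<open>tt\<close> would then write the original element with
  fewer letters than its product with s has, against the hypothesis.\<close>

theorem exchange:
  assumes ss: "set ss \<subseteq> S" and s: "s \<in> S" and le: "len (wd ss \<cdot> gen s) \<le> len (wd ss)"
  shows "\<exists>i<length ss. wd ss \<cdot> gen s = wd (take i ss @ drop (Suc i) ss)"
proof (rule parity_deletion[OF ss])
  show "gen s \<in> carrier W" using s by simp
  show "parity ss (gen s)"
  proof (rule ccontr)
    assume np: "\<not> parity ss (gen s)"
    obtain tt where tt: "set tt \<subseteq> S" "wd tt = wd ss \<cdot> gen s" "length tt = len (wd ss \<cdot> gen s)"
      using reduced_word_exists[of "wd ss \<cdot> gen s"] ss s by auto
    have "wd tt \<cdot> gen s = wd ss"
      using tt ss s by (simp add: W.m_assoc)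
    then have "wd (tt @ [s]) = wd ss"
      using tt s by simp
    then have "\<not> parity (tt @ [s]) (gen s)"
      using np parity_cong[of "tt @ [s]" ss "gen s"] tt(1) s ss by simp
    then have "parity tt (gen s)"
      using tt(1) s by (simp add: parity_snoc)
    then obtain i where i: "i < length tt" "wd tt \<cdot> gen s = wd (take i tt @ drop (Suc i) tt)"
      using parity_deletion[OF tt(1) gen_closed[OF s]] by blast
    have "set (take i tt @ drop (Suc i) tt) \<subseteq> S"
      using tt(1) set_take_subset[of i tt] set_drop_subset[of "Suc i" tt] by auto
    from len_wd_le[OF this] have "len (wd ss) < length tt"
      using i \<open>wd tt \<cdot> gen s = wd ss\<close> by simp
    with le tt(3) show False by simp
  qed
qed

section \<open>Elementary properties of the length\<close>

lemma len_one [simp]: "len \<one>\<^bsub>W\<^esub> = 0"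
  using len_wd_le[of "[]"] by simp

lemma len_mult_le:
  assumes "v \<in> carrier W" "w \<in> carrier W"
  shows "len (v \<cdot> w) \<le> len v + len w"
proof -
  obtain ss where ss: "set ss \<subseteq> S" "wd ss = v" "length ss = len v"
    using reduced_word_exists[OF assms(1)] by blast
  obtain tt where tt: "set tt \<subseteq> S" "wd tt = w" "length tt = len w"
    using reduced_word_exists[OF assms(2)] by blast
  show ?thesis using len_wd_le[of "ss @ tt"] ss tt by simp
qed

lemma len_gen_le: "s \<in> S \<Longrightarrow> len (gen s) \<le> 1"
  using len_wd_le[of "[s]"] by simp

text \<open>Subadditivity bounds the change by one. It cannot be zero, since exchange would then
  delete a letter from a reduced word and still reach an element of the same length.\<close>

lemma len_mult_gen:
  assumes w: "w \<in> carrier W" and s: "s \<in> S"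
  shows "len (w \<cdot> gen s) = Suc (len w) \<or> Suc (len (w \<cdot> gen s)) = len w"
proof -
  have "w \<cdot> gen s \<cdot> gen s = w"
    using assms by (simp add: W.m_assoc)
  then have 1: "len w \<le> Suc (len (w \<cdot> gen s))"
    using len_mult_le[of "w \<cdot> gen s" "gen s"] len_gen_le[OF s] assms by simp
  have 2: "len (w \<cdot> gen s) \<le> Suc (len w)"
    using len_mult_le[of w "gen s"] len_gen_le[OF s] assms by simp
  have "len (w \<cdot> gen s) \<noteq> len w"
  proof
    assume eq: "len (w \<cdot> gen s) = len w"
    obtain ss where ss: "set ss \<subseteq> S" "wd ss = w" "length ss = len w"
      using reduced_word_exists[OF w] by blast
    then obtain i where i: "i < length ss" "w \<cdot> gen s = wd (take i ss @ drop (Suc i) ss)"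
      using exchange[OF ss(1) s] eq by auto
    have "set (take i ss @ drop (Suc i) ss) \<subseteq> S"
      using ss(1) set_take_subset[of i ss] set_drop_subset[of "Suc i" ss] by auto
    from len_wd_le[OF this] show False
      using i ss eq by simp
  qed
  with 1 2 show ?thesis by linarith
qed

lemma len_inv:
  assumes w: "w \<in> carrier W"
  shows "len (winv w) = len w"
proof -
  have le: "len (winv w) \<le> len w" if w: "w \<in> carrier W" for w
  proof -
    obtain ss where ss: "set ss \<subseteq> S" "wd ss = w" "length ss = len w"
      using reduced_word_exists[OF w] by blast
    then show ?thesis using len_wd_le[of "rev ss"] by (simp add: wd_rev)
  qed
  from le[OF w] le[of "winv w"] show ?thesis using w by simp
qed

section \<open>Parabolic subgroups and minimal coset representatives\<close>

lemma parabolic_iff: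
  assumes Y: "Y \<subseteq> S"
  shows "w \<in> parabolic S m Y \<longleftrightarrow> (\<exists>ys. set ys \<subseteq> Y \<and> wd ys = w)"
proof
  assume "w \<in> parabolic S m Y"
  then have "w \<in> generate W (gen ` Y)" by (simp add: parabolic_def)
  then show "\<exists>ys. set ys \<subseteq> Y \<and> wd ys = w"
  proof (induction rule: generate.induct)
    case one
    show ?case by (intro exI[of _ "[]"]) simp
  next
    case (incl h)
    then obtain s where "s \<in> Y" "h = gen s" by blast
    then show ?case using Y by (intro exI[of _ "[s]"]) auto
  next
    case (inv h)
    then obtain s where "s \<in> Y" "h = gen s" by blast
    then show ?case using Y by (intro exI[of _ "[s]"]) auto
  next
    case (eng h1 h2)
    then obtain xs ys where "set xs \<subseteq> Y" "wd xs = h1" "set ys \<subseteq> Y" "wd ys = h2" by blast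
    then show ?case using Y by (intro exI[of _ "xs @ ys"]) auto
  qed
next
  assume "\<exists>ys. set ys \<subseteq> Y \<and> wd ys = w"
  then obtain ys where "set ys \<subseteq> Y" "wd ys = w" by blast
  moreover have "wd ys \<in> generate W (gen ` Y)" if "set ys \<subseteq> Y"
    using that
  proof (induction ys)
    case Nil
    then show ?case by (simp add: generate.one)
  next
    case (Cons y ys)
    then have "gen y \<in> generate W (gen ` Y)" "wd ys \<in> generate W (gen ` Y)"
      by (simp_all add: generate.incl)
    then show ?case by (simp add: generate.eng)
  qed
  ultimately show "w \<in> parabolic S m Y" by (simp add: parabolic_def)
qed

lemma parabolic_closed: "Y \<subseteq> S \<Longrightarrow> w \<in> parabolic S m Y \<Longrightarrow> w \<in> carrier W"
  by (auto simp: parabolic_iff)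

lemma parabolic_one: "Y \<subseteq> S \<Longrightarrow> \<one>\<^bsub>W\<^esub> \<in> parabolic S m Y"
  by (auto simp: parabolic_iff intro!: exI[of _ "[]"])

lemma parabolic_gen: "Y \<subseteq> S \<Longrightarrow> s \<in> Y \<Longrightarrow> gen s \<in> parabolic S m Y"
  by (auto simp: parabolic_def intro: generate.incl)

lemma parabolic_mult:
  "v \<in> parabolic S m Y \<Longrightarrow> w \<in> parabolic S m Y \<Longrightarrow> v \<cdot> w \<in> parabolic S m Y"
  by (auto simp: parabolic_def intro: generate.eng)

lemma parabolic_inv:
  assumes "Y \<subseteq> S" "w \<in> parabolic S m Y"
  shows "winv w \<in> parabolic S m Y"
proof -
  obtain ys where "set ys \<subseteq> Y" "wd ys = w" using assms parabolic_iff by blast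
  then show ?thesis
    using assms(1) wd_rev[of ys] by (auto simp: parabolic_iff intro!: exI[of _ "rev ys"])
qed

lemma parabolic_empty: "parabolic S m {} = {\<one>\<^bsub>W\<^esub>}"
  using parabolic_iff[of "{}"] by auto

lemma coset_minimal_iff:
  "coset_minimal S m a Y \<longleftrightarrow> (\<forall>b\<in>parabolic S m Y. len a \<le> len (a \<cdot> b))"
  by (auto simp: coset_minimal_def l_coset_def)

lemma coset_minimal_empty: "a \<in> carrier W \<Longrightarrow> coset_minimal S m a {}"
  by (simp add: coset_minimal_iff parabolic_empty)

lemma coset_minimal_one: "coset_minimal S m \<one>\<^bsub>W\<^esub> Y"
  by (simp add: coset_minimal_iff)

lemma coset_decomposition:
  assumes Y: "Y \<subseteq> S" and w: "w \<in> carrier W"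
  shows "\<exists>a b. a \<in> carrier W \<and> coset_minimal S m a Y \<and> b \<in> parabolic S m Y \<and> w = a \<cdot> b"
proof -
  obtain b where b: "b \<in> parabolic S m Y"
    and min: "\<And>b'. b' \<in> parabolic S m Y \<Longrightarrow> len (w \<cdot> b) \<le> len (w \<cdot> b')"
    using arg_min_nat_lemma[of "\<lambda>b. b \<in> parabolic S m Y" "\<one>\<^bsub>W\<^esub>" "\<lambda>b. len (w \<cdot> b)"] parabolic_one[OF Y]
    by blast
  note bc = parabolic_closed[OF Y b]
  have "coset_minimal S m (w \<cdot> b) Y"
    unfolding coset_minimal_iff
  proof
    fix c assume c: "c \<in> parabolic S m Y"
    then show "len (w \<cdot> b) \<le> len (w \<cdot> b \<cdot> c)"
      using min[OF parabolic_mult[OF b c]] w bc parabolic_closed[OF Y c] by (simp add: W.m_assoc)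
  qed
  moreover have "w = (w \<cdot> b) \<cdot> winv b"
    using w bc by (simp add: W.m_assoc)
  ultimately show ?thesis
    using parabolic_inv[OF Y b] w bc by (intro exI[of _ "w \<cdot> b"] exI[of _ "winv b"]) simp
qed

lemma delete_set: "set ss \<subseteq> Z \<Longrightarrow> set (take i ss @ drop (Suc i) ss) \<subseteq> Z"
  using set_take_subset[of i ss] set_drop_subset[of "Suc i" ss] by auto

text \<open>If the last letter failed to increase the length, exchange would delete a letter either
  from a reduced word of \<open>a\<close>, against minimality in the coset, or from
  \<open>ys\<close>, against shortness. Shortness refers to words over \<open>Y\<close> only,
  because reduced words over \<open>Y\<close> are first obtained from this lemma, as the case
  \<open>a = 1\<close>.\<close>

lemma len_minimal_mult_word:
  assumes Y: "Y \<subseteq> S" and a: "a \<in> carrier W" "coset_minimal S m a Y"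
    and ys: "set ys \<subseteq> Y"
    and short: "\<And>zs. set zs \<subseteq> Y \<Longrightarrow> wd zs = wd ys \<Longrightarrow> length ys \<le> length zs"
  shows "len (a \<cdot> wd ys) = len a + length ys"
  using ys short
proof (induction ys rule: rev_induct)
  case Nil
  then show ?case using a by simp
next
  case (snoc s ys)
  have s: "s \<in> Y" "s \<in> S" and ys: "set ys \<subseteq> Y" "set ys \<subseteq> S" using snoc.prems Y by auto
  have short: "length ys \<le> length zs" if "set zs \<subseteq> Y" "wd zs = wd ys" for zs
  proof -
    have "set (zs @ [s]) \<subseteq> Y" "wd (zs @ [s]) = wd (ys @ [s])" using that s ys Y by auto
    then show ?thesis using snoc.prems(2) by fastforce
  qed
  have IH: "len (a \<cdot> wd ys) = len a + length ys"
    using snoc.IH ys(1) short by blast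
  obtain as where as: "set as \<subseteq> S" "wd as = a" "length as = len a"
    using reduced_word_exists[OF a(1)] by blast
  let ?v = "a \<cdot> wd ys"
  have v: "?v \<in> carrier W" and v_wd: "wd (as @ ys) = ?v" using a ys as by auto
  have "\<not> len (?v \<cdot> gen s) \<le> len ?v"
  proof
    assume le: "len (?v \<cdot> gen s) \<le> len ?v"
    have "set (as @ ys) \<subseteq> S" using as ys by simp
    from exchange[OF this s(2)] le obtain i where i: "i < length (as @ ys)"
      "?v \<cdot> gen s = wd (take i (as @ ys) @ drop (Suc i) (as @ ys))"
      unfolding v_wd by blast
    show False
    proof (cases "i < length as")
      case True
      let ?d = "take i as @ drop (Suc i) as"
      have d: "set ?d \<subseteq> S" by (rule delete_set[OF as(1)])
      have "?v \<cdot> gen s = wd (?d @ ys)"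
        using i True by (simp add: Suc_diff_le)
      also have "\<dots> = wd ?d \<cdot> wd ys"
        using d ys by (intro wd_append)
      finally have eq: "?v \<cdot> gen s = wd ?d \<cdot> wd ys" .
      \<comment> \<open>Moving s to the left past \<open>wd ys\<close> turns it into an element of
        the parabolic subgroup, so the shortened word for \<open>a\<close> represents an element of
        the coset of \<open>a\<close>.\<close>
      let ?c = "wd ys \<cdot> gen s \<cdot> winv (wd ys)"
      have "wd ys \<in> parabolic S m Y" using ys Y parabolic_iff by blast
      then have c: "?c \<in> parabolic S m Y"
        using parabolic_gen[OF Y s(1)] parabolic_inv[OF Y] by (intro parabolic_mult) auto
      have "a \<cdot> ?c = (?v \<cdot> gen s) \<cdot> winv (wd ys)"
        using a ys s by (simp add: W.m_assoc)
      also have "\<dots> = wd ?d"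
        unfolding eq using wd_closed[OF d] wd_closed[OF ys(2)] by (simp add: W.m_assoc del: wd_append)
      finally have "len (a \<cdot> ?c) \<le> length ?d"
        using len_wd_le[OF d] by simp
      moreover have "len a \<le> len (a \<cdot> ?c)"
        using a(2) c unfolding coset_minimal_iff by blast
      ultimately show False using as True by simp
    next
      case False
      let ?j = "i - length as"
      let ?d = "take ?j ys @ drop (Suc ?j) ys"
      have d: "set ?d \<subseteq> Y" by (rule delete_set[OF ys(1)])
      have "?v \<cdot> gen s = wd (as @ ?d)"
        using i False by (simp add: Suc_diff_le)
      also have "\<dots> = a \<cdot> wd ?d"
        unfolding as(2)[symmetric] by (rule wd_append[OF as(1) subset_trans[OF d Y]])
      finally have eq: "?v \<cdot> gen s = a \<cdot> wd ?d" .
      have "wd ?d \<in> carrier W" by (rule wd_closed[OF subset_trans[OF d Y]])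
      then have "wd ys \<cdot> gen s = wd ?d"
        using eq a ys s by (simp add: W.m_assoc del: wd_append)
      then have "wd ?d = wd (ys @ [s])" using ys s by simp
      then have "length (ys @ [s]) \<le> length ?d" using snoc.prems(2)[OF d] by simp
      then show False using i False by simp
    qed
  qed
  then have "len (?v \<cdot> gen s) = Suc (len ?v)"
    using len_mult_gen[OF v s(2)] by linarith
  then show ?case using IH a ys s by (simp add: W.m_assoc)
qed

lemma parabolic_short_word:
  assumes Y: "Y \<subseteq> S" and b: "b \<in> parabolic S m Y"
  shows "\<exists>ys. set ys \<subseteq> Y \<and> wd ys = b \<and> (\<forall>zs. set zs \<subseteq> Y \<longrightarrow> wd zs = wd ys \<longrightarrow> length ys \<le> length zs)"
proof -
  obtain xs where xs: "set xs \<subseteq> Y \<and> wd xs = b" using parabolic_iff[OF Y] b by blast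
  obtain ys where "set ys \<subseteq> Y \<and> wd ys = b"
    "\<And>zs. set zs \<subseteq> Y \<and> wd zs = b \<Longrightarrow> length ys \<le> length zs"
    using arg_min_nat_lemma[of "\<lambda>xs. set xs \<subseteq> Y \<and> wd xs = b" xs length, OF xs] by blast
  then show ?thesis by blast
qed

lemma parabolic_reduced_word:
  assumes Y: "Y \<subseteq> S" and b: "b \<in> parabolic S m Y"
  shows "\<exists>ys. set ys \<subseteq> Y \<and> wd ys = b \<and> length ys = len b"
proof -
  obtain ys where ys: "set ys \<subseteq> Y" "wd ys = b"
    "\<And>zs. set zs \<subseteq> Y \<Longrightarrow> wd zs = wd ys \<Longrightarrow> length ys \<le> length zs"
    using parabolic_short_word[OF assms] by blast
  show ?thesis
    using len_minimal_mult_word[OF Y W.one_closed coset_minimal_one ys(1,3)] ys Y by auto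
qed

lemma len_minimal_mult:
  assumes Y: "Y \<subseteq> S" and a: "a \<in> carrier W" "coset_minimal S m a Y" and b: "b \<in> parabolic S m Y"
  shows "len (a \<cdot> b) = len a + len b"
proof -
  obtain ys where ys: "set ys \<subseteq> Y" "wd ys = b"
    "\<And>zs. set zs \<subseteq> Y \<Longrightarrow> wd zs = wd ys \<Longrightarrow> length ys \<le> length zs"
    using parabolic_short_word[OF Y b] by blast
  show ?thesis
    using len_minimal_mult_word[OF Y a ys(1,3)] ys
      len_minimal_mult_word[OF Y W.one_closed coset_minimal_one ys(1,3)] Y by auto
qed

section \<open>The order of a product of two generators\<close>

text \<open>The dual of Tits's geometric representation, written in the coordinates given by the simple
  roots; it keeps the formulas free of sums.\<close>

definition coeff :: "'s \<Rightarrow> 's \<Rightarrow> real" where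
  "coeff s t = (case m s t of enat n \<Rightarrow> 2 * cos (pi / real n) | \<infinity> \<Rightarrow> 2)"

definition geo_step :: "'s \<Rightarrow> ('s \<Rightarrow> real) \<Rightarrow> 's \<Rightarrow> real" where
  "geo_step s x = (\<lambda>t. if t = s then - x s else x t + coeff s t * x s)"

definition geo_act :: "'s gword \<Rightarrow> ('s \<Rightarrow> real) \<Rightarrow> 's \<Rightarrow> real" where
  "geo_act u = foldr (\<lambda>(s, b). geo_step s) u"

lemma geo_act_simps [simp]:
  "geo_act [] x = x" "geo_act ((s, b) # u) x = geo_step s (geo_act u x)"
  "geo_act (u @ v) x = geo_act u (geo_act v x)"
  by (simp_all add: geo_act_def)

lemma geo_step_invol: "geo_step s (geo_step s x) = x"
  by (auto simp: geo_step_def)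

lemma m_sym: "s \<in> S \<Longrightarrow> t \<in> S \<Longrightarrow> m s t = m t s"
  using coxeter_matrix unfolding coxeter_matrix_def by (cases "s = t") auto

lemma m_ge2: "s \<in> S \<Longrightarrow> t \<in> S \<Longrightarrow> s \<noteq> t \<Longrightarrow> 2 \<le> m s t"
  using coxeter_matrix unfolding coxeter_matrix_def by auto

text \<open>In the coordinates s and t the product of the two generators is a rotation by 2 pi/n.
  The parametrization by r and \<phi> is chosen so that each application just adds 2 pi/n to
  \<phi>.\<close>

lemma geo_braid_finite:
  fixes j n :: nat
  assumes st: "s \<in> S" "t \<in> S" "s \<noteq> t" and n: "m s t = enat n"
    and x: "x s = r * cos \<phi>" "x t = - (r * cos (\<phi> + pi / n))"
  defines "y \<equiv> geo_act (concat (replicate j [(s, True), (t, True)])) x"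
  shows "y s = r * cos (\<phi> + 2 * j * pi / n)" "y t = - (r * cos (\<phi> + (2 * j + 1) * pi / n))"
proof -
  have ct: "coeff s t = 2 * cos (pi / n)" "coeff t s = 2 * cos (pi / n)"
    using n m_sym[OF st(1,2)] by (simp_all add: coeff_def)
  have tri: "2 * cos \<theta> * cos \<alpha> = cos (\<alpha> + \<theta>) + cos (\<alpha> - \<theta>)" for \<alpha> \<theta> :: real
    by (simp add: cos_add cos_diff)
  define \<theta> where "\<theta> = pi / n"
  have "y s = r * cos (\<phi> + 2 * j * \<theta>) \<and> y t = - (r * cos (\<phi> + (2 * j + 1) * \<theta>))"
    unfolding y_def
  proof (induction j)
    case 0
    then show ?case using x by (simp add: \<theta>_def)
  next
    case (Suc j)
    let ?z = "geo_act (concat (replicate j [(s, True), (t, True)])) x"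
    let ?\<alpha> = "\<phi> + (2 * j + 1) * \<theta>"
    have z: "?z s = r * cos (?\<alpha> - \<theta>)" "?z t = - (r * cos ?\<alpha>)"
      using Suc by (simp_all add: algebra_simps)
    have 1: "geo_step t ?z s = - (r * cos (?\<alpha> + \<theta>))"
      using st z tri[of \<theta> ?\<alpha>] by (simp add: geo_step_def ct flip: \<theta>_def) (simp add: algebra_simps)
    have 2: "geo_step t ?z t = r * cos ?\<alpha>"
      using z by (simp add: geo_step_def)
    have "geo_step s (geo_step t ?z) s = r * cos (?\<alpha> + \<theta>)"
      unfolding geo_step_def[of s] using 1 by simp
    moreover have "geo_step s (geo_step t ?z) t = - (r * cos (?\<alpha> + 2 * \<theta>))"
      unfolding geo_step_def[of s] using st 1 2 tri[of \<theta> "?\<alpha> + \<theta>"]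
      by (simp add: ct flip: \<theta>_def) (simp add: algebra_simps)
    ultimately show ?case by (simp add: algebra_simps)
  qed
  then show "y s = r * cos (\<phi> + 2 * j * pi / n)" "y t = - (r * cos (\<phi> + (2 * j + 1) * pi / n))"
    by (simp_all add: \<theta>_def)
qed

text \<open>For n at least 2 the sine of pi/n is nonzero, so the second coordinate determines the
  sine part of polar coordinates once the first gives the cosine part.\<close>

lemma dihedral_coords:
  assumes n: "2 \<le> n"
  shows "\<exists>r \<phi>. p = r * cos \<phi> \<and> (q::real) = - (r * cos (\<phi> + pi / real n))"
proof -
  have sin: "sin (pi / n) \<noteq> 0"
    using n by (intro less_imp_neq[symmetric] sin_gt_zero) (auto simp: field_simps)
  obtain r \<phi> where r: "p = r * cos \<phi>" "(q + p * cos (pi / n)) / sin (pi / n) = r * sin \<phi>"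
    using polar_Ex by blast
  have "q = r * sin \<phi> * sin (pi / n) - p * cos (pi / n)"
    using r(2) sin by (simp add: field_simps)
  then show ?thesis
    using r(1) by (intro exI[of _ r] exI[of _ \<phi>]) (simp add: cos_add algebra_simps)
qed

text \<open>A full turn restores the coordinates s and t. Every other coordinate becomes invariant
  under both generators after adding a suitable combination of these two, so it is restored as
  well.\<close>

lemma geo_act_relation:
  assumes st: "s \<in> S" "t \<in> S" "s \<noteq> t" and n: "m s t = enat n"
  shows "geo_act (concat (replicate n [(s, True), (t, True)])) x = x"
proof
  fix a
  have n2: "2 \<le> n" using m_ge2[OF st] n by (simp add: numeral_eq_enat)
  have ct: "coeff s t = 2 * cos (pi / n)" "coeff t s = 2 * cos (pi / n)"
    using n m_sym[OF st(1,2)] by (simp_all add: coeff_def)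
  let ?y = "\<lambda>j. geo_act (concat (replicate j [(s, True), (t, True)])) x"
  obtain r \<phi> where r: "x s = r * cos \<phi>" "x t = - (r * cos (\<phi> + pi / n))"
    using dihedral_coords[OF n2, of "x s" "x t"] by auto
  have full: "real (2 * n) * pi / n = 2 * pi" "real (2 * n + 1) * pi / n = 2 * pi + pi / n"
    using n2 by (simp_all add: field_simps)
  have "\<phi> + (2 * pi + pi / n) = (\<phi> + pi / n) + 2 * pi" by simp
  then have ys: "?y n s = x s" "?y n t = x t"
    unfolding geo_braid_finite[OF st n r] r full by (simp_all only: cos_periodic)
  show "?y n a = x a"
  proof (cases "a = s \<or> a = t")
    case False
    define k where "k = coeff s t"
    \<comment> \<open>This is the determinant of the linear system for \<open>l\<close> and
      \<open>u\<close> below.\<close>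
    have k2: "4 - k\<^sup>2 \<noteq> 0"
    proof -
      have "sin (pi / n) \<noteq> 0"
        using n2 by (intro less_imp_neq[symmetric] sin_gt_zero) (auto simp: field_simps)
      moreover have "4 - k\<^sup>2 = 4 * (sin (pi / n))\<^sup>2"
        unfolding k_def ct by (simp add: power_mult_distrib sin_squared_eq)
      ultimately show ?thesis by simp
    qed
    \<comment> \<open>The coefficients are chosen such that both generators fix \<open>x a + l * x s + u * x t\<close>.\<close>
    define l where "l = (2 * coeff s a + k * coeff t a) / (4 - k\<^sup>2)"
    define u where "u = (2 * coeff t a + k * coeff s a) / (4 - k\<^sup>2)"
    have lu: "coeff s a = 2 * l - k * u" "coeff t a = 2 * u - k * l"
      using k2 by (simp_all add: l_def u_def divide_simps) (simp_all add: power2_eq_square algebra_simps)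
    let ?I = "\<lambda>z. z a + l * z s + u * z t"
    have ck: "coeff s t = k" "coeff t s = k" by (simp_all add: k_def ct)
    have inv: "?I (geo_step s z) = ?I z" "?I (geo_step t z) = ?I z" for z
      using False st(3) by (simp_all add: geo_step_def lu ck algebra_simps)
    have "?I (?y j) = ?I x" for j
    proof (induction j)
      case (Suc j)
      then show ?case by (simp add: inv)
    qed simp
    from this[of n] show ?thesis using ys by simp
  qed (use ys in auto)
qed

lemma geo_act_pres_eq: "pres_eq S W_rel u v \<Longrightarrow> geo_act u x = geo_act v x"
proof (induction arbitrary: x rule: pres_eq.induct)
  case (rel u v)
  from rel.hyps(1) consider s where "u = [(s, True), (s, True)]" "v = []"
    | s t k where "u = concat (replicate k [(s, True), (t, True)])" "v = []"
      "s \<in> S" "t \<in> S" "s \<noteq> t" "m s t = enat k"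
    unfolding coxeter_relations_def by blast
  then show ?case
    by cases (simp_all add: geo_step_invol geo_act_relation)
qed (simp_all add: geo_step_invol)

text \<open>The relations bound the order of st from above only. The representation bounds it from
  below, because a rotation by 2 pi/n needs a multiple of n steps to return.\<close>

lemma braid_power_order:
  assumes st: "s \<in> S" "t \<in> S" "s \<noteq> t" and one: "(gen s \<cdot> gen t) [^]\<^bsub>W\<^esub> j = \<one>\<^bsub>W\<^esub>" and j: "0 < j"
  shows "\<exists>n. m s t = enat n \<and> n dvd j"
proof -
  let ?u = "concat (replicate j [s, t])"
  have u: "set ?u \<subseteq> S" using st by (induction j) auto
  have "wd ?u = wd []" using one st by (simp add: wd_braid_power)
  then have "pres_eq S W_rel (pos_word ?u) []"
    using wd_eq_iff[OF u, of "[]"] by simp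
  then have act: "geo_act (concat (replicate j [(s, True), (t, True)])) x = x" for x
    using geo_act_pres_eq[of "pos_word ?u" "[]"] by (simp add: pos_word_concat)
  show ?thesis
  proof (cases "m s t")
    case (enat n)
    have n2: "2 \<le> n" using m_ge2[OF st] enat by (simp add: numeral_eq_enat)
    \<comment> \<open>The vector with r = 1 and \<phi> = 0: its coordinate s is 1 and equals 1 again
      only after full turns.\<close>
    define x where "x = (\<lambda>a. if a = s then 1 else - cos (pi / n))"
    have "x s = 1 * cos 0" "x t = - (1 * cos (0 + pi / n))"
      using st by (simp_all add: x_def)
    from geo_braid_finite(1)[OF st enat this, of j] have "cos (2 * j * pi / n) = 1"
      by (simp add: act x_def)
    then obtain k :: int where "2 * j * pi / n = real_of_int k * 2 * pi"
      using cos_one_2pi_int by blast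
    then have "real j = k * n" using n2 by (simp add: field_simps)
    then have "int j = k * int n" by (metis of_int_eq_iff of_int_mult of_int_of_nat_eq)
    then have "n dvd j" by (metis dvd_triv_right int_dvd_int_iff)
    with enat show ?thesis by blast
  next
    case infinity
    have ct: "coeff s t = 2" "coeff t s = 2"
      using infinity m_sym[OF st(1,2)] by (simp_all add: coeff_def)
    \<comment> \<open>For the infinite label, both generators preserve the sum of the coordinates s
      and t. On vectors with sum 1 the product shifts the coordinate s by -2, so it never
      returns.\<close>
    define x where "x = (\<lambda>a. if a = s then 0 else (1::real))"
    let ?y = "\<lambda>j. geo_act (concat (replicate j [(s, True), (t, True)])) x"
    have "?y j s = - 2 * real j \<and> ?y j s + ?y j t = 1" for j
    proof (induction j)
      case 0
      then show ?case using st by (simp add: x_def)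
    next
      case (Suc j)
      then show ?case using st ct by (simp add: geo_step_def)
    qed
    then have "?y j s = - 2 * real j" by blast
    then have False using j by (simp add: act x_def)
    then show ?thesis ..
  qed
qed

section \<open>Matsumoto's theorem\<close>

definition reduced :: "'s list \<Rightarrow> bool" where
  "reduced ss \<longleftrightarrow> set ss \<subseteq> S \<and> length ss = len (wd ss)"

lemma reducedD: "reduced ss \<Longrightarrow> set ss \<subseteq> S" "reduced ss \<Longrightarrow> len (wd ss) = length ss"
  by (simp_all add: reduced_def)

lemma reduced_shortest:
  assumes "reduced ss" "set tt \<subseteq> S" "wd tt = wd ss"
  shows "length ss \<le> length tt"
  using len_wd_le[OF assms(2)] assms by (simp add: reduced_def)

lemma reduced_append:
  assumes "reduced (ss @ tt)"
  shows "reduced ss" "reduced tt"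
proof -
  have S: "set ss \<subseteq> S" "set tt \<subseteq> S" using reducedD(1)[OF assms] by auto
  then have "len (wd ss) + len (wd tt) \<ge> length ss + length tt"
    using len_mult_le[of "wd ss" "wd tt"] reducedD(2)[OF assms] by simp
  then show "reduced ss" "reduced tt"
    using len_wd_le[OF S(1)] len_wd_le[OF S(2)] S by (auto simp: reduced_def)
qed

lemma reduced_rev: "reduced ss \<Longrightarrow> reduced (rev ss)"
  by (simp add: reduced_def wd_rev len_inv)

lemma reduced_append_iff:
  assumes "reduced ss" "reduced tt"
  shows "reduced (ss @ tt) \<longleftrightarrow> len (wd ss \<cdot> wd tt) = len (wd ss) + len (wd tt)"
  using assms by (auto simp: reduced_def)

lemma wd_alternating_eq:
  assumes "s \<in> S" "t \<in> S" "s \<noteq> t" "m s t = enat k"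
  shows "wd (alternating k s t) = wd (alternating k t s)"
proof -
  have "set (alternating k s t) \<subseteq> S" "set (alternating k t s) \<subseteq> S"
    using alternating_set[of k s t] alternating_set[of k t s] assms by auto
  then show ?thesis
    using alternating_coxeter[of s S t m k] m_sym[of s t] assms
    by (simp add: wd_eq_iff pos_word_alternating)
qed

text \<open>In a longer alternating word the k letters after the first can be exchanged for those
  starting with s. The two adjacent letters s then cancel, which shortens the word.\<close>

lemma reduced_alternating_le:
  assumes st: "s \<in> S" "t \<in> S" "s \<noteq> t" and k: "m s t = enat k" and red: "reduced (alternating n s t)"
  shows "n \<le> k"
proof (rule ccontr)
  assume "\<not> n \<le> k"
  then obtain j where n: "n = Suc (k + j)" using less_imp_Suc_add by (metis not_le)
  let ?rest = "if even k then alternating j t s else alternating j s t"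
  have rest: "set ?rest \<subseteq> S" "set (alternating k s t) \<subseteq> S" "set (alternating k t s) \<subseteq> S"
    using alternating_set[of j s t] alternating_set[of j t s]
      alternating_set[of k s t] alternating_set[of k t s] st by auto
  have k0: "0 < k" using m_ge2[OF st] k by (simp add: numeral_eq_enat)
  then obtain k' where k': "k = Suc k'" by (cases k) auto
  have tail: "set (alternating k' t s @ ?rest) \<subseteq> S"
    using rest unfolding k' by auto
  have "wd (alternating n s t) = gen s \<cdot> wd (alternating k t s @ ?rest)"
    unfolding n by (simp add: alternating_add)
  also have "\<dots> = gen s \<cdot> wd (alternating k s t @ ?rest)"
    using rest wd_alternating_eq[OF st k] by (simp only: wd_append)
  also have "\<dots> = wd (alternating k' t s @ ?rest)"
    using st tail by (simp add: k' del: wd_append)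
  finally have "n \<le> length (alternating k' t s @ ?rest)"
    using reduced_shortest[OF red tail] by simp
  then show False using n k' by (simp split: if_splits)
qed

lemma reduced_dihedral_alternating:
  assumes "reduced ss" "set ss \<subseteq> {s, t}" "s \<noteq> t" "ss \<noteq> [] \<Longrightarrow> hd ss = s"
  shows "ss = alternating (length ss) s t"
  using assms
proof (induction ss arbitrary: s t)
  case (Cons x ss)
  have x: "x = s" using Cons.prems(4) by simp
  have red: "reduced ss" using reduced_append(2)[of "[x]" ss] Cons.prems by simp
  have "ss = alternating (length ss) t s"
  proof (rule Cons.IH[OF red])
    assume ne: "ss \<noteq> []"
    show "hd ss = t"
    proof (rule ccontr)
      assume "hd ss \<noteq> t"
      then have "hd ss = s" using Cons.prems(2) ne by (cases ss) auto
      then obtain tt where tt: "ss = s # tt" using ne by (cases ss) auto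
      have S: "set (x # ss) \<subseteq> S" using Cons.prems(1) reducedD by blast
      have "wd tt = wd (x # ss)" using S by (simp add: tt x)
      then have "length (x # ss) \<le> length tt"
        using reduced_shortest[OF Cons.prems(1), of tt] S tt by simp
      then show False by (simp add: tt)
    qed
  qed (use Cons.prems in auto)
  then show ?case using x by simp
qed simp

text \<open>A descent s gives a reduced word ending in s, and reduced words in two letters
  alternate. Writing it as a reversed alternating word names its last letter instead of its
  first.\<close>

lemma dihedral_descent:
  assumes st: "s \<in> S" "t \<in> S" "s \<noteq> t" and b: "b \<in> parabolic S m {s, t}"
    and desc: "len (b \<cdot> gen s) < len b"
  shows "b = wd (rev (alternating (len b) s t))" "reduced (rev (alternating (len b) s t))"
proof -
  have Y: "{s, t} \<subseteq> S" using st by simp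
  have bc: "b \<in> carrier W" by (rule parabolic_closed[OF Y b])
  have "b \<cdot> gen s \<in> parabolic S m {s, t}"
    using parabolic_mult[OF b parabolic_gen[OF Y]] by simp
  then obtain ys where ys: "set ys \<subseteq> {s, t}" "wd ys = b \<cdot> gen s" "length ys = len (b \<cdot> gen s)"
    using parabolic_reduced_word[OF Y] by blast
  have bs: "wd (ys @ [s]) = b"
    using wd_append[OF subset_trans[OF ys(1) Y], of "[s]"] ys(2) st bc by (simp add: W.m_assoc)
  moreover have "length (ys @ [s]) = len b"
    using ys desc len_mult_gen[OF bc st(1)] by auto
  ultimately have red: "reduced (ys @ [s])"
    using ys Y by (auto simp: reduced_def simp del: wd_append)
  have "rev (ys @ [s]) = alternating (length (rev (ys @ [s]))) s t"
    by (rule reduced_dihedral_alternating[OF reduced_rev[OF red]]) (use ys st in auto)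
  then have "ys @ [s] = rev (alternating (len b) s t)"
    using \<open>length (ys @ [s]) = len b\<close> by (metis length_rev rev_rev_ident)
  then show "b = wd (rev (alternating (len b) s t))" "reduced (rev (alternating (len b) s t))"
    using bs red by simp_all
qed

text \<open>If both generators shorten \<open>b\<close>, then \<open>b\<close> is spelled by both
  alternating words of length n = \<open>len b\<close>. Joining the inverse of one to the other
  gives (st)^n = 1, so m(s,t) is finite and divides n. A reduced alternating word has at most m(s,t)
  letters, so the two are equal.\<close>

lemma dihedral_longest:
  assumes st: "s \<in> S" "t \<in> S" "s \<noteq> t" and b: "b \<in> parabolic S m {s, t}"
    and desc: "len (b \<cdot> gen s) < len b" "len (b \<cdot> gen t) < len b"
  shows "m s t = enat (len b)"
proof -
  let ?n = "len b"
  have n: "0 < ?n" using desc by simp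
  have tsb: "b \<in> parabolic S m {t, s}" using b by (simp add: insert_commute)
  note bs = dihedral_descent[OF st b desc(1)]
  note bt = dihedral_descent[OF st(2,1) st(3)[symmetric] tsb desc(2)]
  have S: "set (alternating i s t) \<subseteq> S" "set (alternating i t s) \<subseteq> S" for i
    using alternating_set[of i s t] alternating_set[of i t s] st by auto
  have bc: "b \<in> carrier W" using parabolic_closed[of "{s, t}"] b st by simp
  have "wd (alternating (2 * ?n) s t) = \<one>\<^bsub>W\<^esub>"
  proof -
    have "alternating (2 * ?n) s t = alternating ?n s t @ rev (alternating ?n t s)"
      unfolding mult_2 alternating_add by (simp add: rev_alternating)
    moreover have "wd (alternating ?n s t) = winv b"
      using bs(1) wd_rev[of "rev (alternating ?n s t)"] S by simp
    moreover have "wd (rev (alternating ?n t s)) = b" using bt(1) by simp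
    ultimately show ?thesis
      using S bc wd_append[of "alternating ?n s t" "rev (alternating ?n t s)"] by simp
  qed
  then have "(gen s \<cdot> gen t) [^]\<^bsub>W\<^esub> ?n = \<one>\<^bsub>W\<^esub>"
    using wd_braid_power[OF st(1,2)] by (simp add: alternating_eq)
  then obtain k where k: "m s t = enat k" "k dvd ?n"
    using braid_power_order[OF st _ n] by blast
  have "?n \<le> k"
    using reduced_alternating_le[OF st k(1)] reduced_rev[OF bs(2)] by simp
  moreover have "k \<le> ?n" using k(2) n by (rule dvd_imp_le)
  ultimately show ?thesis using k by simp
qed

text \<open>Words with a common last letter are settled by induction. If the last letters s and t
  differ, both shorten the element, hence also its factor in the subgroup generated by s and t,
  which is then the longest element there. Its two alternating words give reduced words
  \<open>?u\<close> and \<open>?v\<close> ending in s and t that differ by one braid relation, and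
  induction links them to \<open>ss\<close> and \<open>tt\<close>.\<close>

theorem Matsumoto:
  assumes "reduced ss" "reduced tt" "wd ss = wd tt"
  shows "pres_eq S A_rel (pos_word ss) (pos_word tt)"
  using assms
proof (induction "length ss" arbitrary: ss tt rule: less_induct)
  case less
  have same_last: "pres_eq S A_rel (pos_word (xs @ [x])) (pos_word (ys @ [x]))"
    if xy: "length (xs @ [x]) = length ss" "reduced (xs @ [x])" "reduced (ys @ [x])"
      "wd (xs @ [x]) = wd (ys @ [x])" for xs ys x
  proof -
    have S: "set xs \<subseteq> S" "set ys \<subseteq> S" "x \<in> S"
      using reducedD(1)[OF xy(2)] reducedD(1)[OF xy(3)] by auto
    then have "wd xs = wd ys" using xy(4) by simp
    then have "pres_eq S A_rel (pos_word xs) (pos_word ys)"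
      using xy(1) reduced_append(1)[OF xy(2)] reduced_append(1)[OF xy(3)] by (intro less.hyps) auto
    moreover have "pres_eq S A_rel (pos_word [x]) (pos_word [x])"
      using S by (intro pres_eq.refl) simp
    ultimately show ?thesis
      unfolding pos_word_simps(3) by (rule pres_eq.append)
  qed
  have len: "length ss = length tt"
    using reducedD(2)[OF less.prems(1)] reducedD(2)[OF less.prems(2)] less.prems(3) by simp
  show ?case
  proof (cases "ss = []")
    case True
    then show ?thesis using len by (simp add: pres_eq.refl)
  next
    case False
    then obtain ss' s where ss: "ss = ss' @ [s]" by (metis rev_exhaust)
    from False len have "tt \<noteq> []" by auto
    then obtain tt' t where tt: "tt = tt' @ [t]" by (metis rev_exhaust)
    show ?thesis
    proof (cases "s = t")
      case True
      then show ?thesis using same_last less.prems unfolding ss tt by blast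
    next
      case st: False
      let ?w = "wd ss" and ?Y = "{s, t}"
      have S: "set ss' \<subseteq> S" "set tt' \<subseteq> S" "s \<in> S" "t \<in> S"
        using reducedD(1)[OF less.prems(1)] reducedD(1)[OF less.prems(2)] by (auto simp: ss tt)
      have Y: "?Y \<subseteq> S" using S by simp
      have w: "?w \<in> carrier W" using reducedD(1)[OF less.prems(1)] by simp
      have ws: "len (?w \<cdot> gen s) < len ?w"
      proof -
        have "?w \<cdot> gen s = wd ss'" using S by (simp add: ss W.m_assoc)
        then show ?thesis
          using len_wd_le[OF S(1)] reducedD(2)[OF less.prems(1)] by (simp add: ss)
      qed
      have wt: "len (?w \<cdot> gen t) < len ?w"
      proof -
        have "?w \<cdot> gen t = wd tt'" unfolding less.prems(3) using S by (simp add: tt W.m_assoc)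
        then show ?thesis
          using len_wd_le[OF S(2)] reducedD(2)[OF less.prems(2)] less.prems(3) by (simp add: tt)
      qed
      obtain a b where ab: "a \<in> carrier W" "coset_minimal S m a ?Y" "b \<in> parabolic S m ?Y" "?w = a \<cdot> b"
        using coset_decomposition[OF Y w] by blast
      have bc: "b \<in> carrier W" by (rule parabolic_closed[OF Y ab(3)])
      have add: "len (a \<cdot> c) = len a + len c" if "c \<in> parabolic S m ?Y" for c
        by (rule len_minimal_mult[OF Y ab(1,2) that])
      have desc: "len (b \<cdot> gen x) < len b" if x: "x \<in> ?Y" for x
      proof -
        have "len (a \<cdot> (b \<cdot> gen x)) < len (a \<cdot> b)"
          using x ws wt ab bc S by (auto simp: W.m_assoc)
        then show ?thesis
          using add[OF ab(3)] add[OF parabolic_mult[OF ab(3) parabolic_gen[OF Y x]]] by simp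
      qed
      have n: "m s t = enat (len b)"
        using dihedral_longest[OF S(3,4) st ab(3)] desc by simp
      have n0: "0 < len b" using desc[of s] by simp
      then obtain n' where n': "len b = Suc n'" by (cases "len b") auto
      obtain as where as: "set as \<subseteq> S" "wd as = a" "length as = len a"
        using reduced_word_exists[OF ab(1)] by blast
      then have as_red: "reduced as" by (simp add: reduced_def)
      have bts: "b \<in> parabolic S m {t, s}" using ab(3) by (simp add: insert_commute)
      note bs = dihedral_descent[OF S(3,4) st ab(3) desc[of s, simplified]]
      note bt = dihedral_descent[OF S(4,3) st[symmetric] bts desc[of t, simplified]]
      let ?u = "as @ rev (alternating (len b) s t)" and ?v = "as @ rev (alternating (len b) t s)"
      have len_w: "len ?w = len a + len b" unfolding ab(4) by (rule add[OF ab(3)])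
      have u: "reduced ?u" "wd ?u = ?w"
      proof -
        show "reduced ?u"
          using reduced_append_iff[OF as_red bs(2)] bs(1)[symmetric] as(2) add[OF ab(3)] by simp
        show "wd ?u = ?w"
          using wd_append[OF as(1) reducedD(1)[OF bs(2)]] bs(1)[symmetric] as(2) ab(4) by simp
      qed
      have v: "reduced ?v" "wd ?v = ?w"
      proof -
        show "reduced ?v"
          using reduced_append_iff[OF as_red bt(2)] bt(1)[symmetric] as(2) add[OF ab(3)] by simp
        show "wd ?v = ?w"
          using wd_append[OF as(1) reducedD(1)[OF bt(2)]] bt(1)[symmetric] as(2) ab(4) by simp
      qed
      have u_last: "?u = (as @ rev (alternating n' t s)) @ [s]" and v_last: "?v = (as @ rev (alternating n' s t)) @ [t]"
        unfolding n' by simp_all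
      have 1: "pres_eq S A_rel (pos_word ss) (pos_word ?u)"
        using same_last[of ss' s "as @ rev (alternating n' t s)"] u less.prems(1)
        unfolding u_last ss by simp
      have 3: "pres_eq S A_rel (pos_word ?v) (pos_word tt)"
      proof -
        have "length ((as @ rev (alternating n' s t)) @ [t]) = length ss"
          using as(3) len_w n' reducedD(2)[OF less.prems(1)] by simp
        then show ?thesis
          using same_last[of "as @ rev (alternating n' s t)" t tt'] v less.prems
          unfolding v_last tt by simp
      qed
      have rel: "pres_eq S A_rel (pos_word (alternating (len b) s t)) (pos_word (alternating (len b) t s))"
      proof (rule pres_eq.rel)
        show "(pos_word (alternating (len b) s t), pos_word (alternating (len b) t s)) \<in> A_rel"
          unfolding artin_relations_def pos_word_alternating using S st n by blast
      qed (use alternating_set[of "len b" s t] alternating_set[of "len b" t s] Y in auto)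
      \<comment> \<open>Reversal fixes both alternating words for odd length and swaps them for even
        length, so this is the braid relation or its mirror image.\<close>
      have "pres_eq S A_rel (pos_word (rev (alternating (len b) s t))) (pos_word (rev (alternating (len b) t s)))"
        using rel pres_eq.sym[OF rel] by (simp add: rev_alternating)
      then have 2: "pres_eq S A_rel (pos_word ?u) (pos_word ?v)"
        unfolding pos_word_simps(3) using as(1) by (intro pres_eq.append pres_eq.refl) simp_all
      show ?thesis
        using pres_eq.trans[OF pres_eq.trans[OF 1 2] 3] .
    qed
  qed
qed

section \<open>The section of reduced words in the Artin group\<close>

definition lift :: "'s gword set \<Rightarrow> 's gword set" where
  "lift w = pres_class S A_rel (pos_word (SOME ss. reduced ss \<and> wd ss = w))"

text \<open>By Matsumoto's theorem all reduced words of an element have the same class, so the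
  choice does not affect the value.\<close>

lemma lift_wd:
  assumes "reduced ss"
  shows "lift (wd ss) = pres_class S A_rel (pos_word ss)"
proof -
  let ?t = "SOME tt. reduced tt \<and> wd tt = wd ss"
  have t: "reduced ?t \<and> wd ?t = wd ss"
    using assms by (intro someI[of "\<lambda>tt. reduced tt \<and> wd tt = wd ss" ss]) simp
  then show ?thesis
    unfolding lift_def using Matsumoto[of ?t ss] assms reducedD(1)[of ?t]
    by (subst pres_class_eq_iff) simp_all
qed

abbreviation "A \<equiv> artin_group S m"

sublocale A: group A
  by (rule group_artin_group)

lemma A_carrier: "carrier A = pres_class S A_rel ` lists (S \<times> UNIV)"
  by (simp add: artin_group_def presented_group_def)

lemma A_one: "\<one>\<^bsub>A\<^esub> = pres_class S A_rel []"
  by (simp add: artin_group_def presented_group_def)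

lemma A_class_mult: "u \<in> lists (S \<times> UNIV) \<Longrightarrow> v \<in> lists (S \<times> UNIV) \<Longrightarrow>
    pres_class S A_rel u \<otimes>\<^bsub>A\<^esub> pres_class S A_rel v = pres_class S A_rel (u @ v)"
  unfolding artin_group_def by (rule presented_group_mult)

lemma A_class_closed: "u \<in> lists (S \<times> UNIV) \<Longrightarrow> pres_class S A_rel u \<in> carrier A"
  unfolding A_carrier by (rule imageI)

lemma reduced_exists: "w \<in> carrier W \<Longrightarrow> \<exists>ss. reduced ss \<and> wd ss = w"
  using reduced_word_exists[of w] by (auto simp: reduced_def)

lemma lift_closed: "w \<in> carrier W \<Longrightarrow> lift w \<in> carrier A"
  using reduced_exists[of w] lift_wd reducedD(1) A_class_closed by fastforce

lemma lift_one [simp]: "lift \<one>\<^bsub>W\<^esub> = \<one>\<^bsub>A\<^esub>"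
  using lift_wd[of "[]"] by (simp add: reduced_def A_one)

lemma lift_gen: "s \<in> S \<Longrightarrow> lift (gen s) = artin_gen S m s"
proof -
  assume s: "s \<in> S"
  have "len (gen s) = 1"
    using len_mult_gen[of "\<one>\<^bsub>W\<^esub>" s] s by simp
  then show ?thesis
    using lift_wd[of "[s]"] s by (simp add: reduced_def artin_gen_def pres_gen_def)
qed

lemma lift_mult:
  assumes v: "v \<in> carrier W" and w: "w \<in> carrier W" and add: "len (v \<cdot> w) = len v + len w"
  shows "lift (v \<cdot> w) = lift v \<otimes>\<^bsub>A\<^esub> lift w"
proof -
  obtain ss where ss: "reduced ss" "wd ss = v" using reduced_exists[OF v] by blast
  obtain tt where tt: "reduced tt" "wd tt = w" using reduced_exists[OF w] by blast
  note S = reducedD(1)[OF ss(1)] reducedD(1)[OF tt(1)]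
  have "reduced (ss @ tt)"
    using reduced_append_iff[OF ss(1) tt(1)] add ss tt by simp
  from lift_wd[OF this] show ?thesis
    using lift_wd[OF ss(1)] lift_wd[OF tt(1)] ss tt S by (simp add: A_class_mult)
qed

section \<open>Finite parabolic subgroups of rank at most two\<close>

lemma finite_parabolic_empty: "finite (parabolic S m {})"
  by (simp add: parabolic_empty)

lemma parabolic_single:
  assumes s: "s \<in> S"
  shows "parabolic S m {s} = {\<one>\<^bsub>W\<^esub>, gen s}"
proof
  have wd: "wd ss = \<one>\<^bsub>W\<^esub> \<or> wd ss = gen s" if "set ss \<subseteq> {s}" for ss
    using that s by (induction ss) auto
  show "parabolic S m {s} \<subseteq> {\<one>\<^bsub>W\<^esub>, gen s}"
  proof
    fix w assume "w \<in> parabolic S m {s}"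
    then obtain ss where "set ss \<subseteq> {s}" "wd ss = w" using parabolic_iff[of "{s}"] s by blast
    then show "w \<in> {\<one>\<^bsub>W\<^esub>, gen s}" using wd by blast
  qed
  show "{\<one>\<^bsub>W\<^esub>, gen s} \<subseteq> parabolic S m {s}"
    using s parabolic_one[of "{s}"] parabolic_gen[of "{s}" s] by simp
qed

lemma finite_parabolic_single: "s \<in> S \<Longrightarrow> finite (parabolic S m {s})"
  by (simp add: parabolic_single)

text \<open>Every element has a reduced word over the two letters; such a word alternates and has at
  most k letters.\<close>

lemma finite_parabolic_pair:
  assumes st: "s \<in> S" "t \<in> S" "s \<noteq> t" and k: "m s t = enat k"
  shows "finite (parabolic S m {s, t})"
proof (rule finite_subset)
  have Y: "{s, t} \<subseteq> S" using st by simp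
  let ?F = "{ys. set ys \<subseteq> {s, t} \<and> length ys \<le> k}"
  show "finite (wd ` ?F)"
    by (intro finite_imageI finite_lists_length_le) simp
  show "parabolic S m {s, t} \<subseteq> wd ` ?F"
  proof
    fix b assume b: "b \<in> parabolic S m {s, t}"
    obtain ys where ys: "set ys \<subseteq> {s, t}" "wd ys = b" "length ys = len b"
      using parabolic_reduced_word[OF Y b] by blast
    then have red: "reduced ys" using Y by (auto simp: reduced_def)
    have "length ys \<le> k"
    proof (cases ys)
      case (Cons x xs)
      show ?thesis
      proof (cases "x = s")
        case True
        then have "ys = alternating (length ys) s t"
          using Cons by (intro reduced_dihedral_alternating[OF red ys(1) st(3)]) simp
        then show ?thesis using reduced_alternating_le[OF st k] red by metis
      next
        case False
        then have "ys = alternating (length ys) t s"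
          using Cons ys(1) st(3) by (intro reduced_dihedral_alternating[OF red]) auto
        moreover have "m t s = enat k" using k m_sym[OF st(1,2)] by simp
        ultimately show ?thesis
          using reduced_alternating_le[OF st(2,1) st(3)[symmetric]] red by metis
      qed
    qed simp
    then show "b \<in> wd ` ?F" using ys by blast
  qed
qed

text \<open>At the first length i < k where reducedness is lost in the next step, the element
  spelled so far is shortened both by its last letter and by the letter that would follow.
  \<open>dihedral_longest\<close> then gives m(s,t) = i, a contradiction.\<close>

lemma reduced_alternating:
  assumes st: "s \<in> S" "t \<in> S" "s \<noteq> t" and k: "m s t = enat k"
  shows "reduced (alternating k s t)"
proof (rule ccontr)
  assume nr: "\<not> reduced (alternating k s t)"
  have S: "set (alternating i x y) \<subseteq> S" if "{x, y} = {s, t}" for i x y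
    using alternating_set[of i x y] st that by auto
  have "\<exists>i<k. \<not> reduced (alternating (Suc i) s t) \<and> reduced (alternating i s t)"
  proof -
    have "reduced (alternating 0 s t)" by (simp add: reduced_def)
    then obtain i where "reduced (alternating i s t)" "\<not> reduced (alternating (Suc i) s t)" "Suc i \<le> k"
      using nr by (induction k) (auto simp: le_Suc_eq)
    then show ?thesis using Suc_le_lessD by blast
  qed
  then obtain i where i: "i < k" "\<not> reduced (alternating (Suc i) s t)" "reduced (alternating i s t)" by blast
  \<comment> \<open>\<open>?x\<close> is the letter that comes after i letters, \<open>?y\<close>
    the last of the i letters.\<close>
  let ?x = "if even i then s else t" and ?y = "if even i then t else s"
  let ?c = "wd (alternating i s t)"
  have xy: "?x \<in> S" "?y \<in> S" "{?x, ?y} = {s, t}" "?x \<noteq> ?y" using st by auto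
  have c: "?c \<in> carrier W" using S[of s t] by simp
  have cpar: "?c \<in> parabolic S m {s, t}"
    using parabolic_iff[of "{s, t}"] alternating_set[of i s t] st by blast
  have lc: "len ?c = i" using reducedD(2)[OF i(3)] by simp
  have "len (?c \<cdot> gen ?x) \<noteq> Suc i"
    using i(2) S[of s t "Suc i"] S[of s t i] xy unfolding alternating_Suc_right by (auto simp: reduced_def)
  then have dx: "len (?c \<cdot> gen ?x) < len ?c"
    using len_mult_gen[OF c xy(1)] lc by auto
  have i0: "0 < i"
  proof (rule ccontr)
    assume "\<not> 0 < i"
    then show False using dx lc by simp
  qed
  then obtain i' where i': "i = Suc i'" by (cases i) auto
  have "?c = wd (alternating i' s t) \<cdot> gen ?y"
    using S[of s t i'] xy unfolding i' alternating_Suc_right by auto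
  then have "?c \<cdot> gen ?y = wd (alternating i' s t)"
    using S[of s t i'] xy by (simp add: W.m_assoc)
  then have dy: "len (?c \<cdot> gen ?y) < len ?c"
    using len_wd_le[of "alternating i' s t"] S[of s t i'] lc i' by simp
  have "m ?x ?y = enat i"
    using dihedral_longest[OF xy(1,2,4) _ dx dy] cpar xy(3) lc by metis
  then have "m s t = enat i" using m_sym[OF st(1,2)] by (auto split: if_splits)
  then show False using k i(1) by simp
qed

end

section \<open>The Salvetti complex\<close>

locale salvetti_system = coxeter_system S m for S :: "'s set" and m :: "'s \<Rightarrow> 's \<Rightarrow> enat" +
  assumes finite_S: "finite S"
begin

abbreviation "vertices \<equiv> sal_vertices S m"
abbreviation "sle \<equiv> sal_le S m"
abbreviation "K \<equiv> derived_complex vertices sle"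
abbreviation "spherical \<equiv> spherical_subsets S m"

lemma sphericalD:
  assumes "P \<in> spherical"
  shows "P \<subseteq> S" "finite (parabolic S m P)"
  using assms by (auto simp: spherical_subsets_def)

lemma spherical_small:
  "{} \<in> spherical" "s \<in> S \<Longrightarrow> {s} \<in> spherical"
  "s \<in> S \<Longrightarrow> t \<in> S \<Longrightarrow> s \<noteq> t \<Longrightarrow> m s t = enat k \<Longrightarrow> {s, t} \<in> spherical"
  using finite_parabolic_empty finite_parabolic_single finite_parabolic_pair
  by (auto simp: spherical_subsets_def)

lemma vertices_iff: "(u, P) \<in> vertices \<longleftrightarrow> u \<in> carrier W \<and> P \<in> spherical"
  by (simp add: sal_vertices_def)

lemma le_iff:
  "sle (u, P) (v, Q) \<longleftrightarrow> P \<subseteq> Q \<and> winv v \<cdot> u \<in> parabolic S m Q \<and>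
     coset_minimal S m (winv v \<cdot> u) P"
  by (simp add: sal_le_def Let_def)

lemma le_refl: "x \<in> vertices \<Longrightarrow> sle x x"
  by (cases x) (auto simp: le_iff vertices_iff parabolic_one sphericalD coset_minimal_one)

lemma len_eq_0: "w \<in> carrier W \<Longrightarrow> len w = 0 \<Longrightarrow> w = \<one>\<^bsub>W\<^esub>"
  using reduced_word_exists[of w] by auto

text \<open>An element of W_P that is shortest in its coset of W_P has length 0. This keeps
  different vertices of equal type out of a common simplex and is reused to show that the action is
  free.\<close>

lemma le_same:
  assumes "x \<in> vertices" "y \<in> vertices" "sle x y" "snd x = snd y"
  shows "x = y"
proof -
  obtain u P v where xy: "x = (u, P)" "y = (v, P)" using assms(4) by (cases x, cases y) auto
  have uv: "u \<in> carrier W" "v \<in> carrier W" "P \<subseteq> S"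
    using assms xy by (auto simp: vertices_iff sphericalD)
  let ?d = "winv v \<cdot> u"
  have d: "?d \<in> carrier W" using uv by simp
  have "winv ?d \<in> parabolic S m P"
    using assms(3) xy parabolic_inv[OF uv(3)] by (simp add: le_iff)
  then have "len ?d \<le> len (?d \<cdot> winv ?d)"
    using assms(3) unfolding xy le_iff coset_minimal_iff by blast
  then have "len ?d = 0" unfolding W.r_inv[OF d] by simp
  then have "?d = \<one>\<^bsub>W\<^esub>" using len_eq_0[OF d] by simp
  then have "v \<cdot> ?d = v" using uv by simp
  then show ?thesis using uv xy by (simp add: W.m_assoc)
qed

lemma le_snd: "sle x y \<Longrightarrow> snd x \<subseteq> snd y"
  by (cases x, cases y) (simp add: le_iff)

lemma le_antisym: "x \<in> vertices \<Longrightarrow> y \<in> vertices \<Longrightarrow> sle x y \<Longrightarrow> sle y x \<Longrightarrow> x = y"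
  by (rule le_same) (auto dest: le_snd)

lemma KD:
  assumes "\<sigma> \<in> K" "x \<in> \<sigma>" "y \<in> \<sigma>"
  shows "x \<in> vertices" "sle x y \<or> sle y x"
  using assms by (auto simp: derived_complex_def)

lemma K_edge: "x \<in> vertices \<Longrightarrow> y \<in> vertices \<Longrightarrow> sle x y \<Longrightarrow> {x, y} \<in> K"
  by (auto simp: derived_complex_def le_refl)

lemma K_triangle:
  "x \<in> vertices \<Longrightarrow> y \<in> vertices \<Longrightarrow> z \<in> vertices \<Longrightarrow> sle x y \<Longrightarrow> sle y z \<Longrightarrow> sle x z \<Longrightarrow> {x, y, z} \<in> K"
  by (auto simp: derived_complex_def le_refl)

lemma le_bottom:
  assumes "winv v \<cdot> u \<in> parabolic S m Q" "u \<in> carrier W" "v \<in> carrier W"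
  shows "sle (u, {}) (v, Q)"
  using assms by (simp add: le_iff coset_minimal_empty)

text \<open>A comparable vertex is determined by a spherical subset together with an element of a
  finite parabolic subgroup, and a finite \<open>S\<close> has finitely many subsets.\<close>

lemma finite_neighbours:
  assumes "x \<in> vertices"
  shows "finite {y \<in> vertices. sle x y \<or> sle y x}"
proof -
  obtain u P where x: "x = (u, P)" "u \<in> carrier W" "P \<in> spherical"
    using assms by (cases x) (auto simp: vertices_iff)
  have fin: "finite spherical"
    using finite_S by (intro finite_subset[of spherical "Pow S"]) (auto simp: spherical_subsets_def)
  let ?N = "(\<Union>Q\<in>spherical. (\<lambda>d. (u \<cdot> winv d, Q)) ` parabolic S m Q) \<union>
    (\<Union>Q\<in>spherical. (\<lambda>d. (u \<cdot> d, Q)) ` parabolic S m P)"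
  have "finite ?N" using fin x by (auto dest: sphericalD)
  moreover have "{y \<in> vertices. sle x y \<or> sle y x} \<subseteq> ?N"
  proof
    fix y assume y: "y \<in> {y \<in> vertices. sle x y \<or> sle y x}"
    obtain v Q where vQ: "y = (v, Q)" "v \<in> carrier W" "Q \<in> spherical"
      using y by (cases y) (auto simp: vertices_iff)
    have 1: "v = u \<cdot> winv (winv v \<cdot> u)"
      using x vQ by (simp add: W.inv_mult_group)
    have 2: "v = u \<cdot> (winv u \<cdot> v)"
      using x vQ by simp
    from y consider "winv v \<cdot> u \<in> parabolic S m Q" | "winv u \<cdot> v \<in> parabolic S m P"
      by (auto simp: x vQ le_iff)
    then show "y \<in> ?N"
    proof cases
      case 1
      have "y = (u \<cdot> winv (winv v \<cdot> u), Q)"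
        unfolding vQ(1) using \<open>v = u \<cdot> winv (winv v \<cdot> u)\<close> by simp
      then show ?thesis using 1 vQ(3) by blast
    next
      case 2
      have "y = (u \<cdot> (winv u \<cdot> v), Q)"
        unfolding vQ(1) using \<open>v = u \<cdot> (winv u \<cdot> v)\<close> by simp
      then show ?thesis using 2 vQ(3) by blast
    qed
  qed
  ultimately show ?thesis by (rule rev_finite_subset)
qed

lemma lf_complex_K: "lf_complex K"
proof
  show "\<sigma> \<in> K \<Longrightarrow> finite \<sigma>" for \<sigma> by (simp add: derived_complex_def)
  show "\<sigma> \<in> K \<Longrightarrow> \<tau> \<subseteq> \<sigma> \<Longrightarrow> \<tau> \<noteq> {} \<Longrightarrow> \<tau> \<in> K" for \<sigma> \<tau>
    unfolding derived_complex_def by (auto intro: finite_subset)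
  fix x
  show "finite {\<sigma> \<in> K. x \<in> \<sigma>}"
  proof (cases "x \<in> vertices")
    case True
    have "{\<sigma> \<in> K. x \<in> \<sigma>} \<subseteq> Pow {y \<in> vertices. sle x y \<or> sle y x}"
      by (auto dest: KD)
    then show ?thesis using finite_neighbours[OF True] by (simp add: finite_subset)
  next
    case False
    then have "{\<sigma> \<in> K. x \<in> \<sigma>} = {}" by (auto dest: KD)
    then show ?thesis by (simp only: finite.emptyI)
  qed
qed

section \<open>The edge cocycle with values in the Artin group\<close>

definition descent :: "'s sal_vertex \<Rightarrow> 's sal_vertex \<Rightarrow> 's gword set" where
  "descent x y = lift (winv (fst y) \<cdot> fst x)"

text \<open>Going down contributes the lift of the relative position, going up its inverse. On the
  way from (w, {}) over (w, {s}) to (ws, {}) the labels are therefore 1 and the Artin generator of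
  s.\<close>

definition edge_label :: "'s sal_vertex \<Rightarrow> 's sal_vertex \<Rightarrow> 's gword set" where
  "edge_label x y = (if sle x y then inv\<^bsub>A\<^esub> (descent x y) else descent y x)"

lemma vertices_fst: "x \<in> vertices \<Longrightarrow> fst x \<in> carrier W"
  by (cases x) (simp add: vertices_iff)

lemma descent_closed [simp]: "x \<in> vertices \<Longrightarrow> y \<in> vertices \<Longrightarrow> descent x y \<in> carrier A"
  unfolding descent_def by (intro lift_closed W.m_closed W.inv_closed vertices_fst)

lemma edge_label_le: "sle x y \<Longrightarrow> edge_label x y = inv\<^bsub>A\<^esub> (descent x y)"
  by (simp add: edge_label_def)

lemma descent_refl: "x \<in> vertices \<Longrightarrow> descent x x = \<one>\<^bsub>A\<^esub>"
  by (simp add: descent_def vertices_fst)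

lemma edge_label_ge:
  assumes "x \<in> vertices" "y \<in> vertices" "sle y x"
  shows "edge_label x y = descent y x"
proof (cases "sle x y")
  case True
  then have "x = y" using le_antisym assms by blast
  then show ?thesis using assms by (simp add: edge_label_def descent_refl)
qed (simp add: edge_label_def)

text \<open>The left factor is minimal for \<open>Q\<close> because y lies below z, and the right
  factor belongs to W_Q because x lies below y. Hence lengths add and \<open>lift\<close> is
  multiplicative.\<close>

lemma descent_mult:
  assumes V: "x \<in> vertices" "y \<in> vertices" "z \<in> vertices" and le: "sle x y" "sle y z"
  shows "descent x z = descent y z \<otimes>\<^bsub>A\<^esub> descent x y"
proof -
  obtain u P v Q w R where xyz: "x = (u, P)" "y = (v, Q)" "z = (w, R)"
    by (cases x, cases y, cases z) auto
  have c: "u \<in> carrier W" "v \<in> carrier W" "w \<in> carrier W" "Q \<subseteq> S"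
    using V by (auto simp: xyz vertices_iff sphericalD)
  let ?a = "winv w \<cdot> v" and ?b = "winv v \<cdot> u"
  have ab: "?a \<in> carrier W" "?b \<in> carrier W" "?a \<cdot> ?b = winv w \<cdot> u"
    using c by (simp_all add: W.m_assoc)
  have "len (?a \<cdot> ?b) = len ?a + len ?b"
    using le by (intro len_minimal_mult[OF c(4) ab(1)]) (auto simp: xyz le_iff)
  from lift_mult[OF ab(1,2) this] show ?thesis
    by (simp add: descent_def xyz ab(3))
qed

sublocale sal: cocycle_complex K A edge_label
proof (intro cocycle_complex.intro lf_complex_K A.is_group cocycle_complex_axioms.intro)
  fix \<sigma> x y
  assume "\<sigma> \<in> K" "x \<in> \<sigma>" "y \<in> \<sigma>"
  then have "x \<in> vertices" "y \<in> vertices" by (auto dest: KD)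
  then show "edge_label x y \<in> carrier A" by (simp add: edge_label_def)
next
  fix \<sigma> x y z
  assume \<sigma>: "\<sigma> \<in> K" "x \<in> \<sigma>" "y \<in> \<sigma>" "z \<in> \<sigma>"
  have V: "x \<in> vertices" "y \<in> vertices" "z \<in> vertices" using \<sigma> by (auto dest: KD)
  note c = descent_closed[OF V(1,2)] descent_closed[OF V(2,1)] descent_closed[OF V(2,3)]
    descent_closed[OF V(3,2)] descent_closed[OF V(1,3)] descent_closed[OF V(3,1)]
  have cancel: "inv\<^bsub>A\<^esub> a \<otimes>\<^bsub>A\<^esub> (a \<otimes>\<^bsub>A\<^esub> b) = b" "a \<otimes>\<^bsub>A\<^esub> (inv\<^bsub>A\<^esub> a \<otimes>\<^bsub>A\<^esub> b) = b"
    if "a \<in> carrier A" "b \<in> carrier A" for a b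
    using that by (simp_all flip: A.m_assoc)
  \<comment> \<open>Pairwise comparability by itself admits cyclic triples. Their types contain each
    other in a circle, so the types coincide and the three vertices collapse into one.\<close>
  have cyc: "a = b \<and> b = c" if "a \<in> vertices" "b \<in> vertices" "c \<in> vertices" "sle a b" "sle b c" "sle c a" for a b c
  proof -
    have "snd a \<subseteq> snd b" "snd b \<subseteq> snd c" "snd c \<subseteq> snd a"
      using le_snd[OF that(4)] le_snd[OF that(5)] le_snd[OF that(6)] .
    then have "snd a = snd b" "snd b = snd c" by auto
    then show ?thesis using le_same that by metis
  qed
  \<comment> \<open>Apart from the two cycles, every pattern is a chain, and the identity is
    \<open>descent_mult\<close> for that chain with some labels moved to the other side.\<close>
  consider (xyz) "sle x y" "sle y z" "sle x z" | (c1) "sle x y" "sle y z" "sle z x"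
    | (xzy) "sle x y" "sle z y" "sle x z" | (zxy) "sle x y" "sle z y" "sle z x"
    | (yxz) "sle y x" "sle y z" "sle x z" | (yzx) "sle y x" "sle y z" "sle z x"
    | (c2) "sle y x" "sle z y" "sle x z" | (zyx) "sle y x" "sle z y" "sle z x"
    using KD(2)[OF \<sigma>(1,2,3)] KD(2)[OF \<sigma>(1,3,4)] KD(2)[OF \<sigma>(1,2,4)] by blast
  then show "edge_label x z = edge_label x y \<otimes>\<^bsub>A\<^esub> edge_label y z"
  proof cases
    case xyz
    then show ?thesis
      using descent_mult[OF V xyz(1,2)] c by (simp add: edge_label_le A.inv_mult_group)
  next
    case c1
    then have "x = y" "y = z" using cyc[OF V] by auto
    then show ?thesis using V le_refl[OF V(1)] by (simp add: edge_label_le descent_refl)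
  next
    case xzy
    then show ?thesis
      using descent_mult[OF V(1,3,2) xzy(3,2)] c V
      by (simp add: edge_label_le edge_label_ge A.inv_mult_group A.m_assoc)
  next
    case zxy
    then show ?thesis
      using descent_mult[OF V(3,1,2) zxy(3,1)] c V by (simp add: edge_label_le edge_label_ge cancel)
  next
    case yxz
    then show ?thesis
      using descent_mult[OF V(2,1,3) yxz(1,3)] c V
      by (simp add: edge_label_le edge_label_ge A.inv_mult_group cancel)
  next
    case yzx
    then show ?thesis
      using descent_mult[OF V(2,3,1) yzx(2,3)] c V
      by (simp add: edge_label_le edge_label_ge A.m_assoc)
  next
    case c2
    then have "x = z" "z = y" using cyc[OF V(1,3,2)] by auto
    then show ?thesis using V le_refl[OF V(1)] by (simp add: edge_label_le descent_refl)
  next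
    case zyx
    then show ?thesis
      using descent_mult[OF V(3,2,1) zyx(2,1)] c V by (simp add: edge_label_ge)
  qed
qed

lemma salvetti_eq: "salvetti S m = sal.X"
  unfolding salvetti_def by (rule sal.realization_eq)

section \<open>Words as edge paths\<close>

abbreviation pt :: "'s sal_vertex \<Rightarrow> 's sal_vertex \<Rightarrow> real" where
  "pt \<equiv> vertex_point"

definition edge :: "'s sal_vertex \<Rightarrow> 's sal_vertex \<Rightarrow> real \<Rightarrow> 's sal_vertex \<Rightarrow> real" where
  "edge x y = segment (pt x) (pt y)"

definition ev :: "'s gword \<Rightarrow> 's gword set" where
  "ev = eval_word W gen"

definition gen_path :: "'s gword set \<Rightarrow> 's \<Rightarrow> real \<Rightarrow> 's sal_vertex \<Rightarrow> real" where
  "gen_path w s = path_join (edge (w, {}) (w, {s})) (edge (w, {s}) (w \<cdot> gen s, {}))"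

text \<open>The two letters of s give different routes from x(w) to x(ws), one through (w, {s}) and
  the other through (ws, {s}). Together they form a circle around which the square of the Artin
  generator is spelled.\<close>

definition letter_path :: "'s gword set \<Rightarrow> 's \<times> bool \<Rightarrow> real \<Rightarrow> 's sal_vertex \<Rightarrow> real" where
  "letter_path w = (\<lambda>(s, b). if b then gen_path w s else path_rev (gen_path (w \<cdot> gen s) s))"

primrec word_path :: "'s gword set \<Rightarrow> 's gword \<Rightarrow> real \<Rightarrow> 's sal_vertex \<Rightarrow> real" where
  "word_path w [] = (\<lambda>_. pt (w, {}))"
| "word_path w (x # u) = path_join (letter_path w x) (word_path (w \<cdot> gen (fst x)) u)"

lemma edge_ends [simp]: "edge x y 0 = pt x" "edge x y 1 = pt y"
  by (simp_all add: edge_def)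

lemma edge_rev [simp]: "path_rev (edge x y) = edge y x"
  by (simp add: edge_def)

lemma pathin_edge: "{x, y} \<in> K \<Longrightarrow> pathin sal.X (edge x y)"
  unfolding edge_def by (rule sal.pathin_segment) (auto intro: sal.vertex_point_geom)

lemma triangle_path:
  assumes "{x, y, z} \<in> K"
  shows "path_homotopic sal.X (path_join (edge x y) (edge y z)) (edge x z)"
  unfolding edge_def
  by (rule sal.triangle_homotopic[OF assms]) (auto intro: sal.vertex_point_geom[OF assms])

lemma ev_simps [simp]:
  "ev [] = \<one>\<^bsub>W\<^esub>" "s \<in> S \<Longrightarrow> ev ((s, b) # u) = gen s \<cdot> ev u"
  by (auto simp: ev_def eval_word_def)

lemma gen_Pi: "gen \<in> S \<rightarrow> carrier W"
  by auto

lemma ev_closed [simp]: "u \<in> lists (S \<times> UNIV) \<Longrightarrow> ev u \<in> carrier W"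
  unfolding ev_def by (rule eval_word_closed[OF group_coxeter_group gen_Pi])

lemma ev_append [simp]:
  "u \<in> lists (S \<times> UNIV) \<Longrightarrow> v \<in> lists (S \<times> UNIV) \<Longrightarrow> ev (u @ v) = ev u \<cdot> ev v"
  unfolding ev_def by (rule eval_word_append[OF group_coxeter_group gen_Pi])

lemma ev_pos_word: "set ss \<subseteq> S \<Longrightarrow> ev (pos_word ss) = wd ss"
  unfolding ev_def by (rule eval_word_wd)

lemma ev_artin_rel: "(u, v) \<in> A_rel \<Longrightarrow> eval_word W gen u = eval_word W gen v"
proof -
  assume "(u, v) \<in> A_rel"
  then obtain s t k where *: "s \<in> S" "t \<in> S" "s \<noteq> t" "m s t = enat k"
    "u = pos_word (alternating k s t)" "v = pos_word (alternating k t s)"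
    unfolding artin_relations_def pos_word_alternating by blast
  then have "set (alternating k s t) \<subseteq> S" "set (alternating k t s) \<subseteq> S"
    using alternating_set[of k s t] alternating_set[of k t s] by auto
  then show ?thesis
    using wd_alternating_eq[OF *(1-4)] by (simp add: * eval_word_wd)
qed

lemma ev_pres_eq: "pres_eq S A_rel u v \<Longrightarrow> ev u = ev v"
  unfolding ev_def by (rule eval_word_pres_eq[OF group_coxeter_group gen_Pi ev_artin_rel])

lemma vertex_small:
  "w \<in> carrier W \<Longrightarrow> (w, {}) \<in> vertices" "w \<in> carrier W \<Longrightarrow> s \<in> S \<Longrightarrow> (w, {s}) \<in> vertices"
  by (simp_all add: vertices_iff spherical_small)

lemma le_gen:
  assumes "w \<in> carrier W" "s \<in> S"
  shows "sle (w, {}) (w, {s})" "sle (w \<cdot> gen s, {}) (w, {s})"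
  using assms parabolic_one[of "{s}"] parabolic_gen[of "{s}" s] by (auto intro!: le_bottom)

lemma pathin_gen_edges:
  assumes "w \<in> carrier W" "s \<in> S"
  shows "pathin sal.X (edge (w, {}) (w, {s}))" "pathin sal.X (edge (w, {s}) (w \<cdot> gen s, {}))"
proof -
  have "{(w, {}), (w, {s})} \<in> K" "{(w \<cdot> gen s, {}), (w, {s})} \<in> K"
    using assms by (auto intro!: K_edge le_gen vertex_small)
  then show "pathin sal.X (edge (w, {}) (w, {s}))" "pathin sal.X (edge (w, {s}) (w \<cdot> gen s, {}))"
    by (auto intro!: pathin_edge simp: insert_commute)
qed

lemma gen_path:
  assumes "w \<in> carrier W" "s \<in> S"
  shows "pathin sal.X (gen_path w s)" "gen_path w s 0 = pt (w, {})" "gen_path w s 1 = pt (w \<cdot> gen s, {})"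
  using pathin_gen_edges[OF assms] by (auto simp: gen_path_def intro!: pathin_join)

lemma letter_path:
  assumes "w \<in> carrier W" "s \<in> S"
  shows "pathin sal.X (letter_path w (s, b))" "letter_path w (s, b) 0 = pt (w, {})"
    "letter_path w (s, b) 1 = pt (w \<cdot> gen s, {})"
  using assms gen_path[OF assms] gen_path[of "w \<cdot> gen s" s]
  by (auto simp: letter_path_def W.m_assoc intro!: pathin_rev)

lemma word_path:
  assumes "u \<in> lists (S \<times> UNIV)" "w \<in> carrier W"
  shows "pathin sal.X (word_path w u)" "word_path w u 0 = pt (w, {})" "word_path w u 1 = pt (w \<cdot> ev u, {})"
proof -
  have "pathin sal.X (word_path w u) \<and> word_path w u 0 = pt (w, {}) \<and> word_path w u 1 = pt (w \<cdot> ev u, {})"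
    using assms
  proof (induction u arbitrary: w)
    case Nil
    have "{(w, {}), (w, {})} \<in> K" using Nil by (intro K_edge le_refl vertex_small) auto
    then show ?case
      using Nil sal.vertex_point_geom[of "{(w, {})}" "(w, {})"] by (auto intro: sal.geomI)
  next
    case (Cons x u)
    obtain s b where x: "x = (s, b)" by (cases x)
    then show ?case
      using Cons letter_path[of w s b] by (auto simp: W.m_assoc intro!: pathin_join)
  qed
  then show "pathin sal.X (word_path w u)" "word_path w u 0 = pt (w, {})" "word_path w u 1 = pt (w \<cdot> ev u, {})"
    by auto
qed

lemma word_path_append:
  assumes "u \<in> lists (S \<times> UNIV)" "v \<in> lists (S \<times> UNIV)" "w \<in> carrier W"
  shows "path_homotopic sal.X (word_path w (u @ v)) (path_join (word_path w u) (word_path (w \<cdot> ev u) v))"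
  using assms(1,3)
proof (induction u arbitrary: w)
  case Nil
  then show ?case
    using assms(2) word_path[of v w] path_homotopic_lid[of sal.X "word_path w v" "pt (w, {})"]
    by (simp add: path_homotopic_sym)
next
  case (Cons x u)
  obtain s b where x: "x = (s, b)" "s \<in> S" using Cons by (cases x) auto
  have u: "u \<in> lists (S \<times> UNIV)" using Cons by simp
  let ?w = "w \<cdot> gen s"
  have w: "?w \<in> carrier W" using Cons.prems x by simp
  note l = letter_path[OF Cons.prems x(2), of b] and p = word_path[OF u w]
    and q = word_path[OF assms(2), of "?w \<cdot> ev u"]
  have "path_homotopic sal.X (path_join (letter_path w x) (word_path ?w (u @ v)))
      (path_join (letter_path w x) (path_join (word_path ?w u) (word_path (?w \<cdot> ev u) v)))"
    using l Cons.IH[OF w] u assms(2) w word_path[of "u @ v" ?w]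
    by (intro path_homotopic_join path_homotopic_refl) (auto simp: x)
  also have "path_homotopic sal.X \<dots>
      (path_join (path_join (letter_path w x) (word_path ?w u)) (word_path (?w \<cdot> ev u) v))"
    using l p q u w by (intro path_homotopic_sym[OF path_homotopic_assoc]) (auto simp: x)
  finally show ?case
    using Cons.prems x u by (simp add: W.m_assoc)
qed

text \<open>All edges of the path of a reduced word in a finite parabolic subgroup lie below the
  corresponding vertex, so the path can be contracted through that vertex.\<close>

lemma word_path_cone:
  assumes Q: "Q \<in> spherical" and v: "v \<in> carrier W"
    and ys: "reduced ys" "set ys \<subseteq> Q"
  shows "path_homotopic sal.X (word_path v (pos_word ys))
    (path_join (edge (v, {}) (v, Q)) (edge (v, Q) (v \<cdot> wd ys, {})))"
  using ys
proof (induction ys rule: rev_induct)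
  case Nil
  have "{(v, {}), (v, Q)} \<in> K"
    using v Q by (intro K_edge vertex_small le_bottom) (auto simp: vertices_iff parabolic_one sphericalD)
  from path_homotopic_rinv[OF pathin_edge[OF this]] show ?case
    using v by (simp add: path_homotopic_sym)
next
  case (snoc s ys)
  have QS: "Q \<subseteq> S" using sphericalD[OF Q] by simp
  have s: "s \<in> Q" "s \<in> S" and ys: "set ys \<subseteq> Q" "set ys \<subseteq> S" "reduced ys"
    using snoc.prems QS reduced_append(1)[OF snoc.prems(1)] by auto
  let ?v = "v \<cdot> wd ys"
  let ?z = "(v, Q)" and ?a = "(?v, {})" and ?b = "(?v, {s})" and ?c = "(?v \<cdot> gen s, {})"
  have vc: "?v \<in> carrier W" using v ys by simp
  have V: "(v, {}) \<in> vertices" "?z \<in> vertices" "?a \<in> vertices" "?b \<in> vertices" "?c \<in> vertices"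
    using v vc Q s by (simp_all add: vertices_iff spherical_small)
  have wy: "wd ys \<in> parabolic S m Q" using parabolic_iff[OF QS] ys by blast
  have inv_v: "winv v \<cdot> ?v = wd ys" using v ys by simp
  have le_vz: "sle (v, {}) ?z" using v QS by (intro le_bottom) (simp_all add: parabolic_one)
  have le_az: "sle ?a ?z" using v vc wy inv_v by (intro le_bottom) simp_all
  have le_cz: "sle ?c ?z"
  proof (rule le_bottom)
    have "winv v \<cdot> (?v \<cdot> gen s) = wd ys \<cdot> gen s" using v ys s by (simp add: W.m_assoc)
    then show "winv v \<cdot> (?v \<cdot> gen s) \<in> parabolic S m Q"
      using parabolic_mult[OF wy parabolic_gen[OF QS s(1)]] by simp
  qed (use v vc s in auto)
  \<comment> \<open>Here reducedness enters: appending s lengthens \<open>wd ys\<close>, so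
    \<open>wd ys\<close> is minimal in its coset of the subgroup generated by s.\<close>
  have le_bz: "sle ?b ?z"
  proof -
    have "len (wd ys \<cdot> gen s) = Suc (len (wd ys))"
      using reducedD(2)[OF snoc.prems(1)] reducedD(2)[OF ys(3)] ys s by simp
    then have "coset_minimal S m (wd ys) {s}"
      using s ys parabolic_single by (auto simp: coset_minimal_iff)
    then show ?thesis using s wy inv_v by (simp add: le_iff)
  qed
  note le_ab = le_gen[OF vc s(2)]
  \<comment> \<open>The two edges of the last letter and the apex \<open>?z\<close> span two
    triangles, across which the path is pushed to the apex.\<close>
  have T1: "{?z, ?a, ?b} \<in> K" and T2: "{?z, ?b, ?c} \<in> K"
    using K_triangle[OF V(3,4,2) le_ab(1) le_bz le_az] K_triangle[OF V(5,4,2) le_ab(2) le_bz le_cz]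
    by (simp_all add: insert_commute)
  have P: "pathin sal.X (edge (v, {}) ?z)" "pathin sal.X (edge ?z ?a)" "pathin sal.X (edge ?a ?b)"
    "pathin sal.X (edge ?b ?c)" "pathin sal.X (edge ?z ?b)" "pathin sal.X (edge ?z ?c)"
    using K_edge[OF V(1,2) le_vz] K_edge[OF V(3,2) le_az] K_edge[OF V(3,4) le_ab(1)]
      K_edge[OF V(5,4) le_ab(2)] K_edge[OF V(4,2) le_bz] K_edge[OF V(5,2) le_cz]
    by (auto intro!: pathin_edge simp: insert_commute)
  have W': "pos_word ys \<in> lists (S \<times> UNIV)" "[(s, True)] \<in> lists (S \<times> UNIV)" using ys s by simp_all
  have "path_homotopic sal.X (word_path v (pos_word (ys @ [s])))
     (path_join (word_path v (pos_word ys)) (word_path ?v [(s, True)]))"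
    using word_path_append[OF W' v] ys by (simp add: ev_pos_word)
  also have "path_homotopic sal.X \<dots>
     (path_join (path_join (edge (v, {}) ?z) (edge ?z ?a)) (path_join (edge ?a ?b) (edge ?b ?c)))"
  proof (rule path_homotopic_join)
    show "path_homotopic sal.X (word_path v (pos_word ys)) (path_join (edge (v, {}) ?z) (edge ?z ?a))"
      by (rule snoc.IH[OF ys(3,1)])
    show "path_homotopic sal.X (word_path ?v [(s, True)]) (path_join (edge ?a ?b) (edge ?b ?c))"
      using path_homotopic_rid[OF gen_path(1,3)[OF vc s(2)]]
      by (simp add: letter_path_def gen_path_def)
    show "word_path v (pos_word ys) 1 = word_path ?v [(s, True)] 0"
      using word_path[OF W'(1) v] word_path[OF W'(2) vc] ys by (simp add: ev_pos_word del: word_path.simps)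
  qed
  also have "path_homotopic sal.X \<dots>
     (path_join (edge (v, {}) ?z) (path_join (edge ?z ?a) (path_join (edge ?a ?b) (edge ?b ?c))))"
    using P by (intro path_homotopic_assoc pathin_join) auto
  also have "path_homotopic sal.X \<dots>
     (path_join (edge (v, {}) ?z) (path_join (path_join (edge ?z ?a) (edge ?a ?b)) (edge ?b ?c)))"
    by (rule path_homotopic_join[OF path_homotopic_refl[OF P(1)] path_homotopic_sym[OF path_homotopic_assoc]])
      (use P in auto)
  also have "path_homotopic sal.X \<dots> (path_join (edge (v, {}) ?z) (path_join (edge ?z ?b) (edge ?b ?c)))"
    by (rule path_homotopic_join[OF path_homotopic_refl[OF P(1)]
          path_homotopic_join[OF triangle_path[OF T1] path_homotopic_refl[OF P(4)]]]) auto
  also have "path_homotopic sal.X \<dots> (path_join (edge (v, {}) ?z) (edge ?z ?c))"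
    by (rule path_homotopic_join[OF path_homotopic_refl[OF P(1)] triangle_path[OF T2]]) auto
  finally show ?case
    using v ys s by (simp add: W.m_assoc)
qed

section \<open>Word paths depend only on the class in the Artin group\<close>

definition inv_word :: "'s gword \<Rightarrow> 's gword" where
  "inv_word u = rev (map (\<lambda>(s, b). (s, \<not> b)) u)"

lemma inv_word_lists: "u \<in> lists (S \<times> UNIV) \<Longrightarrow> inv_word u \<in> lists (S \<times> UNIV)"
  by (auto simp: inv_word_def in_lists_conv_set)

lemma inv_word_pres_eq: "u \<in> lists (S \<times> UNIV) \<Longrightarrow> pres_eq S A_rel (inv_word u @ u) []"
  unfolding inv_word_def by (rule pres_eq_inverse)

lemma word_path_cancel:
  assumes w: "w \<in> carrier W" and s: "s \<in> S"
  shows "path_homotopic sal.X (word_path w [(s, b), (s, \<not> b)]) (word_path w [])"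
proof -
  let ?v = "w \<cdot> gen s"
  have v: "?v \<in> carrier W" "?v \<cdot> gen s = w" using w s by (simp_all add: W.m_assoc)
  have rev: "letter_path ?v (s, \<not> b) = path_rev (letter_path w (s, b))"
    using v by (simp add: letter_path_def)
  note l = letter_path[OF w s, of b] and l' = letter_path[OF v(1) s, of "\<not> b"]
  have "path_homotopic sal.X (path_join (letter_path ?v (s, \<not> b)) (\<lambda>_. pt (w, {}))) (letter_path ?v (s, \<not> b))"
    using l' v by (intro path_homotopic_rid) auto
  then have "path_homotopic sal.X (word_path w [(s, b), (s, \<not> b)])
      (path_join (letter_path w (s, b)) (letter_path ?v (s, \<not> b)))"
    using l l' v by (auto intro!: path_homotopic_join path_homotopic_refl)
  also have "path_homotopic sal.X \<dots> (\<lambda>_. pt (w, {}))"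
    unfolding rev using path_homotopic_rinv[OF l(1)] l(2) by simp
  finally show ?thesis by simp
qed

text \<open>Congruence and cancellation follow from the groupoid laws. For a braid relation both
  alternating words are reduced and spell the same element, so both paths contract to the same route
  through the vertex of type {s, t}.\<close>

lemma word_path_pres_eq:
  assumes "pres_eq S A_rel u v" "w \<in> carrier W"
  shows "path_homotopic sal.X (word_path w u) (word_path w v)"
  using assms
proof (induction arbitrary: w rule: pres_eq.induct)
  case (refl u)
  then show ?case using word_path(1) by blast
next
  case (sym u v)
  then show ?case using path_homotopic_sym by blast
next
  case (trans u v x)
  then show ?case using path_homotopic_trans by blast
next
  case (append u u' v v')
  have l: "u \<in> lists (S \<times> UNIV)" "u' \<in> lists (S \<times> UNIV)" "v \<in> lists (S \<times> UNIV)" "v' \<in> lists (S \<times> UNIV)"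
    using pres_eq_lists[OF append.hyps(1)] pres_eq_lists[OF append.hyps(2)] by auto
  have e: "ev u' = ev u" using ev_pres_eq[OF append.hyps(1)] by simp
  have "path_homotopic sal.X (word_path w (u @ v)) (path_join (word_path w u) (word_path (w \<cdot> ev u) v))"
    by (rule word_path_append[OF l(1,3) append.prems])
  also have "path_homotopic sal.X \<dots> (path_join (word_path w u') (word_path (w \<cdot> ev u) v'))"
    using append.IH append.prems l word_path[OF l(1) append.prems] word_path[OF l(3), of "w \<cdot> ev u"]
    by (intro path_homotopic_join) simp_all
  also have "path_homotopic sal.X \<dots> (word_path w (u' @ v'))"
    using path_homotopic_sym[OF word_path_append[OF l(2,4) append.prems]] by (simp add: e)
  finally show ?case .
next
  case (cancel s b)
  then show ?case by (intro word_path_cancel)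
next
  case (rel u v)
  then obtain s t k where st: "s \<in> S" "t \<in> S" "s \<noteq> t" "m s t = enat k"
    and uv: "u = pos_word (alternating k s t)" "v = pos_word (alternating k t s)"
    unfolding artin_relations_def pos_word_alternating by blast
  have ts: "m t s = enat k" using st m_sym by simp
  note Q = spherical_small(3)[OF st]
  have "path_homotopic sal.X (word_path w u) (path_join (edge (w, {}) (w, {s, t}))
      (edge (w, {s, t}) (w \<cdot> wd (alternating k s t), {})))"
    unfolding uv using alternating_set[of k s t]
    by (intro word_path_cone Q rel.prems reduced_alternating[OF st]) auto
  moreover have "path_homotopic sal.X (word_path w v) (path_join (edge (w, {}) (w, {s, t}))
      (edge (w, {s, t}) (w \<cdot> wd (alternating k t s), {})))"
    unfolding uv using alternating_set[of k t s] st(3)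
    by (intro word_path_cone Q rel.prems reduced_alternating[OF st(2,1) _ ts]) auto
  ultimately show ?case
    unfolding wd_alternating_eq[OF st] using path_homotopic_sym path_homotopic_trans by blast
qed

section \<open>Tethering vertices and pushing edge paths down\<close>

definition base :: "'s sal_vertex \<Rightarrow> real \<Rightarrow> 's sal_vertex \<Rightarrow> real" where
  "base x = edge (fst x, {}) x"

lemma base_ends [simp]: "base x 0 = pt (fst x, {})" "base x 1 = pt x"
  by (simp_all add: base_def)

lemma sle_base:
  assumes "x \<in> vertices"
  shows "(fst x, {}) \<in> vertices" "sle (fst x, {}) x"
  using assms by (cases x; auto simp: vertices_iff spherical_small le_iff coset_minimal_one parabolic_one sphericalD)+

lemma pathin_base: "x \<in> vertices \<Longrightarrow> pathin sal.X (base x)"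
  unfolding base_def by (intro pathin_edge K_edge sle_base)

text \<open>The path of a reduced word over \<open>Q\<close> contracts through y, and (u, {}), x, y
  span a simplex; this handles the edge from y down to x. The edge from x up to y is spelled by the
  formal inverse of the same word: a positive word for the inverse element of \<open>W\<close> would
  in general give a different element of \<open>A\<close>.\<close>

lemma edge_word:
  assumes x: "x \<in> vertices" and y: "y \<in> vertices" and xy: "sle x y"
  shows "\<exists>a\<in>lists (S \<times> UNIV). fst y \<cdot> ev a = fst x \<and>
      path_homotopic sal.X (path_join (base y) (edge y x)) (path_join (word_path (fst y) a) (base x))" (is ?up)
    and "\<exists>a\<in>lists (S \<times> UNIV). fst x \<cdot> ev a = fst y \<and>
      path_homotopic sal.X (path_join (base x) (edge x y)) (path_join (word_path (fst x) a) (base y))" (is ?down)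
proof -
  obtain u P v Q where uv: "x = (u, P)" "y = (v, Q)" by (cases x, cases y) auto
  have c: "u \<in> carrier W" "v \<in> carrier W" "Q \<in> spherical" "Q \<subseteq> S"
    using x y by (auto simp: uv vertices_iff sphericalD)
  let ?d = "winv v \<cdot> u" and ?u = "(u, {})"
  have d: "?d \<in> parabolic S m Q" using xy by (simp add: uv le_iff)
  have vd: "v \<cdot> ?d = u" using c by simp
  obtain ys where ys: "set ys \<subseteq> Q" "wd ys = ?d" "length ys = len ?d"
    using parabolic_reduced_word[OF c(4) d] by blast
  then have red: "reduced ys" using c by (auto simp: reduced_def)
  let ?p = "pos_word ys"
  have p: "?p \<in> lists (S \<times> UNIV)" "ev ?p = ?d"
    using ys c(4) by (simp_all add: ev_pos_word subset_trans[OF ys(1)])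
  have up: "?u \<in> vertices" "sle ?u x" "sle ?u y"
    using sle_base[OF x] le_bottom[OF d c(1,2)] by (simp_all add: uv)
  note T = K_triangle[OF up(1) x y up(2) xy up(3)]
  have T': "{y, ?u, x} \<in> K" using T by (simp add: insert_commute)
  have P: "pathin sal.X (base x)" "pathin sal.X (base y)" "pathin sal.X (edge y ?u)" "pathin sal.X (edge ?u y)"
    "pathin sal.X (edge x y)" "pathin sal.X (edge y x)"
    using K_edge[OF up(1) y up(3)] K_edge[OF x y xy] pathin_base[OF x] pathin_base[OF y]
    by (auto intro: pathin_edge simp: insert_commute)
  have E: "base x = edge ?u x" by (simp add: base_def uv)
  have cone: "path_homotopic sal.X (word_path v ?p) (path_join (base y) (edge y ?u))"
    using word_path_cone[OF c(3,2) red ys(1)] c by (simp add: ys(2) base_def uv)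
  have "path_homotopic sal.X (path_join (word_path v ?p) (base x)) (path_join (path_join (base y) (edge y ?u)) (base x))"
    using word_path[OF p(1) c(2)] p(2) vd by (intro path_homotopic_join cone path_homotopic_refl P) (simp add: uv)
  also have "path_homotopic sal.X \<dots> (path_join (base y) (path_join (edge y ?u) (base x)))"
    using P by (intro path_homotopic_assoc) (simp_all add: uv)
  also have "path_homotopic sal.X \<dots> (path_join (base y) (edge y x))"
    unfolding E using T' by (intro path_homotopic_join[OF path_homotopic_refl[OF P(2)] triangle_path]) auto
  finally have 1: "path_homotopic sal.X (path_join (word_path v ?p) (base x)) (path_join (base y) (edge y x))" .
  show ?up
    using p vd path_homotopic_sym[OF 1] by (intro bexI[of _ ?p]) (simp_all add: uv)
  \<comment> \<open>Inserting this inverse word and the word itself in front of the edge from (u,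
    {}) to y allows the cone to be used a second time.\<close>
  let ?a = "inv_word ?p"
  have a: "?a \<in> lists (S \<times> UNIV)" by (rule inv_word_lists[OF p(1)])
  have "ev ?a \<cdot> ?d = \<one>\<^bsub>W\<^esub>"
    using ev_pres_eq[OF inv_word_pres_eq[OF p(1)]] a p by simp
  then have "ev ?a = winv ?d" using a c by (metis W.inv_closed W.inv_equality W.inv_inv W.m_closed ev_closed)
  then have ua: "u \<cdot> ev ?a = v" using c by (simp add: W.inv_mult_group)
  note wa = word_path[OF a c(1)] and wp = word_path[OF p(1) c(2)]
  have const: "path_homotopic sal.X (path_join (word_path u ?a) (word_path v ?p)) (\<lambda>_. pt ?u)"
    using path_homotopic_trans[OF path_homotopic_sym[OF word_path_append[OF a p(1) c(1)]]
        word_path_pres_eq[OF inv_word_pres_eq[OF p(1)] c(1)]] by (simp add: ua)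
  have "path_homotopic sal.X (path_join (base x) (edge x y)) (edge ?u y)"
    unfolding E by (rule triangle_path[OF T])
  also have "path_homotopic sal.X (edge ?u y) (path_join (\<lambda>_. pt ?u) (edge ?u y))"
    using P by (intro path_homotopic_sym[OF path_homotopic_lid]) auto
  also have "path_homotopic sal.X \<dots> (path_join (path_join (word_path u ?a) (word_path v ?p)) (edge ?u y))"
    using P by (intro path_homotopic_join path_homotopic_sym[OF const] path_homotopic_refl) auto
  also have "path_homotopic sal.X \<dots> (path_join (word_path u ?a) (path_join (word_path v ?p) (edge ?u y)))"
    using P wa wp p(2) vd ua by (intro path_homotopic_assoc) auto
  also have "path_homotopic sal.X \<dots> (path_join (word_path u ?a) (path_join (path_join (base y) (edge y ?u)) (edge ?u y)))"
    by (rule path_homotopic_join[OF path_homotopic_refl[OF wa(1)] path_homotopic_join[OF cone path_homotopic_refl[OF P(4)]]])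
      (use wa wp p(2) vd ua in simp_all)
  also have "path_homotopic sal.X \<dots> (path_join (word_path u ?a) (path_join (base y) (path_join (edge y ?u) (edge ?u y))))"
    by (rule path_homotopic_join[OF path_homotopic_refl[OF wa(1)] path_homotopic_assoc])
      (use P wa ua in \<open>simp_all add: uv\<close>)
  also have "path_homotopic sal.X \<dots> (path_join (word_path u ?a) (path_join (base y) (\<lambda>_. pt y)))"
  proof -
    have "path_homotopic sal.X (path_join (edge y ?u) (edge ?u y)) (\<lambda>_. pt y)"
      using path_homotopic_rinv[OF P(3)] by simp
    then show ?thesis
      by (intro path_homotopic_join[OF path_homotopic_refl[OF wa(1)] path_homotopic_join[OF path_homotopic_refl[OF P(2)]]])
        (use wa ua in \<open>simp_all add: uv\<close>)
  qed
  also have "path_homotopic sal.X \<dots> (path_join (word_path u ?a) (base y))"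
    by (rule path_homotopic_join[OF path_homotopic_refl[OF wa(1)] path_homotopic_rid[OF P(2)]])
      (use wa ua in \<open>simp_all add: uv\<close>)
  finally show ?down
    using a ua by (intro bexI[of _ ?a]) (simp_all add: uv)
qed

text \<open>The predicate for \<open>edge_path_induct\<close>. Tethers at both ends let it speak
  about paths between vertices of any type, and when two paths are joined the words are concatenated
  at the common tether.\<close>

definition word_rel :: "'s sal_vertex \<Rightarrow> 's sal_vertex \<Rightarrow> (real \<Rightarrow> 's sal_vertex \<Rightarrow> real) \<Rightarrow> bool" where
  "word_rel x y p \<longleftrightarrow> pathin sal.X p \<and> p 0 = pt x \<and> p 1 = pt y \<and> x \<in> vertices \<and> y \<in> vertices \<and>
     (\<exists>a\<in>lists (S \<times> UNIV). fst x \<cdot> ev a = fst y \<and>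
       path_homotopic sal.X (path_join (base x) p) (path_join (word_path (fst x) a) (base y)))"

lemma word_rel_homotopic:
  assumes "word_rel x y p" "path_homotopic sal.X p q"
  shows "word_rel x y q"
proof -
  have x: "x \<in> vertices" and p: "p 0 = pt x" using assms(1) by (auto simp: word_rel_def)
  have "path_homotopic sal.X (path_join (base x) q) (path_join (base x) p)"
    using p path_homotopic_ends[OF assms(2)]
    by (intro path_homotopic_join path_homotopic_refl pathin_base x path_homotopic_sym[OF assms(2)]) simp
  then have "path_homotopic sal.X (path_join (base x) q) r"
    if "path_homotopic sal.X (path_join (base x) p) r" for r
    using that path_homotopic_trans by blast
  then show ?thesis
    using assms(1) path_homotopic_ends[OF assms(2)] path_homotopic_pathin[OF assms(2)]
    unfolding word_rel_def by auto
qed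

lemma word_rel_join:
  assumes p: "word_rel x y p" and q: "word_rel y z q"
  shows "word_rel x z (path_join p q)"
proof -
  have V: "x \<in> vertices" "y \<in> vertices" "z \<in> vertices"
    and P: "pathin sal.X p" "p 0 = pt x" "p 1 = pt y" "pathin sal.X q" "q 0 = pt y" "q 1 = pt z"
    using p q by (auto simp: word_rel_def)
  obtain a where a: "a \<in> lists (S \<times> UNIV)" "fst x \<cdot> ev a = fst y"
    "path_homotopic sal.X (path_join (base x) p) (path_join (word_path (fst x) a) (base y))"
    using p by (auto simp: word_rel_def)
  obtain b where b: "b \<in> lists (S \<times> UNIV)" "fst y \<cdot> ev b = fst z"
    "path_homotopic sal.X (path_join (base y) q) (path_join (word_path (fst y) b) (base z))"
    using q by (auto simp: word_rel_def)
  note c = vertices_fst[OF V(1)] vertices_fst[OF V(2)] vertices_fst[OF V(3)]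
  note B = pathin_base[OF V(1)] pathin_base[OF V(2)] pathin_base[OF V(3)]
  note wa = word_path[OF a(1) c(1)] and wb = word_path[OF b(1) c(2)]
  have "path_homotopic sal.X (path_join (base x) (path_join p q)) (path_join (path_join (base x) p) q)"
    using B P by (intro path_homotopic_sym[OF path_homotopic_assoc]) auto
  also have "path_homotopic sal.X \<dots> (path_join (path_join (word_path (fst x) a) (base y)) q)"
    using P by (intro path_homotopic_join a(3) path_homotopic_refl) auto
  also have "path_homotopic sal.X \<dots> (path_join (word_path (fst x) a) (path_join (base y) q))"
    using B P wa a(2) by (intro path_homotopic_assoc) auto
  also have "path_homotopic sal.X \<dots> (path_join (word_path (fst x) a) (path_join (word_path (fst y) b) (base z)))"
    using wa a(2) by (intro path_homotopic_join[OF path_homotopic_refl[OF wa(1)] b(3)]) simp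
  also have "path_homotopic sal.X \<dots> (path_join (path_join (word_path (fst x) a) (word_path (fst y) b)) (base z))"
    using B wa wb a(2) b(2) by (intro path_homotopic_sym[OF path_homotopic_assoc]) auto
  also have "path_homotopic sal.X \<dots> (path_join (word_path (fst x) (a @ b)) (base z))"
    using path_homotopic_sym[OF word_path_append[OF a(1) b(1) c(1)]] a(2) b(2) wb B
    by (intro path_homotopic_join path_homotopic_refl) auto
  finally have "path_homotopic sal.X (path_join (base x) (path_join p q)) (path_join (word_path (fst x) (a @ b)) (base z))" .
  moreover have "fst x \<cdot> ev (a @ b) = fst z"
    using a b c by (simp flip: W.m_assoc)
  ultimately show ?thesis
    using P V a(1) b(1) unfolding word_rel_def
    by (intro conjI bexI[of _ "a @ b"] pathin_join) simp_all
qed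

lemma word_rel_edge:
  assumes "{x, y} \<in> K"
  shows "word_rel x y (segment (pt x) (pt y))"
proof -
  have V: "x \<in> vertices" "y \<in> vertices" and le: "sle x y \<or> sle y x"
    using KD[OF assms, of x y] KD(1)[OF assms, of y y] by auto
  have "pathin sal.X (edge x y)" by (rule pathin_edge[OF assms])
  then have "word_rel x y (edge x y)"
    using le edge_word(2)[OF V] edge_word(1)[OF V(2,1)] V unfolding word_rel_def by auto
  then show ?thesis by (simp add: edge_def)
qed

theorem path_homotopic_word_path:
  assumes c: "pathin sal.X c" "c 0 = pt (w, {})" "c 1 = pt (w', {})" and w: "w \<in> carrier W"
  shows "\<exists>a\<in>lists (S \<times> UNIV). w \<cdot> ev a = w' \<and> path_homotopic sal.X c (word_path w a)"
proof -
  have "word_rel (w, {}) (w', {}) c"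
    by (rule sal.edge_path_induct[OF _ _ _ c]) (blast intro: word_rel_homotopic word_rel_join word_rel_edge)+
  \<comment> \<open>At the vertices of type {} the tethers are constant paths.\<close>
  then obtain a where a: "a \<in> lists (S \<times> UNIV)" "w \<cdot> ev a = w'"
    "path_homotopic sal.X (path_join (\<lambda>_. pt (w, {})) c) (path_join (word_path w a) (\<lambda>_. pt (w', {})))"
    by (auto simp: word_rel_def base_def edge_def)
  have "path_homotopic sal.X c (path_join (\<lambda>_. pt (w, {})) c)"
    by (rule path_homotopic_sym[OF path_homotopic_lid[OF c(1,2)]])
  also note a(3)
  also have "path_homotopic sal.X (path_join (word_path w a) (\<lambda>_. pt (w', {}))) (word_path w a)"
    using word_path[OF a(1) w] a(2) by (intro path_homotopic_rid) auto
  finally show ?thesis using a by blast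
qed

section \<open>Homotopic word paths define the same element of the Artin group\<close>

lemma cover_edge:
  assumes K: "{x, y} \<in> K" and a: "\<alpha> \<in> carrier A"
  shows "{(x, \<alpha>), (y, \<alpha> \<otimes>\<^bsub>A\<^esub> edge_label x y)} \<in> sal.cover"
  using sal.sheet_cover[OF K _ a, of x] sal.cocycle_refl[OF K, of x] a by (simp add: sal.sheet_def)

definition lifted_edge :: "'s sal_vertex \<times> 's gword set \<Rightarrow> 's sal_vertex \<times> 's gword set \<Rightarrow> real
    \<Rightarrow> 's sal_vertex \<times> 's gword set \<Rightarrow> real" where
  "lifted_edge x y = segment (vertex_point x) (vertex_point y)"

lemma lifted_edge:
  assumes "{x, y} \<in> sal.cover"
  shows "pathin sal.cover.X (lifted_edge x y)" "lifted_edge x y 0 = vertex_point x" "lifted_edge x y 1 = vertex_point y"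
    "sal.proj \<circ> lifted_edge x y = edge (fst x) (fst y)"
  using sal.cover.pathin_segment[OF assms sal.cover.vertex_point_geom[OF assms] sal.cover.vertex_point_geom[OF assms]]
    sal.proj_edge[OF assms]
  by (auto simp: lifted_edge_def edge_def)

text \<open>The label is 1 on the way up to (w, {s}) and the Artin generator on the way
  down.\<close>

lemma lift_gen_path:
  assumes w: "w \<in> carrier W" and s: "s \<in> S" and \<alpha>: "\<alpha> \<in> carrier A"
  shows "\<exists>c. pathin sal.cover.X c \<and> c 0 = vertex_point ((w, {}), \<alpha>) \<and>
    c 1 = vertex_point ((w \<cdot> gen s, {}), \<alpha> \<otimes>\<^bsub>A\<^esub> artin_gen S m s) \<and> sal.proj \<circ> c = gen_path w s"
proof -
  let ?a = "(w, {})" and ?b = "(w, {s})" and ?c = "(w \<cdot> gen s, {})"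
  have V: "?a \<in> vertices" "?b \<in> vertices" "?c \<in> vertices" using w s by (simp_all add: vertex_small)
  note le = le_gen[OF w s]
  have "edge_label ?a ?b = \<one>\<^bsub>A\<^esub>"
    using le w by (simp add: edge_label_le descent_def)
  then have e1: "{(?a, \<alpha>), (?b, \<alpha>)} \<in> sal.cover"
    using cover_edge[OF K_edge[OF V(1,2) le(1)] \<alpha>] \<alpha> by simp
  have "edge_label ?b ?c = artin_gen S m s"
    using edge_label_ge[OF V(2,3) le(2)] w s by (simp add: descent_def lift_gen)
  moreover have "{?b, ?c} \<in> K" using K_edge[OF V(3,2) le(2)] by (simp add: insert_commute)
  ultimately have e2: "{(?b, \<alpha>), (?c, \<alpha> \<otimes>\<^bsub>A\<^esub> artin_gen S m s)} \<in> sal.cover"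
    using cover_edge[of ?b ?c \<alpha>] \<alpha> by simp
  let ?p = "path_join (lifted_edge (?a, \<alpha>) (?b, \<alpha>)) (lifted_edge (?b, \<alpha>) (?c, \<alpha> \<otimes>\<^bsub>A\<^esub> artin_gen S m s))"
  show ?thesis
    using lifted_edge[OF e1] lifted_edge[OF e2]
    by (intro exI[of _ ?p]) (auto simp: gen_path_def path_join_comp intro!: pathin_join)
qed

abbreviation cls :: "'s gword \<Rightarrow> 's gword set" where
  "cls u \<equiv> pres_class S A_rel u"

lemma cls_letter:
  assumes "s \<in> S"
  shows "cls [(s, True)] = artin_gen S m s" "cls [(s, False)] \<otimes>\<^bsub>A\<^esub> artin_gen S m s = \<one>\<^bsub>A\<^esub>"
proof -
  show 1: "cls [(s, True)] = artin_gen S m s" by (simp add: artin_gen_def pres_gen_def)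
  have "pres_eq S A_rel [(s, False), (s, True)] []"
    using pres_eq.cancel[OF assms, of A_rel False] by simp
  then have "cls ([(s, False)] @ [(s, True)]) = \<one>\<^bsub>A\<^esub>"
    using assms unfolding A_one by (subst pres_class_eq_iff) simp_all
  then show "cls [(s, False)] \<otimes>\<^bsub>A\<^esub> artin_gen S m s = \<one>\<^bsub>A\<^esub>"
    unfolding 1[symmetric] using assms by (subst A_class_mult) simp_all
qed

lemma lift_letter_path:
  assumes w: "w \<in> carrier W" and s: "s \<in> S" and \<alpha>: "\<alpha> \<in> carrier A"
  shows "\<exists>c. pathin sal.cover.X c \<and> c 0 = vertex_point ((w, {}), \<alpha>) \<and>
    c 1 = vertex_point ((w \<cdot> gen s, {}), \<alpha> \<otimes>\<^bsub>A\<^esub> cls [(s, b)]) \<and> sal.proj \<circ> c = letter_path w (s, b)"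
proof (cases b)
  case True
  then show ?thesis
    using lift_gen_path[OF assms] cls_letter(1)[OF s] by (simp add: letter_path_def)
next
  case False
  \<comment> \<open>A negative letter is lifted by reversing a lift of the positive path from ws to
    w; the label \<beta> at its start is fixed by the requirement that it arrive at
    \<alpha>.\<close>
  let ?\<beta> = "\<alpha> \<otimes>\<^bsub>A\<^esub> cls [(s, False)]" and ?v = "w \<cdot> gen s"
  have cl: "cls [(s, False)] \<in> carrier A" "artin_gen S m s \<in> carrier A"
    using s A_class_closed[of "[(s, False)]"] A_class_closed[of "[(s, True)]"] cls_letter(1)[OF s] by auto
  then have \<beta>: "?\<beta> \<in> carrier A" "?\<beta> \<otimes>\<^bsub>A\<^esub> artin_gen S m s = \<alpha>"
    using \<alpha> cls_letter(2)[OF s] by (simp_all add: A.m_assoc)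
  have v: "?v \<in> carrier W" "?v \<cdot> gen s = w" using w s by (simp_all add: W.m_assoc)
  obtain c where c: "pathin sal.cover.X c" "c 0 = vertex_point ((?v, {}), ?\<beta>)"
    "c 1 = vertex_point ((w, {}), \<alpha>)" "sal.proj \<circ> c = gen_path ?v s"
    using lift_gen_path[OF v(1) s \<beta>(1)] unfolding v(2) \<beta>(2) by blast
  show ?thesis
    using c False by (intro exI[of _ "path_rev c"]) (simp add: pathin_rev path_rev_comp letter_path_def)
qed

lemma lift_word_path:
  assumes "u \<in> lists (S \<times> UNIV)" "w \<in> carrier W" "\<alpha> \<in> carrier A"
  shows "\<exists>c. pathin sal.cover.X c \<and> c 0 = vertex_point ((w, {}), \<alpha>) \<and>
    c 1 = vertex_point ((w \<cdot> ev u, {}), \<alpha> \<otimes>\<^bsub>A\<^esub> cls u) \<and> sal.proj \<circ> c = word_path w u"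
  using assms
proof (induction u arbitrary: w \<alpha>)
  case Nil
  have "{(w, {}), (w, {})} \<in> K" using Nil by (intro K_edge le_refl vertex_small)
  from cover_edge[OF this Nil(2)] have e: "{((w, {}), \<alpha>), ((w, {}), \<alpha>)} \<in> sal.cover"
    using sal.cocycle_refl[of "{(w, {}), (w, {})}" "(w, {})"] Nil \<open>{(w, {}), (w, {})} \<in> K\<close> by simp
  show ?case
    using lifted_edge[OF e] Nil
    by (intro exI[of _ "lifted_edge ((w, {}), \<alpha>) ((w, {}), \<alpha>)"]) (simp add: A_one[symmetric] edge_def)
next
  case (Cons x u)
  obtain s b where x: "x = (s, b)" "s \<in> S" using Cons by (cases x) auto
  have u: "u \<in> lists (S \<times> UNIV)" using Cons by simp
  have s: "[(s, b)] \<in> lists (S \<times> UNIV)" using x by simp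
  let ?v = "w \<cdot> gen s" and ?\<beta> = "\<alpha> \<otimes>\<^bsub>A\<^esub> cls [(s, b)]"
  have v: "?v \<in> carrier W" and \<beta>: "?\<beta> \<in> carrier A"
    using Cons.prems x A_class_closed[OF s] by simp_all
  obtain c where c: "pathin sal.cover.X c" "c 0 = vertex_point ((w, {}), \<alpha>)"
    "c 1 = vertex_point ((?v, {}), ?\<beta>)" "sal.proj \<circ> c = letter_path w (s, b)"
    using lift_letter_path[OF Cons.prems(1) x(2) Cons.prems(2)] by blast
  obtain d where d: "pathin sal.cover.X d" "d 0 = vertex_point ((?v, {}), ?\<beta>)"
    "d 1 = vertex_point ((?v \<cdot> ev u, {}), ?\<beta> \<otimes>\<^bsub>A\<^esub> cls u)" "sal.proj \<circ> d = word_path ?v u"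
    using Cons.IH[OF v \<beta>] by blast
  have "cls (x # u) = cls [(s, b)] \<otimes>\<^bsub>A\<^esub> cls u"
    using A_class_mult[OF s u] x by simp
  then have "?\<beta> \<otimes>\<^bsub>A\<^esub> cls u = \<alpha> \<otimes>\<^bsub>A\<^esub> cls (x # u)"
    using Cons.prems A_class_closed[OF s] A_class_closed[OF u] by (simp add: A.m_assoc)
  moreover have "?v \<cdot> ev u = w \<cdot> ev (x # u)"
    using Cons.prems x u by (simp add: W.m_assoc)
  ultimately show ?case
    using c d x(1) by (intro exI[of _ "path_join c d"]) (simp add: pathin_join path_join_comp)
qed

text \<open>Lifts from the same point have homotopic, hence equally ending, paths, and the group
  coordinates of the ends are the two classes.\<close>

theorem word_path_homotopic_imp_cls_eq:
  assumes a: "a \<in> lists (S \<times> UNIV)" and b: "b \<in> lists (S \<times> UNIV)" and w: "w \<in> carrier W"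
    and hom: "path_homotopic sal.X (word_path w a) (word_path w b)"
  shows "cls a = cls b"
proof -
  obtain c where c: "pathin sal.cover.X c" "c 0 = vertex_point ((w, {}), \<one>\<^bsub>A\<^esub>)"
    "c 1 = vertex_point ((w \<cdot> ev a, {}), \<one>\<^bsub>A\<^esub> \<otimes>\<^bsub>A\<^esub> cls a)" "sal.proj \<circ> c = word_path w a"
    using lift_word_path[OF a w A.one_closed] by blast
  obtain d where d: "pathin sal.cover.X d" "d 0 = vertex_point ((w, {}), \<one>\<^bsub>A\<^esub>)"
    "d 1 = vertex_point ((w \<cdot> ev b, {}), \<one>\<^bsub>A\<^esub> \<otimes>\<^bsub>A\<^esub> cls b)" "sal.proj \<circ> d = word_path w b"
    using lift_word_path[OF b w A.one_closed] by blast
  have "path_homotopic sal.cover.X c d"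
    using hom c d by (intro covering_map_lift_homotopy[OF sal.cover_covering_map]) simp_all
  then have "d 1 = c 1" by (rule path_homotopic_ends)
  then show ?thesis
    using c(3) d(3) A_class_closed[OF a] A_class_closed[OF b] by simp
qed

section \<open>The action of the Coxeter group\<close>

abbreviation "act \<equiv> sal_act S m"

definition move :: "'s gword set \<Rightarrow> 's sal_vertex \<Rightarrow> 's sal_vertex" where
  "move w = (\<lambda>(u, P). (w \<cdot> u, P))"

lemma act_def: "act w = realization_map (move w)"
  by (simp add: sal_act_def move_def)

lemma move_vertices: "w \<in> carrier W \<Longrightarrow> x \<in> vertices \<Longrightarrow> move w x \<in> vertices"
  by (cases x) (simp add: move_def vertices_iff)

lemma move_sle:
  assumes "w \<in> carrier W" "x \<in> vertices" "y \<in> vertices"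
  shows "sle (move w x) (move w y) \<longleftrightarrow> sle x y"
proof -
  obtain u P v Q where xy: "x = (u, P)" "y = (v, Q)" by (cases x, cases y) auto
  then have c: "u \<in> carrier W" "v \<in> carrier W" using assms by (simp_all add: vertices_iff)
  then have "winv (w \<cdot> v) \<cdot> (w \<cdot> u) = winv v \<cdot> u"
    using assms(1) by (simp add: W.inv_mult_group W.m_assoc)
  then show ?thesis by (simp add: xy move_def le_iff)
qed

lemma move_K:
  assumes w: "w \<in> carrier W" and \<sigma>: "\<sigma> \<in> K"
  shows "move w ` \<sigma> \<in> K"
proof -
  have "sle a b \<or> sle b a" if "a \<in> move w ` \<sigma>" "b \<in> move w ` \<sigma>" for a b
    using that KD[OF \<sigma>] move_sle[OF w] by blast
  then show ?thesis
    using \<sigma> move_vertices[OF w] KD(1)[OF \<sigma>] sal.simplex_finite[OF \<sigma>]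
    unfolding derived_complex_def by blast
qed

text \<open>In coordinates the action is a translation, from which continuity and the action laws
  can be read off. A pair with \<open>u\<close> outside \<open>W\<close> is no vertex and receives
  0.\<close>

lemma act_eq:
  assumes w: "w \<in> carrier W" and f: "f \<in> geom K"
  shows "act w f (u, P) = (if u \<in> carrier W then f (winv w \<cdot> u, P) else 0)"
proof -
  note s = sal.geom_supp(1)[OF f]
  have V: "x \<in> vertices" if "x \<in> supp f" for x using KD(1)[OF s that that] .
  have "act w f (u, P) = (\<Sum>x\<in>{x \<in> supp f. move w x = (u, P)}. f x)"
    unfolding act_def by (rule realization_map_alt) (simp_all add: sal.simplex_finite[OF s])
  also have "\<dots> = (if u \<in> carrier W then f (winv w \<cdot> u, P) else 0)"
  proof (cases "u \<in> carrier W")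
    case True
    let ?x = "(winv w \<cdot> u, P)"
    have "move w x = (u, P) \<longleftrightarrow> x = ?x" if x: "x \<in> supp f" for x
      using vertices_fst[OF V[OF x]] w True by (cases x) (auto simp: move_def)
    then have "{x \<in> supp f. move w x = (u, P)} = {x \<in> {?x}. f x \<noteq> 0}" by (auto simp: supp_def)
    moreover have "(\<Sum>x\<in>{x \<in> {?x}. f x \<noteq> 0}. f x) = (\<Sum>x\<in>{?x}. f x)"
      by (intro sum.mono_neutral_left) auto
    ultimately show ?thesis using True by simp
  next
    case False
    then have "move w x \<noteq> (u, P)" if "x \<in> supp f" for x
      using move_vertices[OF w V[OF that]] by (auto simp: vertices_iff)
    then show ?thesis using False by (auto intro!: sum.neutral)
  qed
  finally show ?thesis .
qed

lemma geom_outside: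
  assumes f: "f \<in> geom K" and u: "u \<notin> carrier W"
  shows "f (u, P) = 0"
  using KD(1)[OF sal.geom_supp(1)[OF f], of "(u, P)" "(u, P)"] u by (auto simp: supp_def vertices_iff)

lemma act_geom: "w \<in> carrier W \<Longrightarrow> f \<in> geom K \<Longrightarrow> act w f \<in> geom K"
  unfolding act_def using sal.geom_supp[of f]
  by (intro sal.geomI[OF move_K realization_map_simplex]) (auto intro: sal.simplex_finite)

lemma act_continuous:
  assumes w: "w \<in> carrier W"
  shows "continuous_map sal.X sal.X (act w)"
proof -
  have "continuous_on (geom K) (act w)"
  proof (rule continuous_on_coordinatewise_then_product)
    fix x :: "'s sal_vertex"
    obtain u P where x: "x = (u, P)" by (cases x)
    have "continuous_on (geom K) (\<lambda>f. if u \<in> carrier W then f (winv w \<cdot> u, P) else 0)"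
      by (cases "u \<in> carrier W") (auto intro: continuous_on_subset[OF continuous_on_product_coordinates])
    then show "continuous_on (geom K) (\<lambda>f. act w f x)"
      by (rule continuous_on_eq) (simp add: x act_eq[OF w])
  qed
  then show ?thesis
    using act_geom[OF w] by (auto simp: continuous_map_in_subtopology)
qed

lemma act_one: "f \<in> geom K \<Longrightarrow> act \<one>\<^bsub>W\<^esub> f = f"
proof
  fix x :: "'s sal_vertex" assume f: "f \<in> geom K"
  obtain u P where x: "x = (u, P)" by (cases x)
  show "act \<one>\<^bsub>W\<^esub> f x = f x"
    using act_eq[OF W.one_closed f, of u P] geom_outside[OF f, of u P] by (auto simp: x)
qed

lemma act_mult:
  assumes g: "g \<in> carrier W" and h: "h \<in> carrier W" and f: "f \<in> geom K"
  shows "act (g \<cdot> h) f = act g (act h f)"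
proof
  fix x :: "'s sal_vertex"
  obtain u P where x: "x = (u, P)" by (cases x)
  show "act (g \<cdot> h) f x = act g (act h f) x"
    using g h by (simp add: x act_eq act_geom f W.inv_mult_group W.m_assoc)
qed

lemma act_vertex: "act w (pt x) = pt (move w x)"
  by (simp add: act_def realization_map_vertex)

lemma act_edge: "act w \<circ> edge x y = edge (move w x) (move w y)"
proof
  fix t
  show "(act w \<circ> edge x y) t = edge (move w x) (move w y) t"
    unfolding comp_def edge_def act_def
    by (subst realization_map_segment[of "{x, y}"]) (auto simp: realization_map_vertex)
qed

lemma act_gen_path:
  assumes "w \<in> carrier W" "v \<in> carrier W" "s \<in> S"
  shows "act w \<circ> gen_path v s = gen_path (w \<cdot> v) s"
  using assms by (simp add: gen_path_def path_join_comp act_edge move_def W.m_assoc)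

lemma act_word_path:
  assumes "u \<in> lists (S \<times> UNIV)" "w \<in> carrier W" "v \<in> carrier W"
  shows "act w \<circ> word_path v u = word_path (w \<cdot> v) u"
  using assms
proof (induction u arbitrary: v)
  case Nil
  then show ?case by (auto simp: act_vertex move_def)
next
  case (Cons x u)
  obtain s b where x: "x = (s, b)" "s \<in> S" using Cons by (cases x) auto
  have l: "act w \<circ> letter_path v x = letter_path (w \<cdot> v) x"
    using Cons.prems x by (simp add: letter_path_def act_gen_path path_rev_comp W.m_assoc)
  have "act w \<circ> word_path (v \<cdot> gen s) u = word_path (w \<cdot> (v \<cdot> gen s)) u"
    using Cons.prems x by (intro Cons.IH) simp_all
  then show ?case
    unfolding word_path.simps path_join_comp l using Cons.prems x by (simp add: W.m_assoc)
qed

text \<open>The open star of a vertex \<open>v\<close> in the support of the point serves as slice.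
  If \<open>f\<close> and its translate by \<open>g\<close> both lie in it, then \<open>v\<close>
  and its translate by g^-1 are vertices of one simplex with the same type, so they coincide and
  \<open>g\<close> is trivial.\<close>

lemma sal_regular_covering: "regular_covering sal.X (orbit_space W act sal.X) (orbit W act)"
proof (rule regular_covering_orbit_space[OF W.is_group])
  fix x assume x: "x \<in> topspace sal.X"
  then have xg: "x \<in> geom K" by simp
  obtain v where v: "v \<in> supp x"
    using closed_simplex_supp(2)[OF sal.geom_supp(2)[OF xg] sal.simplex_finite[OF sal.geom_supp(1)[OF xg]]] by blast
  let ?U = "geom K \<inter> {f. 0 < f v}"
  have "open {f :: 's sal_vertex \<Rightarrow> real. 0 < f v}"
    by (intro open_Collect_less continuous_on_const continuous_on_product_coordinates)
  then have "openin sal.X ?U" by (simp add: openin_open_Int)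
  moreover have "x \<in> ?U" using v xg sal.geom_supp(3)[OF xg, of v] by (auto simp: supp_def)
  moreover have "g = \<one>\<^bsub>W\<^esub>" if g: "g \<in> carrier W" and f: "f \<in> ?U" and gf: "act g f \<in> ?U" for g f
  proof -
    obtain u P where vu: "v = (u, P)" by (cases v)
    have fg: "f \<in> geom K" using f by simp
    note s = sal.geom_supp(1)[OF fg]
    have vs: "v \<in> supp f" using f by (auto simp: supp_def)
    then have V: "v \<in> vertices" using KD(1)[OF s] by blast
    then have u: "u \<in> carrier W" by (simp add: vu vertices_iff)
    let ?v = "(winv g \<cdot> u, P)"
    have vs': "?v \<in> supp f" using gf act_eq[OF g fg, of u P] u by (auto simp: vu supp_def)
    then have V': "?v \<in> vertices" using KD(1)[OF s] by blast
    have "v = ?v"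
      using KD(2)[OF s vs vs'] le_same[OF V V'] le_same[OF V' V] by (auto simp: vu)
    then have "winv g \<cdot> u = u" by (simp add: vu)
    then have "winv g = \<one>\<^bsub>W\<^esub>" using g u by (metis W.inv_closed W.r_cancel_one')
    then show ?thesis using g by (metis W.inv_inv W.inv_one)
  qed
  ultimately show "\<exists>U. openin sal.X U \<and> x \<in> U \<and>
      (\<forall>g\<in>carrier W. \<forall>u\<in>U. act g u \<in> U \<longrightarrow> g = \<one>\<^bsub>W\<^esub>)" by blast
qed (rule act_continuous, assumption, simp_all add: act_one act_mult)

section \<open>The fundamental groups\<close>

abbreviation "Bar \<equiv> salvetti_bar S m"
abbreviation "p \<equiv> sal_proj S m"
abbreviation "x1 \<equiv> sal_point \<one>\<^bsub>W\<^esub>"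
abbreviation "x0 \<equiv> p x1"

lemma regular_covering_p: "regular_covering sal.X Bar p"
  using sal_regular_covering by (simp add: salvetti_bar_def sal_proj_def salvetti_eq)

lemma covering_p: "covering_map sal.X Bar p"
  using regular_covering_p by (simp add: regular_covering_def)

lemma continuous_p: "continuous_map sal.X Bar p"
  by (rule covering_mapD(1)[OF covering_p])

lemma p_eq_imp:
  assumes "f \<in> geom K" "p f = p f'"
  shows "\<exists>g\<in>carrier W. f = act g f'"
proof -
  have "act \<one>\<^bsub>W\<^esub> f \<in> p f" by (auto simp: sal_proj_def orbit_def)
  then show ?thesis using assms by (auto simp: act_one sal_proj_def orbit_def)
qed

lemma p_act:
  assumes g: "g \<in> carrier W" and f: "f \<in> geom K"
  shows "p (act g f) = p f"
proof (intro subset_antisym subsetI)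
  fix y assume "y \<in> p (act g f)"
  then obtain h where "h \<in> carrier W" "y = act h (act g f)" by (auto simp: sal_proj_def orbit_def)
  then show "y \<in> p f"
    using g f act_mult[of h g f] unfolding sal_proj_def orbit_def
    by (intro CollectI exI[of _ "h \<cdot> g"]) simp
next
  fix y assume "y \<in> p f"
  then obtain h where h: "h \<in> carrier W" "y = act h f" by (auto simp: sal_proj_def orbit_def)
  have "act (h \<cdot> winv g) (act g f) = act (h \<cdot> winv g \<cdot> g) f"
    using g f h by (intro act_mult[symmetric]) simp_all
  also have "\<dots> = y" using g h by (simp add: W.m_assoc)
  finally show "y \<in> p (act g f)"
    using g h unfolding sal_proj_def orbit_def by (intro CollectI exI[of _ "h \<cdot> winv g"]) simp
qed

lemma x1_eq: "x1 = pt (\<one>\<^bsub>W\<^esub>, {})"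
  by (simp add: sal_point_def)

lemma act_x1: "g \<in> carrier W \<Longrightarrow> act g x1 = pt (g, {})"
  by (simp add: x1_eq act_vertex move_def)

lemma pt_geom: "x \<in> vertices \<Longrightarrow> pt x \<in> geom K"
  using sal.geomI[OF K_edge sal.vertex_point_geom[OF K_edge]] le_refl by blast

lemma x1_geom: "x1 \<in> geom K"
  unfolding x1_eq by (intro pt_geom vertex_small) simp

lemma p_pt: "g \<in> carrier W \<Longrightarrow> p (pt (g, {})) = x0"
  using p_act[OF _ x1_geom] by (simp add: act_x1)

section \<open>Loops in the quotient as words\<close>

abbreviation "words \<equiv> lists (S \<times> (UNIV :: bool set))"

definition wp :: "'s gword \<Rightarrow> real \<Rightarrow> 's sal_vertex \<Rightarrow> real" where
  "wp a = word_path \<one>\<^bsub>W\<^esub> a"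

lemma wp:
  assumes "a \<in> words"
  shows "pathin sal.X (wp a)" "wp a 0 = x1" "wp a 1 = pt (ev a, {})"
  using word_path[OF assms W.one_closed] ev_closed[OF assms] by (simp_all add: wp_def x1_eq)

lemma p_wp_loop:
  assumes a: "a \<in> words"
  shows "p \<circ> wp a \<in> loops Bar x0"
  using wp[OF a] p_pt[OF ev_closed[OF a]] pathin_compose[OF wp(1)[OF a] continuous_p] by (simp add: loops_iff)

lemma wp_homotopic:
  assumes "pathin sal.X c" "c 0 = x1" "c 1 = pt (w, {})"
  shows "\<exists>a\<in>words. ev a = w \<and> path_homotopic sal.X c (wp a)"
proof -
  obtain a where "a \<in> words" "\<one>\<^bsub>W\<^esub> \<cdot> ev a = w" "path_homotopic sal.X c (wp a)"
    using path_homotopic_word_path[of c "\<one>\<^bsub>W\<^esub>" w] assms unfolding x1_eq wp_def by blast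
  then show ?thesis by auto
qed

text \<open>The lift starting at x(1) ends over the base point, so it ends at some x(g) and is
  homotopic to a word path.\<close>

lemma loop_homotopic_p_wp:
  assumes c: "c \<in> loops Bar x0"
  shows "\<exists>a\<in>words. path_homotopic Bar c (p \<circ> wp a)"
proof -
  have c': "pathin Bar c" "x1 \<in> topspace sal.X" "p x1 = c 0" "c 1 = x0"
    using c x1_geom by (simp_all add: loops_iff)
  have "\<exists>d. pathin sal.X d \<and> d 0 = x1 \<and> (\<forall>t\<in>{0..1}. p (d t) = c t)"
    by (rule covering_map_lift_path[OF covering_p]) (use c' in simp_all)
  then obtain d where d: "pathin sal.X d" "d 0 = x1" "\<forall>t\<in>{0..1}. p (d t) = c t"
    by blast
  have "d 1 \<in> geom K" using pathin_in_topspace[OF d(1), of 1] by simp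
  moreover have "p (d 1) = p x1" using d(3) c'(4) by simp
  ultimately obtain g where g: "g \<in> carrier W" "d 1 = act g x1"
    using p_eq_imp by blast
  obtain a where a: "a \<in> words" "path_homotopic sal.X d (wp a)"
    using wp_homotopic[OF d(1,2)] g by (auto simp: act_x1)
  have "path_homotopic Bar (p \<circ> d) c"
    by (rule path_homotopic_eq[OF pathin_compose[OF d(1) continuous_p]]) (simp add: d(3))
  then show ?thesis
    using path_homotopic_compose[OF a(2) continuous_p] a(1) path_homotopic_sym path_homotopic_trans by blast
qed

text \<open>The three conditions are linked in a circle: homotopies lift, homotopic word paths have
  equal classes, equal classes give homotopic paths, and homotopies project.\<close>

lemma p_wp_homotopic_iff:
  assumes a: "a \<in> words" and b: "b \<in> words"
  shows "path_homotopic Bar (p \<circ> wp a) (p \<circ> wp b) \<longleftrightarrow> cls a = cls b"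
    "path_homotopic sal.X (wp a) (wp b) \<longleftrightarrow> cls a = cls b"
proof -
  have 1: "path_homotopic sal.X (wp a) (wp b)" if "path_homotopic Bar (p \<circ> wp a) (p \<circ> wp b)"
    using wp[OF a] wp[OF b] that by (intro covering_map_lift_homotopy[OF covering_p]) simp_all
  have 2: "cls a = cls b" if "path_homotopic sal.X (wp a) (wp b)"
    using word_path_homotopic_imp_cls_eq[OF a b W.one_closed] that by (simp add: wp_def)
  have 3: "path_homotopic sal.X (wp a) (wp b)" if "cls a = cls b"
    using that word_path_pres_eq[OF _ W.one_closed] pres_class_eq_iff[OF a, of A_rel b] by (simp add: wp_def)
  have 4: "path_homotopic Bar (p \<circ> wp a) (p \<circ> wp b)" if "path_homotopic sal.X (wp a) (wp b)"
    by (rule path_homotopic_compose[OF that continuous_p])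
  show "path_homotopic Bar (p \<circ> wp a) (p \<circ> wp b) \<longleftrightarrow> cls a = cls b"
    "path_homotopic sal.X (wp a) (wp b) \<longleftrightarrow> cls a = cls b"
    using 1 2 3 4 by blast+
qed

text \<open>The second loop has to be continued from x(ev a) rather than x(1). Translation by
  \<open>ev a\<close> moves its lift there and disappears in the quotient.\<close>

lemma p_wp_append:
  assumes a: "a \<in> words" and b: "b \<in> words"
  shows "path_homotopic Bar (path_join (p \<circ> wp a) (p \<circ> wp b)) (p \<circ> wp (a @ b))"
proof -
  note e = ev_closed[OF a]
  have "(p \<circ> wp b) t = (p \<circ> word_path (ev a) b) t" if t: "0 \<le> t" "t \<le> 1" for t
  proof -
    have "act (ev a) (wp b t) = word_path (ev a) b t"
      using act_word_path[OF b e W.one_closed] e by (simp add: wp_def fun_eq_iff)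
    moreover have "p (act (ev a) (wp b t)) = p (wp b t)"
      using pathin_in_topspace[OF wp(1)[OF b] t] by (intro p_act e) simp
    ultimately show ?thesis by simp
  qed
  then have 1: "path_homotopic Bar (p \<circ> wp b) (p \<circ> word_path (ev a) b)"
    using pathin_compose[OF wp(1)[OF b] continuous_p] by (intro path_homotopic_eq)
  have "path_homotopic Bar (path_join (p \<circ> wp a) (p \<circ> wp b)) (path_join (p \<circ> wp a) (p \<circ> word_path (ev a) b))"
    using p_wp_loop[OF a] p_wp_loop[OF b]
    by (intro path_homotopic_join[OF path_homotopic_refl 1]) (auto simp: loops_iff)
  also have "path_join (p \<circ> wp a) (p \<circ> word_path (ev a) b) = p \<circ> path_join (wp a) (word_path (ev a) b)"
    by (simp add: path_join_comp)
  also have "path_homotopic Bar \<dots> (p \<circ> wp (a @ b))"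
    using word_path_append[OF a b W.one_closed] e
    by (intro path_homotopic_compose[OF path_homotopic_sym continuous_p]) (simp add: wp_def)
  finally show ?thesis .
qed

section \<open>Identification with the Artin group and the boundary map\<close>

abbreviation "\<pi>Bar \<equiv> fundamental_group Bar x0"
abbreviation "\<pi>Sal \<equiv> fundamental_group sal.X x1"

definition bar_class :: "'s gword \<Rightarrow> (real \<Rightarrow> ('s sal_vertex \<Rightarrow> real) set) set" where
  "bar_class a = loop_class Bar x0 (p \<circ> wp a)"

definition sal_class :: "'s gword \<Rightarrow> (real \<Rightarrow> 's sal_vertex \<Rightarrow> real) set" where
  "sal_class a = loop_class sal.X x1 (wp a)"

lemma bar_carrier: "carrier \<pi>Bar = bar_class ` words"
proof -
  have "loop_class Bar x0 c \<in> bar_class ` words" if c: "c \<in> loops Bar x0" for c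
  proof -
    obtain a where a: "a \<in> words" "path_homotopic Bar c (p \<circ> wp a)"
      using loop_homotopic_p_wp[OF c] by blast
    then have "loop_class Bar x0 c = bar_class a"
      unfolding bar_class_def by (simp add: loop_class_eq_iff[OF c p_wp_loop[OF a(1)]])
    then show ?thesis using a(1) by blast
  qed
  then show ?thesis
    unfolding fundamental_group_carrier bar_class_def using p_wp_loop by blast
qed

lemma bar_class_eq: "a \<in> words \<Longrightarrow> b \<in> words \<Longrightarrow> bar_class a = bar_class b \<longleftrightarrow> cls a = cls b"
  unfolding bar_class_def by (simp add: loop_class_eq_iff p_wp_loop p_wp_homotopic_iff)

lemma bar_mult:
  assumes "a \<in> words" "b \<in> words"
  shows "bar_class a \<otimes>\<^bsub>\<pi>Bar\<^esub> bar_class b = bar_class (a @ b)"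
proof -
  have "a @ b \<in> words" using assms by simp
  then show ?thesis
    unfolding bar_class_def fundamental_group_mult[OF p_wp_loop[OF assms(1)] p_wp_loop[OF assms(2)]]
    using p_wp_append[OF assms]
    by (subst loop_class_eq_iff) (intro loops_join p_wp_loop assms)+
qed

text \<open>The spelling word is chosen arbitrarily; \<open>bar_class_eq\<close> makes the value
  independent of it and also gives injectivity.\<close>

definition \<Phi> :: "(real \<Rightarrow> ('s sal_vertex \<Rightarrow> real) set) set \<Rightarrow> 's gword set" where
  "\<Phi> C = cls (SOME a. a \<in> words \<and> bar_class a = C)"

lemma \<Phi>_bar_class: "a \<in> words \<Longrightarrow> \<Phi> (bar_class a) = cls a"
proof -
  assume a: "a \<in> words"
  let ?b = "SOME b. b \<in> words \<and> bar_class b = bar_class a"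
  have "?b \<in> words \<and> bar_class ?b = bar_class a"
    using a by (intro someI[of "\<lambda>b. b \<in> words \<and> bar_class b = bar_class a" a]) simp
  then show ?thesis unfolding \<Phi>_def using a bar_class_eq by blast
qed

lemma \<Phi>_iso: "\<Phi> \<in> iso \<pi>Bar A"
proof -
  have "\<Phi> \<in> hom \<pi>Bar A"
    unfolding hom_def bar_carrier
    by (auto simp: \<Phi>_bar_class bar_mult A_class_mult A_class_closed simp del: in_lists_conv_set del: in_listsD)
  moreover have "inj_on \<Phi> (carrier \<pi>Bar)"
    unfolding bar_carrier by (rule inj_onI, elim imageE) (simp add: \<Phi>_bar_class bar_class_eq)
  moreover have "\<Phi> ` carrier \<pi>Bar = carrier A"
    unfolding bar_carrier A_carrier image_image by (rule image_cong) (simp_all add: \<Phi>_bar_class)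
  ultimately show ?thesis by (simp add: iso_def bij_betw_def)
qed

lemma theta_cls: "a \<in> words \<Longrightarrow> artin_theta S m (cls a) = ev a"
  unfolding artin_theta_def ev_def
  by (rule pres_hom_class[OF group_coxeter_group gen_Pi ev_artin_rel])

lemma ev_cls: "a \<in> words \<Longrightarrow> b \<in> words \<Longrightarrow> cls a = cls b \<Longrightarrow> ev a = ev b"
  using theta_cls by metis

lemma ev_surj: "w \<in> carrier W \<Longrightarrow> \<exists>a\<in>words. ev a = w"
  using wd_surj[of w] ev_pos_word pos_word_lists by metis

lemma ev_image: "ev ` words = carrier W"
  using ev_surj ev_closed by blast

abbreviation "\<delta> \<equiv> covering_boundary W act sal.X x1"

text \<open>The word path itself is a lift with end x(ev a). Any other admissible lift is homotopic
  to the path of some word \<open>b\<close>; projecting gives \<open>cls a = cls b\<close>, so its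
  end is the same and the definite description is justified.\<close>

lemma \<delta>_bar_class:
  assumes a: "a \<in> words"
  shows "\<delta> (bar_class a) = ev a"
  unfolding covering_boundary_def
proof (rule the_equality)
  show "ev a \<in> carrier W \<and> (\<exists>c. pathin sal.X c \<and> c 0 = x1 \<and> c 1 = act (ev a) x1 \<and> orbit W act \<circ> c \<in> bar_class a)"
    using wp[OF a] ev_closed[OF a] p_wp_loop[OF a] act_x1[OF ev_closed[OF a]]
    by (intro conjI exI[of _ "wp a"]) (auto simp: bar_class_def loop_class_alt loops_iff simp flip: sal_proj_def)
next
  fix g assume "g \<in> carrier W \<and> (\<exists>c. pathin sal.X c \<and> c 0 = x1 \<and> c 1 = act g x1 \<and> orbit W act \<circ> c \<in> bar_class a)"
  then obtain c where g: "g \<in> carrier W" and c: "pathin sal.X c" "c 0 = x1" "c 1 = pt (g, {})" "p \<circ> c \<in> bar_class a"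
    by (auto simp: act_x1 simp flip: sal_proj_def)
  obtain b where b: "b \<in> words" "ev b = g" "path_homotopic sal.X c (wp b)"
    using wp_homotopic[OF c(1-3)] by blast
  have "path_homotopic Bar (p \<circ> wp a) (p \<circ> c)"
    using c(4) by (simp add: bar_class_def loop_class_alt[OF p_wp_loop[OF a]])
  then have "path_homotopic Bar (p \<circ> wp a) (p \<circ> wp b)"
    using path_homotopic_compose[OF b(3) continuous_p] path_homotopic_trans by blast
  then have "cls a = cls b" by (simp add: p_wp_homotopic_iff a b)
  then show "g = ev a" using ev_cls[OF a b(1)] b(2) by simp
qed

section \<open>Loops in the complex and the colored Artin group\<close>

lemma wp_loop: "a \<in> words \<Longrightarrow> ev a = \<one>\<^bsub>W\<^esub> \<Longrightarrow> wp a \<in> loops sal.X x1"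
  using wp[of a] by (simp add: loops_iff x1_eq)

lemma sal_carrier: "carrier \<pi>Sal = sal_class ` {a \<in> words. ev a = \<one>\<^bsub>W\<^esub>}"
proof -
  have "loop_class sal.X x1 c \<in> sal_class ` {a \<in> words. ev a = \<one>\<^bsub>W\<^esub>}" if c: "c \<in> loops sal.X x1" for c
  proof -
    have "pathin sal.X c" "c 0 = x1" "c 1 = pt (\<one>\<^bsub>W\<^esub>, {})" using c by (simp_all add: loops_iff x1_eq)
    then obtain a where a: "a \<in> words" "ev a = \<one>\<^bsub>W\<^esub>" "path_homotopic sal.X c (wp a)"
      using wp_homotopic by blast
    then have "loop_class sal.X x1 c = sal_class a"
      unfolding sal_class_def by (simp add: loop_class_eq_iff[OF c wp_loop[OF a(1,2)]])
    then show ?thesis using a by blast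
  qed
  then show ?thesis
    unfolding fundamental_group_carrier sal_class_def using wp_loop by blast
qed

lemma sal_class_eq:
  assumes "a \<in> words" "ev a = \<one>\<^bsub>W\<^esub>" "b \<in> words" "ev b = \<one>\<^bsub>W\<^esub>"
  shows "sal_class a = sal_class b \<longleftrightarrow> cls a = cls b"
  unfolding sal_class_def loop_class_eq_iff[OF wp_loop[OF assms(1,2)] wp_loop[OF assms(3,4)]]
  by (rule p_wp_homotopic_iff(2)[OF assms(1,3)])

abbreviation "p_star \<equiv> fundamental_group_map Bar p x1"

lemma p_star_class: "a \<in> words \<Longrightarrow> ev a = \<one>\<^bsub>W\<^esub> \<Longrightarrow> p_star (sal_class a) = bar_class a"
  unfolding sal_class_def bar_class_def by (rule fundamental_group_map_class[OF continuous_p wp_loop])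

text \<open>Upstairs and downstairs, two word loops are homotopic exactly when their words have the
  same class in \<open>A\<close>.\<close>

lemma p_star_mon: "p_star \<in> mon \<pi>Sal \<pi>Bar"
proof -
  have "inj_on p_star (carrier \<pi>Sal)"
    unfolding sal_carrier
    by (rule inj_onI, elim imageE) (simp add: p_star_class bar_class_eq sal_class_eq)
  then show ?thesis
    unfolding mon_def using fundamental_group_map_hom[OF continuous_p] by blast
qed

lemma p_star_image: "p_star ` carrier \<pi>Sal = bar_class ` {a \<in> words. ev a = \<one>\<^bsub>W\<^esub>}"
  unfolding sal_carrier image_image by (rule image_cong) (simp_all add: p_star_class)

lemma \<delta>_epi: "\<delta> \<in> epi \<pi>Bar W"
proof -
  have "\<delta> \<in> hom \<pi>Bar W"
    unfolding hom_def bar_carrier by (auto simp: \<delta>_bar_class bar_mult del: in_listsD)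
  moreover have "\<delta> ` carrier \<pi>Bar = carrier W"
    unfolding bar_carrier image_image ev_image[symmetric] by (rule image_cong) (simp_all add: \<delta>_bar_class)
  ultimately show ?thesis by (simp add: epi_def)
qed

lemma \<delta>_kernel: "kernel \<pi>Bar W \<delta> = bar_class ` {a \<in> words. ev a = \<one>\<^bsub>W\<^esub>}"
proof -
  have "x \<in> words \<and> \<delta> (bar_class x) = \<one>\<^bsub>W\<^esub> \<longleftrightarrow> x \<in> words \<and> ev x = \<one>\<^bsub>W\<^esub>" for x
    using \<delta>_bar_class[of x] by metis
  then show ?thesis
    unfolding kernel_def bar_carrier Compr_image_eq by (simp only:)
qed

lemma theta_kernel: "kernel A W (artin_theta S m) = cls ` {a \<in> words. ev a = \<one>\<^bsub>W\<^esub>}"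
proof -
  have "x \<in> words \<and> artin_theta S m (cls x) = \<one>\<^bsub>W\<^esub> \<longleftrightarrow> x \<in> words \<and> ev x = \<one>\<^bsub>W\<^esub>" for x
    using theta_cls[of x] by metis
  then show ?thesis
    unfolding kernel_def A_carrier Compr_image_eq by (simp only:)
qed

lemma short_exact_covering: "short_exact \<pi>Sal \<pi>Bar W p_star \<delta>"
proof -
  have "x0 \<in> topspace Bar"
    using continuous_p x1_geom by (auto simp: continuous_map_def)
  then show ?thesis
    unfolding short_exact_def
    using group_fundamental_group[of x1 sal.X] group_fundamental_group[of x0 Bar] x1_geom W.is_group
      p_star_mon \<delta>_epi p_star_image \<delta>_kernel by simp
qed

abbreviation "CA \<equiv> colored_artin_group S m"

lemma CA_carrier: "carrier CA = kernel A W (artin_theta S m)"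
  by (simp add: colored_artin_group_def)

lemma short_exact_CA: "short_exact CA A W (\<lambda>a. a) (artin_theta S m)"
proof -
  have hom: "artin_theta S m \<in> hom A W" by (rule artin_theta(1)[OF coxeter_matrix])
  then interpret h: group_hom A W "artin_theta S m"
    by (intro group_hom.intro group_hom_axioms.intro A.is_group W.is_group)
  have "group CA"
    using A.subgroup_imp_group[OF h.subgroup_kernel] by (simp add: colored_artin_group_def)
  moreover have "(\<lambda>a. a) \<in> mon CA A"
    by (auto simp: mon_def hom_def colored_artin_group_def kernel_def)
  moreover have "artin_theta S m ` carrier A = carrier W"
    unfolding A_carrier image_image ev_image[symmetric] by (rule image_cong) (simp_all add: theta_cls)
  ultimately show ?thesis
    using hom A.is_group W.is_group by (simp add: short_exact_def epi_def CA_carrier)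
qed

text \<open>Restricting \<Phi> along \<open>p_star\<close> makes the square commute by construction.
  Its image is the kernel of the homomorphism to \<open>W\<close> because both consist of the
  classes of words with value 1 in \<open>W\<close>.\<close>

lemma \<Psi>_iso: "(\<lambda>C. \<Phi> (p_star C)) \<in> iso \<pi>Sal CA"
proof -
  have \<Phi>: "\<Phi> \<in> hom \<pi>Bar A" "inj_on \<Phi> (carrier \<pi>Bar)"
    using \<Phi>_iso by (auto simp: iso_def bij_betw_def)
  have ps: "p_star \<in> hom \<pi>Sal \<pi>Bar" "inj_on p_star (carrier \<pi>Sal)"
    using p_star_mon by (auto simp: mon_def)
  have img: "(\<lambda>C. \<Phi> (p_star C)) ` carrier \<pi>Sal = carrier CA"
    unfolding CA_carrier theta_kernel sal_carrier image_image
    by (rule image_cong) (simp_all add: p_star_class \<Phi>_bar_class)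
  have "(\<lambda>C. \<Phi> (p_star C)) \<in> hom \<pi>Sal A"
    using hom_compose[OF ps(1) \<Phi>(1)] by (simp add: comp_def)
  then have "(\<lambda>C. \<Phi> (p_star C)) \<in> hom \<pi>Sal CA"
    using img by (auto simp: hom_def colored_artin_group_def)
  moreover have "inj_on (\<lambda>C. \<Phi> (p_star C)) (carrier \<pi>Sal)"
    using comp_inj_on[OF ps(2) inj_on_subset[OF \<Phi>(2)]] ps(1) by (auto simp: comp_def hom_def)
  ultimately show ?thesis
    using img by (simp add: iso_def bij_betw_def)
qed

lemma theta_\<Phi>: "C \<in> carrier \<pi>Bar \<Longrightarrow> artin_theta S m (\<Phi> C) = \<delta> C"
  unfolding bar_carrier by (auto simp: \<Phi>_bar_class theta_cls \<delta>_bar_class del: in_listsD)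

end

theorem theorem3p10:
  fixes S :: "'s set" and m :: "'s \<Rightarrow> 's \<Rightarrow> enat"
  assumes "finite S" and "coxeter_matrix S m"
  shows "let W = coxeter_group S m; A = artin_group S m; CA = colored_artin_group S m;
             \<theta> = artin_theta S m;
             Sal = salvetti S m; SalBar = salvetti_bar S m; p = sal_proj S m;
             x1 = sal_point \<one>\<^bsub>W\<^esub>; x0 = p x1;
             p_star = fundamental_group_map SalBar p x1;
             \<delta> = covering_boundary W (sal_act S m) Sal x1
         in regular_covering Sal SalBar p \<and>
            short_exact (fundamental_group Sal x1) (fundamental_group SalBar x0) W p_star \<delta> \<and>
            short_exact CA A W (\<lambda>a. a) \<theta> \<and>
            (\<exists>\<Phi> \<Psi>. \<Phi> \<in> iso (fundamental_group SalBar x0) A \<and>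
                   \<Psi> \<in> iso (fundamental_group Sal x1) CA \<and>
                   (\<forall>c \<in> carrier (fundamental_group Sal x1). \<Phi> (p_star c) = \<Psi> c) \<and>
                   (\<forall>c \<in> carrier (fundamental_group SalBar x0). \<theta> (\<Phi> c) = \<delta> c))"
proof -
  interpret salvetti_system S m
    using assms by unfold_locales
  show ?thesis
    unfolding Let_def salvetti_eq
    using regular_covering_p short_exact_covering short_exact_CA \<Phi>_iso \<Psi>_iso theta_\<Phi>
    by blast
qed

end
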